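(* Let $\phi_1,\ldots,\phi_n:\mathbb{R}\to\mathbb{R}$ be such that $$d\nu_n[y^{(1)},\ldots,y^{(n)}]:=\frac1{Z_n}\det\left[\phi_i(y_j^{(n)})\right]_{i,j=1}^n dy^{(n)}dy^{(n-1)}\cdots dy^{(1)}$$ defines a probability measure on the set of Gelfand-Tsetlin patterns of depth $n$, where $Z_n>0$ is a normalisation constant and $dy^{(r)}$ is Lebesgue measure on $\mathbb{R}^r$, and such that the integrals below are well defined and finite. Define $$\Phi_n(y):=\left(\prod_{k=1}^n\phi_k(y_k)\right)\Delta_n(y)\quad(y\in\mathbb{R}^n),\qquad B_n:=\int_{\mathbb{R}^n}dy\;\Phi_n(y).$$ Then $B_n\ne0$, and the random point field $(\mathrm{GT}_n,\nu_n)$ on $\{1,\ldots,n\}\times\mathbb{R}$ is determinantal with a correlation kernel $K_n:(\{1,\ldots,n\}\times\mathbb{R})^2\to\mathbb{R}$ which satisfies $$K_n((r,u),(s,v))=\frac1{B_n}\int_{\mathfrak{S}_n\mathcal{C}_n}dy\;\Phi_n(y)\sum_{j=1}^n1_{v\le u<y_j}\frac{(y_j-u)^{n-r-1}}{(n-r-1)!}\frac{\partial^{n-s}}{\partial v^{n-s}}\prod_{i\ne j}\left(\frac{v-y_i}{y_j-y_i}\right)$$ $$\qquad-\frac1{B_n}\int_{\mathfrak{S}_n\mathcal{C}_n}dy\;\Phi_n(y)\sum_{j=1}^n1_{v>u\ge y_j}\frac{(y_j-u)^{n-r-1}}{(n-r-1)!}\frac{\partial^{n-s}}{\partial v^{n-s}}\prod_{i\ne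 j}\left(\frac{v-y_i}{y_j-y_i}\right),$$ for all $r\in\{1,\ldots,n-1\}$, $s\in\{1,\ldots,n\}$ and $u,v\in\mathbb{R}$.
   Context: For $r\ge1$, $\mathcal{C}_r:=\{(y_1,\ldots,y_r)\in\mathbb{R}^r:y_1>\cdots>y_r\}$ with closure $\overline{\mathcal{C}_r}$. $\mathfrak{S}_n$ is the set of permutations of $\{1,\ldots,n\}$ and $\mathfrak{S}_n\mathcal{C}_n:=\bigcup_{\sigma\in\mathfrak{S}_n}\sigma(\mathcal{C}_n)$, the set of vectors in $\mathbb{R}^n$ with distinct coordinates. $\Delta_n(y):=\prod_{1\le i<j\le n}(y_i-y_j)$. The derivatives in $v$ act only on the polynomial to their right. The set $\overline{\mathrm{GT}_n}$ of Gelfand-Tsetlin patterns of depth $n$ consists of all $(y^{(1)},\ldots,y^{(n)})\in\overline{\mathcal{C}_1}\times\cdots\times\overline{\mathcal{C}_n}$ with $y_i^{(r+1)}\ge y_i^{(r)}\ge y_{i+1}^{(r+1)}$ for all $1\le i\le r\le n-1$. The subset $\mathrm{GT}_n$ consists of all $(y^{(1)},\ldots,y^{(n)})\in\mathcal{C}_1\times\cdots\times\mathcal{C}_n$ with $y_i^{(r+1)}>y_i^{(r)}\ge y_{i+1}^{(r+1)}$ for all $1\le i\le r\le n-1$; $\nu_n$ is supported on $\mathrm{GT}_n$. A pattern is identified with the configuration of the $\frac12n(n+1)$ particles $(r,y_i^{(r)})$, $1\le i\le r\le n$, in $\{1,\ldots,n\}\times\mathbb{R}$. Determinantal: for a random configuration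 of $N$ particles $\omega_1,\ldots,\omega_N$ in $E=\{1,\ldots,n\}\times\mathbb{R}$, and $m\le N$, let $\mathbb{M}_m[B]$ be the expected number of $m$-tuples $(\omega_{i_1},\ldots,\omega_{i_m})$ with distinct indices lying in $B\subset E^m$. The $m$th correlation function $\rho_m$ is the density of $\mathbb{M}_m$ with respect to the $m$-fold product of the reference measure (counting measure times Lebesgue measure). The field is determinantal with correlation kernel $K:E^2\to\mathbb{C}$ if all $\rho_m$ exist and $\rho_m(p_1,\ldots,p_m)=\det[K(p_i,p_j)]_{i,j=1}^m$ for all $m\le N$. *)

theory Defs
  imports "HOL-Probability.Probability" "Jordan_Normal_Form.Determinant"
begin

section \<open>Vectors and chambers\<close>

text \<open>
  A vector \<open>(y\<^sub>1, \<dots>, y\<^sub>r)\<close> of \<open>\<real>\<^sup>r\<close> is an extensional function on \<open>{1..r}\<close>, so that the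
  dimension can vary with the row of a pattern.
\<close>

definition lebesgue_vec :: "nat \<Rightarrow> (nat \<Rightarrow> real) measure" where
  "lebesgue_vec r = (\<Pi>\<^sub>M i\<in>{1..r}. lborel)"

definition weyl_chamber :: "nat \<Rightarrow> (nat \<Rightarrow> real) set" where
  "weyl_chamber r = {y \<in> {1..r} \<rightarrow>\<^sub>E UNIV. \<forall>i j. 1 \<le> i \<and> i < j \<and> j \<le> r \<longrightarrow> y i > y j}"

text \<open>
  The closure is taken in the product topology on \<^typ>\<open>nat \<Rightarrow> real\<close>, in which the extensional
  functions on \<open>{1..r}\<close> form a closed copy of \<open>\<real>\<^sup>r\<close>.
\<close>

definition weyl_chamber_closure :: "nat \<Rightarrow> (nat \<Rightarrow> real) set" where
  "weyl_chamber_closure r = closure (weyl_chamber r)"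

lemma weyl_chamber_closure_eq:
  "weyl_chamber_closure r =
     {y \<in> {1..r} \<rightarrow>\<^sub>E UNIV. \<forall>i j. 1 \<le> i \<and> i < j \<and> j \<le> r \<longrightarrow> y i \<ge> y j}"
    (is "_ = ?S")
proof
  have S: "?S = (\<Inter>i\<in>-{1..r}. {y. y i = undefined}) \<inter>
      (\<Inter>i. \<Inter>j\<in>{j. 1 \<le> i \<and> i < j \<and> j \<le> r}. {y. y j \<le> y i})"
    by (auto simp: PiE_iff extensional_def)
  have "closed {y :: nat \<Rightarrow> real. y i = undefined}" for i
    by (rule closed_Collect_eq) (intro continuous_on_product_coordinates continuous_intros)+
  moreover have "closed {y :: nat \<Rightarrow> real. y j \<le> y i}" for i j
    by (rule closed_Collect_le) (rule continuous_on_product_coordinates)+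
  ultimately have "closed ?S"
    unfolding S by (intro closed_Int closed_INT ballI)
  moreover have "weyl_chamber r \<subseteq> ?S"
    by (auto simp: weyl_chamber_def intro: less_imp_le)
  ultimately show "weyl_chamber_closure r \<subseteq> ?S"
    unfolding weyl_chamber_closure_def by (rule closure_minimal[rotated])
next
  show "?S \<subseteq> weyl_chamber_closure r"
  proof
    fix y assume y: "y \<in> ?S"
    define z where
      "z k = (\<lambda>i. if i \<in> {1..r} then y i - real i * inverse (real (Suc k)) else undefined)" for k
    have z: "z k \<in> weyl_chamber r" for k
    proof -
      have "z k i > z k j" if "1 \<le> i" "i < j" "j \<le> r" for i j
      proof -
        have "y i \<ge> y j" using y that by auto
        moreover have "real i * inverse (real (Suc k)) < real j * inverse (real (Suc k))"
          using that by (intro mult_strict_right_mono) auto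
        ultimately have "y j - real j * inverse (real (Suc k)) < y i - real i * inverse (real (Suc k))"
          by linarith
        then show ?thesis using that by (simp add: z_def del: of_nat_Suc)
      qed
      then show ?thesis by (auto simp: weyl_chamber_def z_def PiE_iff extensional_def)
    qed
    have "(\<lambda>k. z k i) \<longlonglongrightarrow> y i" for i
    proof (cases "i \<in> {1..r}")
      case True
      have "(\<lambda>k. y i - real i * inverse (real (Suc k))) \<longlonglongrightarrow> y i - real i * 0"
        by (intro tendsto_intros LIMSEQ_inverse_real_of_nat)
      then show ?thesis using True by (simp add: z_def)
    next
      case False
      then have "y i = undefined" using y by (auto simp: PiE_iff extensional_def)
      with False show ?thesis by (auto simp: z_def)
    qed
    then have "limitin (product_topology (\<lambda>_. euclidean) UNIV) z y sequentially"
      by (simp add: limitin_componentwise)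
    then have "z \<longlonglongrightarrow> y"
      by (simp add: euclidean_product_topology)
    with z show "y \<in> weyl_chamber_closure r"
      unfolding weyl_chamber_closure_def closure_sequential by blast
  qed
qed

definition permuted_chambers :: "nat \<Rightarrow> (nat \<Rightarrow> real) set" where
  "permuted_chambers n = (\<Union>\<sigma>\<in>{\<sigma>. \<sigma> permutes {1..n}}. (\<lambda>y. y \<circ> \<sigma>) ` weyl_chamber n)"

definition vandermonde :: "nat \<Rightarrow> (nat \<Rightarrow> real) \<Rightarrow> real" where
  "vandermonde n y = (\<Prod>i\<in>{1..n}. \<Prod>j\<in>{i<..n}. y i - y j)"

section \<open>Gelfand-Tsetlin patterns\<close>

definition GT_closed :: "nat \<Rightarrow> (nat \<Rightarrow> nat \<Rightarrow> real) set" where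
  "GT_closed n = {y \<in> (\<Pi>\<^sub>E r\<in>{1..n}. weyl_chamber_closure r).
     \<forall>i r. 1 \<le> i \<and> i \<le> r \<and> r \<le> n - 1 \<longrightarrow>
       y (r + 1) i \<ge> y r i \<and> y r i \<ge> y (r + 1) (i + 1)}"

definition GT_patterns :: "nat \<Rightarrow> (nat \<Rightarrow> nat \<Rightarrow> real) set" where
  "GT_patterns n = {y \<in> (\<Pi>\<^sub>E r\<in>{1..n}. weyl_chamber r).
     \<forall>i r. 1 \<le> i \<and> i \<le> r \<and> r \<le> n - 1 \<longrightarrow>
       y (r + 1) i > y r i \<and> y r i \<ge> y (r + 1) (i + 1)}"

definition lebesgue_pattern :: "nat \<Rightarrow> (nat \<Rightarrow> nat \<Rightarrow> real) measure" where
  "lebesgue_pattern n = (\<Pi>\<^sub>M r\<in>{1..n}. lebesgue_vec r)"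

text \<open>
  The functions \<open>\<phi>\<^sub>1, \<dots>, \<phi>\<^sub>n\<close> are \<open>\<phi> 1, \<dots>, \<phi> n\<close>; matrices are indexed from \<open>0\<close>.
\<close>

definition nu_density :: "nat \<Rightarrow> (nat \<Rightarrow> real \<Rightarrow> real) \<Rightarrow> real \<Rightarrow> (nat \<Rightarrow> nat \<Rightarrow> real) \<Rightarrow> real" where
  "nu_density n \<phi> Z y = indicator (GT_closed n) y *
     (1 / Z * Determinant.det (Matrix.mat n n (\<lambda>(i, j). \<phi> (Suc i) (y n (Suc j)))))"

definition nu :: "nat \<Rightarrow> (nat \<Rightarrow> real \<Rightarrow> real) \<Rightarrow> real \<Rightarrow> (nat \<Rightarrow> nat \<Rightarrow> real) measure" where
  "nu n \<phi> Z = density (lebesgue_pattern n) (\<lambda>y. ennreal (nu_density n \<phi> Z y))"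

text \<open>
  Since \<^const>\<open>ennreal\<close> truncates negative values, that the (possibly signed) density defines a
  measure has to be required separately from \<^const>\<open>prob_space\<close>.
\<close>

definition defines_probability :: "nat \<Rightarrow> (nat \<Rightarrow> real \<Rightarrow> real) \<Rightarrow> real \<Rightarrow> bool" where
  "defines_probability n \<phi> Z \<longleftrightarrow>
     nu_density n \<phi> Z \<in> borel_measurable (lebesgue_pattern n) \<and>
     (AE y in lebesgue_pattern n. 0 \<le> nu_density n \<phi> Z y) \<and>
     prob_space (nu n \<phi> Z)"

definition particle_index :: "nat \<Rightarrow> (nat \<times> nat) set" where
  "particle_index n = {(r, i). 1 \<le> i \<and> i \<le> r \<and> r \<le> n}"

definition particle :: "(nat \<Rightarrow> nat \<Rightarrow> real) \<Rightarrow> nat \<times> nat \<Rightarrow> nat \<times> real" where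
  "particle y = (\<lambda>(r, i). (r, y r i))"

definition reference_measure :: "nat \<Rightarrow> (nat \<times> real) measure" where
  "reference_measure n = count_space {1..n} \<Otimes>\<^sub>M lborel"

section \<open>Determinantal random configurations\<close>

text \<open>
  A random configuration consists of particles \<open>X w i\<close>, \<open>i \<in> I\<close>, in the space of the reference
  measure \<open>M\<close>, where \<open>w\<close> is distributed according to \<open>P\<close>.
\<close>

definition random_configuration ::
    "'w measure \<Rightarrow> 'i set \<Rightarrow> ('w \<Rightarrow> 'i \<Rightarrow> 'e) \<Rightarrow> 'e measure \<Rightarrow> bool" where
  "random_configuration P I X M \<longleftrightarrow>
     prob_space P \<and> finite I \<and> (\<forall>i\<in>I. (\<lambda>w. X w i) \<in> measurable P M)"

definition moment_measure ::
    "'w measure \<Rightarrow> 'i set \<Rightarrow> ('w \<Rightarrow> 'i \<Rightarrow> 'e) \<Rightarrow> nat \<Rightarrow> (nat \<Rightarrow> 'e) set \<Rightarrow> ennreal" where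
  "moment_measure P I X m B =
     (\<integral>\<^sup>+w. of_nat (card {\<tau> \<in> {..<m} \<rightarrow>\<^sub>E I. inj_on \<tau> {..<m} \<and> (\<lambda>a\<in>{..<m}. X w (\<tau> a)) \<in> B}) \<partial>P)"

text \<open>
  As a density, the correlation function is only determined up to null sets.
\<close>

definition is_correlation_function ::
    "'w measure \<Rightarrow> 'i set \<Rightarrow> ('w \<Rightarrow> 'i \<Rightarrow> 'e) \<Rightarrow> 'e measure \<Rightarrow> nat \<Rightarrow> ((nat \<Rightarrow> 'e) \<Rightarrow> real) \<Rightarrow> bool"
  where
  "is_correlation_function P I X M m \<rho> \<longleftrightarrow>
     \<rho> \<in> borel_measurable (\<Pi>\<^sub>M a\<in>{..<m}. M) \<and>
     (AE p in (\<Pi>\<^sub>M a\<in>{..<m}. M). 0 \<le> \<rho> p) \<and>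
     (\<forall>B\<in>sets (\<Pi>\<^sub>M a\<in>{..<m}. M).
        moment_measure P I X m B = (\<integral>\<^sup>+p\<in>B. ennreal (\<rho> p) \<partial>(\<Pi>\<^sub>M a\<in>{..<m}. M)))"

definition determinantal ::
    "'w measure \<Rightarrow> 'i set \<Rightarrow> ('w \<Rightarrow> 'i \<Rightarrow> 'e) \<Rightarrow> 'e measure \<Rightarrow> ('e \<Rightarrow> 'e \<Rightarrow> real) \<Rightarrow> bool" where
  "determinantal P I X M K \<longleftrightarrow>
     random_configuration P I X M \<and>
     (\<forall>m. 1 \<le> m \<and> m \<le> card I \<longrightarrow>
        is_correlation_function P I X M m
          (\<lambda>p. Determinant.det (Matrix.mat m m (\<lambda>(i, j). K (p i) (p j)))))"

section \<open>The integrands of the kernel\<close>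

definition Phi :: "nat \<Rightarrow> (nat \<Rightarrow> real \<Rightarrow> real) \<Rightarrow> (nat \<Rightarrow> real) \<Rightarrow> real" where
  "Phi n \<phi> y = (\<Prod>k\<in>{1..n}. \<phi> k (y k)) * vandermonde n y"

definition B_const :: "nat \<Rightarrow> (nat \<Rightarrow> real \<Rightarrow> real) \<Rightarrow> real" where
  "B_const n \<phi> = (\<integral>y. Phi n \<phi> y \<partial>lebesgue_vec n)"

definition lagrange_deriv :: "nat \<Rightarrow> nat \<Rightarrow> nat \<Rightarrow> (nat \<Rightarrow> real) \<Rightarrow> real \<Rightarrow> real" where
  "lagrange_deriv n d j y v =
     (deriv ^^ d) (\<lambda>t. \<Prod>i\<in>{1..n} - {j}. (t - y i) / (y j - y i)) v"

definition kernel_integrand_upper ::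
    "nat \<Rightarrow> (nat \<Rightarrow> real \<Rightarrow> real) \<Rightarrow> nat \<Rightarrow> real \<Rightarrow> nat \<Rightarrow> real \<Rightarrow> (nat \<Rightarrow> real) \<Rightarrow> real" where
  "kernel_integrand_upper n \<phi> r u s v y = Phi n \<phi> y *
     (\<Sum>j\<in>{1..n}. of_bool (v \<le> u \<and> u < y j) *
        ((y j - u) ^ (n - r - 1) / fact (n - r - 1)) * lagrange_deriv n (n - s) j y v)"

definition kernel_integrand_lower ::
    "nat \<Rightarrow> (nat \<Rightarrow> real \<Rightarrow> real) \<Rightarrow> nat \<Rightarrow> real \<Rightarrow> nat \<Rightarrow> real \<Rightarrow> (nat \<Rightarrow> real) \<Rightarrow> real" where
  "kernel_integrand_lower n \<phi> r u s v y = Phi n \<phi> y *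
     (\<Sum>j\<in>{1..n}. of_bool (v > u \<and> u \<ge> y j) *
        ((y j - u) ^ (n - r - 1) / fact (n - r - 1)) * lagrange_deriv n (n - s) j y v)"

end

theory Submission
  imports Defs
begin

text \<open>
  By the integrability of \<open>\<Phi>\<^sub>n\<close>, each \<open>\<phi>\<^sub>k\<close> has moments up to order \<open>n - 1\<close>, and \<open>B\<^sub>n\<close> is a non-zero multiple of the
  determinant of the moment matrix; it does not vanish because \<open>det [\<phi>\<^sub>i(y\<^sub>j)] \<Delta>\<^sub>n(y)\<close> is almost everywhere
  non-negative and its integral is \<open>n! B\<^sub>n\<close>. Let \<open>\<psi>\<^sub>l\<close> be the linear combinations of the \<open>\<phi>\<^sub>k\<close> that are
  biorthogonal to \<open>x\<^sup>l / l!\<close>. The kernel is \<open>K = \<Sum>\<^sub>l H\<^sub>l \<otimes> \<partial>\<^sup>n\<^sup>-\<^sup>s(v\<^sup>l / l!) - (v - u)\<^sub>+\<^sup>s\<^sup>-\<^sup>r\<^sup>-\<^sup>1 / (s - r - 1)!\<close>, where \<open>H\<^sub>l\<close> is the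
  \<open>(n - r)\<close>-fold antiderivative of \<open>\<psi>\<^sub>l\<close> that vanishes at infinity. Taylor's formula and biorthogonality show that
  integrating \<open>K(p, (s, w)) K((s, w), q)\<close> over \<open>w\<close> gives \<open>K(p, q)\<close>, \<open>- K(p, q)\<close> or \<open>0\<close> according to the rows of \<open>p\<close> and \<open>q\<close>,
  and hence that integrating a point of row \<open>s\<close> out of \<open>det [K(p\<^sub>i, p\<^sub>j)]\<close> multiplies the determinant of the remaining points
  by \<open>s\<close> minus the number of remaining points in row \<open>s\<close>. For a complete configuration the matrix \<open>K\<close> is
  a product \<open>L R\<close> in which \<open>L\<close> contributes \<open>det [\<psi>\<^sub>l(y\<^sub>i)]\<close> and \<open>R\<close> is block triangular with the
  interlacing indicators as diagonal determinants, so that its determinant is the symmetrised density.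
\<close>

section \<open>Determinants over finite index sets\<close>

text \<open>The conditions \<open>v \<le> u < y_j\<close> and \<open>v > u \<ge> y_j\<close> of the
  kernel are the two signs of \<open>oind v y u\<close>, the oriented indicator of the interval
  between \<open>v\<close> and \<open>y_j\<close>. They arise because \<open>\<beta>\<close>, row
  \<open>n\<close> of the kernel, reproduces derivatives of polynomials: the subtracted power of
  \<open>v - u\<close> is itself an integral against \<open>\<beta>\<close>. This one cancellation
  makes the kernel decay, justifies Fubini and produces the stated formula. Averages of Lagrange
  polynomials appear because \<open>Phi\<close> times such a polynomial is a determinant with one
  row changed; integrated row by row, it yields the cofactors of the moment matrix that define the
  biorthogonal functions by Cramer's rule. Integrating out starts from the full configuration and
  divides by the number of free places in a row. So at every stage some row must have room, and a
  determinant with an overfull row must vanish by itself. The weights carry no regularity assumption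
  of their own: measurability and moments are recovered from slices of \<open>Phi\<close>.\<close>

definition gdet :: "'a set \<Rightarrow> ('a \<Rightarrow> 'a \<Rightarrow> real) \<Rightarrow> real" where
  "gdet J M = (\<Sum>\<sigma> | \<sigma> permutes J. of_int (sign \<sigma>) * (\<Prod>i\<in>J. M i (\<sigma> i)))"

lemma gdet_empty [simp]: "gdet {} M = 1"
  by (simp add: gdet_def)

lemma gdet_cong:
  assumes "\<And>i j. i \<in> J \<Longrightarrow> j \<in> J \<Longrightarrow> M i j = M' i j"
  shows "gdet J M = gdet J M'"
  unfolding gdet_def
  by (intro sum.cong refl arg_cong2[where f = "(*)"] prod.cong)
     (auto intro!: assms simp: permutes_in_image)

lemma gdet_det: "Determinant.det (Matrix.mat m m (\<lambda>(i, j). M i j)) = gdet {..<m} M"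
  unfolding Determinant.det_def gdet_def
  by (auto simp: atLeast0LessThan permutes_in_image intro!: sum.cong prod.cong)

text \<open>Conjugating permutations by \<open>f\<close> is a bijection that preserves signs. Index
  sets need no order here, so particles and positions can label rows and columns directly.\<close>

lemma gdet_reindex:
  assumes f: "bij_betw f A B" and A: "finite A"
  shows "gdet B M = gdet A (\<lambda>i j. M (f i) (f j))"
proof -
  let ?g = "inv_into A f"
  have g: "bij_betw ?g B A" by (rule bij_betw_inv_into[OF f])
  have inj: "inj_on f A" using f by (simp add: bij_betw_def)
  show ?thesis
    unfolding gdet_def
  proof (rule sum.reindex_bij_witness[where i = "map_permutation A f" and j = "map_permutation B ?g"])
    fix \<sigma> assume \<sigma>: "\<sigma> \<in> {\<sigma>. \<sigma> permutes B}"
    then have \<sigma>: "\<sigma> permutes B" by simp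
    show "map_permutation A f (map_permutation B ?g \<sigma>) = \<sigma>"
      by (rule map_permutation_compose_inv[OF g \<sigma>])
         (use f in \<open>auto simp: bij_betw_def f_inv_into_f\<close>)
    show "map_permutation B ?g \<sigma> \<in> {\<sigma>. \<sigma> permutes A}"
      using map_permutation_permutes[OF g \<sigma>] by simp
  next
    fix \<sigma> assume \<sigma>: "\<sigma> \<in> {\<sigma>. \<sigma> permutes A}"
    then have \<sigma>: "\<sigma> permutes A" by simp
    show "map_permutation B ?g (map_permutation A f \<sigma>) = \<sigma>"
      by (rule map_permutation_compose_inv[OF f \<sigma>]) (use inj in auto)
    show "map_permutation A f \<sigma> \<in> {\<sigma>. \<sigma> permutes B}"
      using map_permutation_permutes[OF f \<sigma>] by simp
  next
    fix \<sigma> assume \<sigma>: "\<sigma> \<in> {\<sigma>. \<sigma> permutes B}"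
    then have \<sigma>: "\<sigma> permutes B" by simp
    have fB: "finite B" using A f bij_betw_finite by blast
    have s: "sign (map_permutation B ?g \<sigma>) = sign \<sigma>"
      by (rule sign_map_permutation) (use \<sigma> fB g in \<open>auto simp: bij_betw_def\<close>)
    have "(\<Prod>i\<in>B. M i (\<sigma> i)) = (\<Prod>i\<in>A. M (f i) (\<sigma> (f i)))"
      by (rule prod.reindex_bij_betw[OF f, symmetric])
    also have "\<dots> = (\<Prod>i\<in>A. M (f i) (f (map_permutation B ?g \<sigma> i)))"
    proof (rule prod.cong[OF refl])
      fix i assume i: "i \<in> A"
      have fi: "f i \<in> B" using f i by (auto simp: bij_betw_def)
      have "map_permutation B ?g \<sigma> (?g (f i)) = ?g (\<sigma> (f i))"
        by (rule map_permutation_apply) (use g fi in \<open>auto simp: bij_betw_def\<close>)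
      moreover have "?g (f i) = i" using inj i by simp
      moreover have "f (?g (\<sigma> (f i))) = \<sigma> (f i)"
        using f \<sigma> fi by (auto simp: bij_betw_def permutes_in_image intro!: f_inv_into_f)
      ultimately show "M (f i) (\<sigma> (f i)) = M (f i) (f (map_permutation B ?g \<sigma> i))"
        by simp
    qed
    finally show "of_int (sign (map_permutation B ?g \<sigma>)) * (\<Prod>i\<in>A. M (f i) (f (map_permutation B ?g \<sigma> i)))
        = of_int (sign \<sigma>) * (\<Prod>i\<in>B. M i (\<sigma> i))"
      by (simp add: s)
  qed
qed

lemma gdet_det_enum:
  assumes "bij_betw f {..<m} J"
  shows "gdet J M = Determinant.det (Matrix.mat m m (\<lambda>(i, j). M (f i) (f j)))"
  by (simp add: gdet_det gdet_reindex[OF assms])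

lemma ex_enum:
  assumes "finite J"
  obtains f where "bij_betw f {..<card J} J"
  using ex_bij_betw_nat_finite[OF assms] by (auto simp: atLeast0LessThan)

lemma gdet_mult:
  assumes J: "finite J"
  shows "gdet J (\<lambda>i j. \<Sum>k\<in>J. L i k * R k j) = gdet J L * gdet J R"
proof -
  obtain f where f: "bij_betw f {..<card J} J" using ex_enum[OF J] .
  let ?m = "card J"
  let ?L = "Matrix.mat ?m ?m (\<lambda>(i, j). L (f i) (f j))"
  let ?R = "Matrix.mat ?m ?m (\<lambda>(i, j). R (f i) (f j))"
  have "?L * ?R = Matrix.mat ?m ?m (\<lambda>(i, j). \<Sum>k\<in>J. L (f i) k * R k (f j))"
    by (rule eq_matI)
       (auto simp: scalar_prod_def atLeast0LessThan sum.reindex_bij_betw[OF f, symmetric])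
  then show ?thesis
    unfolding gdet_det_enum[OF f]
    using det_mult[of ?L ?m ?R] by simp
qed

lemma gdet_transpose:
  assumes J: "finite J"
  shows "gdet J (\<lambda>i j. M j i) = gdet J M"
proof -
  obtain f where f: "bij_betw f {..<card J} J" using ex_enum[OF J] .
  let ?m = "card J"
  let ?M = "Matrix.mat ?m ?m (\<lambda>(i, j). M (f i) (f j))"
  have "transpose_mat ?M = Matrix.mat ?m ?m (\<lambda>(i, j). M (f j) (f i))"
    by (rule eq_matI) auto
  then show ?thesis
    unfolding gdet_det_enum[OF f]
    using det_transpose[of ?M ?m] by simp
qed

lemma gdet_permute_cols:
  assumes J: "finite J" and \<pi>: "\<pi> permutes J"
  shows "gdet J (\<lambda>i j. M i (\<pi> j)) = of_int (sign \<pi>) * gdet J M"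
proof -
  have sg: "sign (\<pi> \<circ> \<sigma>) = sign \<pi> * sign \<sigma>" if "\<sigma> permutes J" for \<sigma>
    using that J \<pi> by (intro sign_compose) (auto intro: permutes_imp_permutation)
  have sq: "of_int (sign \<pi>) * of_int (sign \<pi>) = (1::real)"
    by (metis of_int_1 of_int_mult sign_idempotent)
  have "of_int (sign \<pi>) * gdet J M
      = (\<Sum>\<sigma> | \<sigma> permutes J. of_int (sign \<pi>) * (of_int (sign (\<pi> \<circ> \<sigma>)) * (\<Prod>i\<in>J. M i ((\<pi> \<circ> \<sigma>) i))))"
    unfolding gdet_def sum_distrib_left
    by (rule setum_permutations_compose_left[OF \<pi>])
  also have "\<dots> = gdet J (\<lambda>i j. M i (\<pi> j))"
    unfolding gdet_def
  proof (intro sum.cong refl)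
    fix \<sigma> assume "\<sigma> \<in> {\<sigma>. \<sigma> permutes J}"
    then have "of_int (sign \<pi>) * of_int (sign (\<pi> \<circ> \<sigma>)) = (of_int (sign \<sigma>) :: real)"
      using sq by (simp add: sg mult.assoc[symmetric])
    then show "of_int (sign \<pi>) * (of_int (sign (\<pi> \<circ> \<sigma>)) * (\<Prod>i\<in>J. M i ((\<pi> \<circ> \<sigma>) i)))
        = of_int (sign \<sigma>) * (\<Prod>i\<in>J. M i (\<pi> (\<sigma> i)))"
      by (simp add: mult.assoc[symmetric])
  qed
  finally show ?thesis by simp
qed

text \<open>Swapping the two columns changes nothing and flips the sign.\<close>

lemma gdet_identical_cols:
  assumes J: "finite J" and ab: "a \<in> J" "b \<in> J" "a \<noteq> b" and eq: "\<And>i. i \<in> J \<Longrightarrow> M i a = M i b"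
  shows "gdet J M = 0"
proof -
  have "gdet J M = gdet J (\<lambda>i j. M i (Transposition.transpose a b j))"
    by (rule gdet_cong) (auto simp: Transposition.transpose_def eq)
  also have "\<dots> = - gdet J M"
    by (subst gdet_permute_cols[OF J permutes_swap_id]) (use ab in \<open>auto simp: sign_swap_id\<close>)
  finally show ?thesis by simp
qed

lemma gdet_identical_rows:
  assumes J: "finite J" and ab: "a \<in> J" "b \<in> J" "a \<noteq> b" and eq: "\<And>j. j \<in> J \<Longrightarrow> M a j = M b j"
  shows "gdet J M = 0"
  using gdet_identical_cols[OF assms(1-4), of "\<lambda>i j. M j i"] eq gdet_transpose[OF J, of M] by simp

lemma gdet_zero_row:
  assumes J: "finite J" and a: "a \<in> J" and 0: "\<And>j. j \<in> J \<Longrightarrow> M a j = 0"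
  shows "gdet J M = 0"
  unfolding gdet_def
proof (intro sum.neutral ballI)
  fix \<sigma> assume "\<sigma> \<in> {\<sigma>. \<sigma> permutes J}"
  then have "M a (\<sigma> a) = 0" using a by (intro 0) (simp add: permutes_in_image)
  then have "(\<Prod>i\<in>J. M i (\<sigma> i)) = 0" using J a by (intro prod_zero) auto
  then show "of_int (sign \<sigma>) * (\<Prod>i\<in>J. M i (\<sigma> i)) = 0" by simp
qed

lemma gdet_scale_rows: "gdet J (\<lambda>i j. c i * M i j) = (\<Prod>i\<in>J. c i) * gdet J M"
  by (simp add: gdet_def prod.distrib sum_distrib_left mult_ac)

text \<open>Each permutation of \<open>insert a J\<close> is a permutation \<open>q\<close> of
  \<open>J\<close> followed by a transposition of \<open>a\<close> with some \<open>b\<close>;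
  \<open>b = a\<close> leaves \<open>a\<close> fixed, and otherwise \<open>a\<close> is inserted
  into a cycle of \<open>q\<close>. The variable of \<open>a\<close> then occurs only in
  \<open>M j a * M a (q j)\<close>, the product to which the composition rule of the kernel
  applies.\<close>

lemma gdet_insert:
  assumes J: "finite J" and a: "a \<notin> J"
  shows "gdet (insert a J) M = M a a * gdet J M -
    (\<Sum>q | q permutes J. of_int (sign q) *
      (\<Sum>j\<in>J. M j a * M a (q j) * (\<Prod>i\<in>J - {j}. M i (q i))))"
proof -
  let ?F = "\<lambda>\<sigma>. of_int (sign \<sigma>) * (\<Prod>i\<in>insert a J. M i (\<sigma> i))"
  have "gdet (insert a J) M
      = (\<Sum>q | q permutes J. ?F (Transposition.transpose a a \<circ> q)) +
        (\<Sum>b\<in>J. \<Sum>q | q permutes J. ?F (Transposition.transpose a b \<circ> q))"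
    unfolding gdet_def sum_over_permutations_insert[OF J a] using J a by simp
  also have "(\<Sum>q | q permutes J. ?F (Transposition.transpose a a \<circ> q)) = M a a * gdet J M"
    unfolding gdet_def sum_distrib_left
    by (intro sum.cong refl) (use J a in \<open>simp add: permutes_not_in mult_ac\<close>)
  also have "(\<Sum>b\<in>J. \<Sum>q | q permutes J. ?F (Transposition.transpose a b \<circ> q)) =
      (\<Sum>q | q permutes J. \<Sum>b\<in>J. ?F (Transposition.transpose a b \<circ> q))"
    by (rule sum.swap)
  also have "\<dots> = (\<Sum>q | q permutes J. - (of_int (sign q) *
      (\<Sum>j\<in>J. M j a * M a (q j) * (\<Prod>i\<in>J - {j}. M i (q i)))))"
  proof (intro sum.cong refl)
    fix q assume "q \<in> {q. q permutes J}"
    then have q: "q permutes J" by simp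
    \<comment> \<open>Writing \<open>b\<close> as \<open>q j\<close> makes \<open>j\<close> the
      index that is now sent to \<open>a\<close>, while \<open>a\<close> is sent to
      \<open>q j\<close>.\<close>
    have "(\<Sum>b\<in>J. ?F (Transposition.transpose a b \<circ> q)) = (\<Sum>j\<in>J. ?F (Transposition.transpose a (q j) \<circ> q))"
      by (rule sum.reindex_bij_betw[OF permutes_imp_bij[OF q], symmetric])
    also have "\<dots> = (\<Sum>j\<in>J. - (of_int (sign q) * (M j a * M a (q j) * (\<Prod>i\<in>J - {j}. M i (q i)))))"
    proof (intro sum.cong refl)
      fix j assume j: "j \<in> J"
      have qj: "q j \<in> J" using q j by (simp add: permutes_in_image)
      have "a \<noteq> q j" using qj a by auto
      have s: "sign (Transposition.transpose a (q j) \<circ> q) = - sign q"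
        using \<open>a \<noteq> q j\<close> q J
        by (subst sign_compose) (auto intro: permutes_imp_permutation simp: sign_swap_id permutation_swap_id)
      have "(\<Prod>i\<in>insert a J. M i ((Transposition.transpose a (q j) \<circ> q) i))
          = M a (q j) * (\<Prod>i\<in>J. M i (Transposition.transpose a (q j) (q i)))"
        using J a q by (simp add: permutes_not_in)
      also have "(\<Prod>i\<in>J. M i (Transposition.transpose a (q j) (q i))) = M j a * (\<Prod>i\<in>J - {j}. M i (Transposition.transpose a (q j) (q i)))"
        using J j by (subst prod.remove[of J j]) auto
      also have "(\<Prod>i\<in>J - {j}. M i (Transposition.transpose a (q j) (q i))) = (\<Prod>i\<in>J - {j}. M i (q i))"
      proof (intro prod.cong refl)
        fix i assume i: "i \<in> J - {j}"
        have "q i \<noteq> q j" using i permutes_inj[OF q] by (auto dest: injD)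
        moreover have "q i \<noteq> a" using i q a by (auto simp: permutes_in_image)
        ultimately show "M i (Transposition.transpose a (q j) (q i)) = M i (q i)" by simp
      qed
      finally show "?F (Transposition.transpose a (q j) \<circ> q) =
          - (of_int (sign q) * (M j a * M a (q j) * (\<Prod>i\<in>J - {j}. M i (q i))))"
        by (simp add: s mult_ac)
    qed
    also have "\<dots> = - (of_int (sign q) *
      (\<Sum>j\<in>J. M j a * M a (q j) * (\<Prod>i\<in>J - {j}. M i (q i))))"
      by (simp add: sum_distrib_left sum_negf)
    finally show "(\<Sum>b\<in>J. ?F (Transposition.transpose a b \<circ> q)) = \<dots>" .
  qed
  finally show ?thesis by (simp add: sum_negf)
qed

text \<open>Only permutations that map \<open>T\<close> into itself contribute; by finiteness they
  map \<open>S\<close> to itself as well and split into one permutation of each block.\<close>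

lemma gdet_block:
  assumes fin: "finite S" "finite T" and disj: "S \<inter> T = {}"
    and 0: "\<And>i j. i \<in> T \<Longrightarrow> j \<in> S \<Longrightarrow> M i j = 0"
  shows "gdet (S \<union> T) M = gdet S M * gdet T M"
proof -
  let ?P = "\<lambda>A. {\<sigma>. \<sigma> permutes A}"
  let ?t = "\<lambda>A \<sigma>. of_int (sign \<sigma>) * (\<Prod>i\<in>A. M i (\<sigma> i)) :: real"
  let ?Q = "{\<sigma>. \<sigma> permutes S \<union> T \<and> \<sigma> ` T \<subseteq> T}"
  have "gdet S M * gdet T M = (\<Sum>(p, q)\<in>?P S \<times> ?P T. ?t S p * ?t T q)"
    unfolding gdet_def by (simp add: sum_product sum.cartesian_product)
  also have "\<dots> = (\<Sum>\<sigma>\<in>?Q. ?t (S \<union> T) \<sigma>)"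
  proof (rule sum.reindex_bij_witness[where j = "\<lambda>(p, q). p \<circ> q" and
      i = "\<lambda>\<sigma>. (\<lambda>x. if x \<in> S then \<sigma> x else x, \<lambda>x. if x \<in> T then \<sigma> x else x)"])
    fix pq assume "pq \<in> ?P S \<times> ?P T"
    then obtain p q where pq: "pq = (p, q)" and p: "p permutes S" and q: "q permutes T" by auto
    have qS: "q x = x" if "x \<in> S" for x using q that disj permutes_not_in by fastforce
    have pT: "p x = x" if "x \<in> T" for x using p that disj permutes_not_in by fastforce
    have qT: "q x \<in> T" if "x \<in> T" for x using q that by (simp add: permutes_in_image)
    have pS: "p x \<in> S" if "x \<in> S" for x using p that by (simp add: permutes_in_image)
    have pn: "p x = x" if "x \<notin> S" for x using p that by (simp add: permutes_not_in)
    have qn: "q x = x" if "x \<notin> T" for x using q that by (simp add: permutes_not_in)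
    have "p \<circ> q permutes S \<union> T"
      using p q by (intro permutes_compose) (auto intro: permutes_subset)
    then show "(case pq of (p, q) \<Rightarrow> p \<circ> q) \<in> ?Q"
      using qT pT by (auto simp: pq)
    show "(\<lambda>x. if x \<in> S then (case pq of (p, q) \<Rightarrow> p \<circ> q) x else x,
        \<lambda>x. if x \<in> T then (case pq of (p, q) \<Rightarrow> p \<circ> q) x else x) = pq"
      using qS pT qT pn qn by (auto simp: pq fun_eq_iff)
    have "(\<Prod>i\<in>S \<union> T. M i ((p \<circ> q) i)) = (\<Prod>i\<in>S. M i (p i)) * (\<Prod>i\<in>T. M i (q i))"
      using fin disj qS pT qT by (simp add: prod.union_disjoint)
    moreover have "sign (p \<circ> q) = sign p * sign q"
      using p q fin by (intro sign_compose) (auto intro: permutes_imp_permutation)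
    ultimately show "?t (S \<union> T) (case pq of (p, q) \<Rightarrow> p \<circ> q) = (case pq of (p, q) \<Rightarrow> ?t S p * ?t T q)"
      by (simp add: pq mult_ac)
  next
    fix \<sigma> assume "\<sigma> \<in> ?Q"
    then have \<sigma>: "\<sigma> permutes S \<union> T" and \<sigma>T: "\<sigma> ` T \<subseteq> T" by auto
    have inj: "inj_on \<sigma> A" for A using permutes_inj[OF \<sigma>] by (rule inj_on_subset) auto
    have T: "\<sigma> ` T = T" using \<sigma>T fin inj by (intro endo_inj_surj) auto
    have "\<sigma> ` (S \<union> T) = S \<union> T" by (rule permutes_image[OF \<sigma>])
    then have "\<sigma> ` S \<subseteq> S \<union> T" by auto
    moreover have "\<sigma> ` S \<inter> \<sigma> ` T = {}"
      using permutes_inj[OF \<sigma>] disj by (simp add: image_Int[symmetric])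
    ultimately have S: "\<sigma> ` S \<subseteq> S" using T by auto
    then have S: "\<sigma> ` S = S" using fin inj by (intro endo_inj_surj) auto
    have "(\<lambda>x. if x \<in> A then \<sigma> x else x) permutes A" if "\<sigma> ` A = A" for A
    proof (rule bij_imp_permutes)
      show "bij_betw (\<lambda>x. if x \<in> A then \<sigma> x else x) A A"
        using that inj by (auto simp: bij_betw_def inj_on_def)
    qed auto
    then show "(\<lambda>x. if x \<in> S then \<sigma> x else x, \<lambda>x. if x \<in> T then \<sigma> x else x) \<in> ?P S \<times> ?P T"
      using S T by auto
    show "(case (\<lambda>x. if x \<in> S then \<sigma> x else x, \<lambda>x. if x \<in> T then \<sigma> x else x) of (p, q) \<Rightarrow> p \<circ> q) = \<sigma>"
      using S T disj \<sigma> by (auto simp: fun_eq_iff permutes_not_in)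
  qed
  also have "\<dots> = gdet (S \<union> T) M"
    unfolding gdet_def
  proof (rule sum.mono_neutral_left)
    show "finite (?P (S \<union> T))" using fin by (simp add: finite_permutations)
    show "\<forall>\<sigma>\<in>?P (S \<union> T) - ?Q. ?t (S \<union> T) \<sigma> = 0"
    proof
      fix \<sigma> assume "\<sigma> \<in> ?P (S \<union> T) - ?Q"
      then obtain i where "i \<in> T" "\<sigma> i \<notin> T" "\<sigma> permutes S \<union> T" by auto
      then have "\<sigma> i \<in> S" using permutes_in_image[of \<sigma> "S \<union> T" i] by auto
      then have "M i (\<sigma> i) = 0" using 0 \<open>i \<in> T\<close> by auto
      then show "?t (S \<union> T) \<sigma> = 0" using \<open>i \<in> T\<close> fin by (auto intro!: bexI[of _ i])
    qed
  qed auto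
  finally show ?thesis by simp
qed

text \<open>Multilinearity in the columns: \<open>f\<close> chooses a summand in each column. As in
  the Cauchy-Binet formula, \<open>X\<close> may be larger than \<open>J\<close>.\<close>

lemma gdet_product_expand:
  assumes J: "finite J" and X: "finite X"
  shows "gdet J (\<lambda>i j. \<Sum>k\<in>X. L i k * R k j) =
    (\<Sum>f\<in>J \<rightarrow>\<^sub>E X. (\<Prod>j\<in>J. R (f j) j) * gdet J (\<lambda>i j. L i (f j)))"
proof -
  have "gdet J (\<lambda>i j. \<Sum>k\<in>X. L i k * R k j)
      = (\<Sum>\<sigma> | \<sigma> permutes J. of_int (sign \<sigma>) * (\<Prod>j\<in>J. \<Sum>k\<in>X. L (\<sigma> j) k * R k j))"
    by (subst gdet_transpose[OF J, symmetric]) (simp add: gdet_def)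
  also have "\<dots> = (\<Sum>\<sigma> | \<sigma> permutes J. \<Sum>f\<in>J \<rightarrow>\<^sub>E X. of_int (sign \<sigma>) * (\<Prod>j\<in>J. L (\<sigma> j) (f j) * R (f j) j))"
    using J X by (simp add: prod_sum_PiE sum_distrib_left)
  also have "\<dots> = (\<Sum>f\<in>J \<rightarrow>\<^sub>E X. \<Sum>\<sigma> | \<sigma> permutes J. of_int (sign \<sigma>) * (\<Prod>j\<in>J. L (\<sigma> j) (f j) * R (f j) j))"
    by (rule sum.swap)
  also have "\<dots> = (\<Sum>f\<in>J \<rightarrow>\<^sub>E X. (\<Prod>j\<in>J. R (f j) j) * gdet J (\<lambda>i j. L i (f j)))"
    by (intro sum.cong refl, subst gdet_transpose[OF J, symmetric])
       (simp add: gdet_def prod.distrib sum_distrib_left mult_ac)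
  finally show ?thesis .
qed

text \<open>Pigeonhole form of a rank bound: a choice \<open>f\<close> that sends \<open>C\<close>
  into the smaller set \<open>Y\<close> repeats a column of \<open>L\<close>, and any other choice
  meets a zero of \<open>R\<close>.\<close>

lemma gdet_rank_zero:
  assumes J: "finite J" and X: "finite X" and C: "C \<subseteq> J" and Y: "Y \<subseteq> X" "card Y < card C"
    and 0: "\<And>k j. k \<in> X - Y \<Longrightarrow> j \<in> C \<Longrightarrow> R k j = 0"
  shows "gdet J (\<lambda>i j. \<Sum>k\<in>X. L i k * R k j) = 0"
  unfolding gdet_product_expand[OF J X]
proof (intro sum.neutral ballI)
  fix f assume f: "f \<in> J \<rightarrow>\<^sub>E X"
  show "(\<Prod>j\<in>J. R (f j) j) * gdet J (\<lambda>i j. L i (f j)) = 0"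
  proof (cases "f ` C \<subseteq> Y")
    case True
    have "finite Y" using X Y finite_subset by auto
    then have "\<not> inj_on f C" using True Y card_inj_on_le[of f C Y] by auto
    then obtain a b where "a \<in> C" "b \<in> C" "a \<noteq> b" "f a = f b" by (auto simp: inj_on_def)
    then have "gdet J (\<lambda>i j. L i (f j)) = 0" using C J by (intro gdet_identical_cols[of J a b]) auto
    then show ?thesis by simp
  next
    case False
    then obtain j where "j \<in> C" "f j \<notin> Y" by auto
    then have "R (f j) j = 0" using f C by (intro 0) auto
    then show ?thesis using J C \<open>j \<in> C\<close> by (auto intro!: bexI[of _ j])
  qed
qed

section \<open>Divided powers and Taylor's formula\<close>

text \<open>Divided powers: differentiation just lowers the index, and \<open>dpow_add\<close> is
  the binomial theorem without coefficients.\<close>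

definition dpow :: "nat \<Rightarrow> real \<Rightarrow> real" where
  "dpow k x = x ^ k / fact k"

text \<open>The \<open>d\<close>-th derivative of \<open>dpow l\<close>.\<close>

definition ediff :: "nat \<Rightarrow> nat \<Rightarrow> real \<Rightarrow> real" where
  "ediff d l x = (if d \<le> l then dpow (l - d) x else 0)"

text \<open>The truncated divided power. The strict inequality matters for \<open>k = 0\<close>, a
  Heaviside function that vanishes at 0.\<close>

definition ppow :: "nat \<Rightarrow> real \<Rightarrow> real" where
  "ppow k x = (if 0 < x then dpow k x else 0)"

text \<open>The oriented indicator: 1 on \<open>{c..<y}\<close> and -1 on \<open>{y..<c}\<close>, so
  that integrating against it in \<open>w\<close> is integrating from \<open>c\<close> to
  \<open>y\<close>.\<close>

definition oind :: "real \<Rightarrow> real \<Rightarrow> real \<Rightarrow> real" where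
  "oind c y w = of_bool (w < y) - of_bool (w < c)"

lemma dpow_0 [simp]: "dpow 0 x = 1"
  by (simp add: dpow_def)

lemma dpow_zero: "dpow k 0 = of_bool (k = 0)"
  by (simp add: dpow_def)

lemma dpow_add: "dpow k (x + y) = (\<Sum>j\<le>k. dpow j x * dpow (k - j) y)"
proof -
  have "dpow k (x + y) = (\<Sum>j\<le>k. of_nat (k choose j) * x ^ j * y ^ (k - j) / fact k)"
    unfolding dpow_def binomial_ring by (simp add: sum_divide_distrib)
  also have "\<dots> = (\<Sum>j\<le>k. dpow j x * dpow (k - j) y)"
    by (intro sum.cong refl) (simp add: dpow_def binomial_fact)
  finally show ?thesis .
qed

lemma dpow_has_derivative:
  "(dpow (Suc k) has_real_derivative dpow k x) (at x)"
proof -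
  have "((\<lambda>x. x ^ Suc k / fact (Suc k)) has_real_derivative real (Suc k) * x ^ k / fact (Suc k)) (at x)"
    using DERIV_cdivide[OF DERIV_pow[of "Suc k" x], of "fact (Suc k)"] by simp
  moreover have "real (Suc k) * x ^ k / fact (Suc k) = dpow k x"
    by (simp add: dpow_def del: of_nat_Suc)
  ultimately show ?thesis by (simp add: dpow_def[abs_def] del: fact_Suc of_nat_Suc power_Suc)
qed

lemma dpow_measurable [measurable]: "dpow k \<in> borel_measurable borel"
  unfolding dpow_def by measurable

lemma ppow_measurable [measurable]: "ppow k \<in> borel_measurable borel"
  unfolding ppow_def by measurable

lemma ediff_measurable [measurable]: "ediff d l \<in> borel_measurable borel"
  unfolding ediff_def by measurable

lemma continuous_dpow: "continuous_on A (dpow k)"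
  unfolding dpow_def by (intro continuous_intros) auto

lemma continuous_ediff: "continuous_on A (ediff d l)"
  unfolding ediff_def by (cases "d \<le> l") (auto intro!: continuous_intros continuous_dpow)

lemma ppow_Suc_eq: "ppow (Suc k) x = dpow (Suc k) (max 0 x)"
  by (auto simp: ppow_def dpow_def max_def)

lemma continuous_ppow: "continuous_on A (ppow (Suc k))"
  unfolding ppow_Suc_eq dpow_def by (intro continuous_intros) auto

lemma ppow_has_derivative:
  assumes "x \<noteq> 0"
  shows "(ppow (Suc k) has_real_derivative ppow k x) (at x)"
proof (cases "0 < x")
  case True
  have "(ppow (Suc k) has_real_derivative dpow k x) (at x)"
    by (rule DERIV_cong_ev[THEN iffD1, OF refl _ refl dpow_has_derivative])
       (use True in \<open>auto simp: ppow_def eventually_nhds intro!: exI[of _ "{0<..}"]\<close>)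
  then show ?thesis using True by (simp add: ppow_def)
next
  case False
  then have "x < 0" using assms by simp
  have "((\<lambda>_. 0) has_real_derivative 0) (at x)" by simp
  then have "(ppow (Suc k) has_real_derivative 0) (at x)"
    by (rule DERIV_cong_ev[THEN iffD1, OF refl _ refl, rotated])
       (use \<open>x < 0\<close> in \<open>auto simp: ppow_def eventually_nhds intro!: exI[of _ "{..<0}"]\<close>)
  then show ?thesis using False by (simp add: ppow_def)
qed

lemma ediff_has_derivative:
  "(ediff d l has_real_derivative ediff (Suc d) l x) (at x)"
proof (cases "d < l")
  case True
  then obtain k where k: "l - d = Suc k" by (metis Suc_diff_Suc)
  then have "l - Suc d = k" by simp
  then show ?thesis using True k dpow_has_derivative[of k x]
    by (simp add: ediff_def[abs_def] Suc_le_eq)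
next
  case False
  then have "ediff d l = (\<lambda>_. ediff d l 0)" by (auto simp: ediff_def fun_eq_iff)
  moreover have "ediff (Suc d) l x = 0" using False by (simp add: ediff_def)
  ultimately show ?thesis by (metis DERIV_const)
qed

lemma oind_measurable [measurable (raw)]:
  assumes [measurable]: "f \<in> borel_measurable M" "g \<in> borel_measurable M" "h \<in> borel_measurable M"
  shows "(\<lambda>x. oind (f x) (g x) (h x)) \<in> borel_measurable M"
  unfolding oind_def of_bool_def by measurable

lemma abs_oind_le: "\<bar>oind c y w\<bar> \<le> 1"
  by (simp add: oind_def)

lemma abs_oind: "\<bar>oind c y w\<bar> = indicator {min c y..<max c y} w"
  by (auto simp: oind_def indicator_def)

section \<open>Functions of polynomial growth\<close>

definition pgrow :: "nat \<Rightarrow> (real \<Rightarrow> real) \<Rightarrow> bool" where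
  "pgrow q g \<longleftrightarrow> g \<in> borel_measurable borel \<and> (\<exists>C. \<forall>y. \<bar>g y\<bar> \<le> C * (1 + \<bar>y\<bar>) ^ q)"

lemma pgrow_measurable: "pgrow q g \<Longrightarrow> g \<in> borel_measurable borel"
  by (simp add: pgrow_def)

lemma pgrowE:
  assumes "pgrow q g"
  obtains C where "C \<ge> 0" "\<And>y. \<bar>g y\<bar> \<le> C * (1 + \<bar>y\<bar>) ^ q"
proof -
  obtain C where C: "\<And>y. \<bar>g y\<bar> \<le> C * (1 + \<bar>y\<bar>) ^ q" using assms by (auto simp: pgrow_def)
  have "0 \<le> C" using C[of 0] by simp
  then show thesis using that C by blast
qed

lemma pgrow_add:
  assumes "pgrow q f" "pgrow q g"
  shows "pgrow q (\<lambda>y. f y + g y)"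
proof -
  obtain C D where C: "\<And>y. \<bar>f y\<bar> \<le> C * (1 + \<bar>y\<bar>) ^ q" and D: "\<And>y. \<bar>g y\<bar> \<le> D * (1 + \<bar>y\<bar>) ^ q"
    using assms by (auto simp: pgrow_def)
  have "\<bar>f y + g y\<bar> \<le> (C + D) * (1 + \<bar>y\<bar>) ^ q" for y
    using C[of y] D[of y] by (auto simp: distrib_right intro: order_trans[OF abs_triangle_ineq])
  then show ?thesis using assms by (auto simp: pgrow_def)
qed

lemma pgrow_mult_bounded:
  assumes "pgrow q f" "g \<in> borel_measurable borel" "\<And>y. \<bar>g y\<bar> \<le> B"
  shows "pgrow q (\<lambda>y. g y * f y)"
proof -
  obtain C where C: "C \<ge> 0" "\<And>y. \<bar>f y\<bar> \<le> C * (1 + \<bar>y\<bar>) ^ q"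
    using assms(1) by (rule pgrowE) blast
  have "\<bar>g y * f y\<bar> \<le> (B * C) * (1 + \<bar>y\<bar>) ^ q" for y
    unfolding abs_mult mult.assoc
    by (intro mult_mono assms C) (auto intro: order_trans[OF abs_ge_zero assms(3)])
  then show ?thesis using assms by (auto simp: pgrow_def)
qed

lemma pgrow_cmult: "pgrow q f \<Longrightarrow> pgrow q (\<lambda>y. c * f y)"
  by (rule pgrow_mult_bounded[where B = "\<bar>c\<bar>"]) auto

lemma pgrow_diff: "pgrow q f \<Longrightarrow> pgrow q g \<Longrightarrow> pgrow q (\<lambda>y. f y - g y)"
  using pgrow_add[of q f "\<lambda>y. -1 * g y"] pgrow_cmult[of q g "-1"] by simp

lemma pgrow_zero: "pgrow q (\<lambda>y. 0)"
  by (auto simp: pgrow_def intro: exI[of _ 0])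

lemma pgrow_sum: "(\<And>i. i \<in> A \<Longrightarrow> pgrow q (f i)) \<Longrightarrow> pgrow q (\<lambda>y. \<Sum>i\<in>A. f i y)"
  by (induction A rule: infinite_finite_induct) (auto intro: pgrow_zero pgrow_add)

lemma abs_diff_le_mult: "\<bar>y - w\<bar> \<le> (1 + \<bar>w\<bar>) * (1 + \<bar>y :: real\<bar>)"
proof -
  have "0 \<le> \<bar>w\<bar> * \<bar>y\<bar>" by simp
  then show ?thesis unfolding distrib_left distrib_right by linarith
qed

lemma pgrow_dpow:
  assumes "k \<le> q"
  shows "pgrow q (\<lambda>y. dpow k (y - w))"
proof -
  have "\<bar>dpow k (y - w)\<bar> \<le> (1 + \<bar>w\<bar>) ^ k * (1 + \<bar>y\<bar>) ^ q" for y
  proof -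
    have "\<bar>dpow k (y - w)\<bar> \<le> \<bar>y - w\<bar> ^ k / 1"
      unfolding dpow_def by (simp add: power_abs) (rule divide_left_mono[where b = 1, simplified], auto)
    also have "\<dots> \<le> ((1 + \<bar>w\<bar>) * (1 + \<bar>y\<bar>)) ^ k"
      by (simp add: power_mono abs_diff_le_mult)
    also have "\<dots> = (1 + \<bar>w\<bar>) ^ k * (1 + \<bar>y\<bar>) ^ k" by (rule power_mult_distrib)
    also have "\<dots> \<le> (1 + \<bar>w\<bar>) ^ k * (1 + \<bar>y\<bar>) ^ q"
      by (intro mult_left_mono power_increasing assms) auto
    finally show ?thesis .
  qed
  then show ?thesis unfolding pgrow_def by (intro conjI exI allI) measurable
qed

lemma pgrow_dpow0: "k \<le> q \<Longrightarrow> pgrow q (dpow k)"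
  using pgrow_dpow[of k q 0] by simp

lemma pgrow_ppow:
  assumes "k \<le> q"
  shows "pgrow q (\<lambda>y. ppow k (y - w))"
proof -
  have "pgrow q (\<lambda>y. of_bool (w < y) * dpow k (y - w))"
    by (rule pgrow_mult_bounded[OF pgrow_dpow[OF assms], where B = 1]) (auto simp: of_bool_def)
  moreover have "of_bool (w < y) * dpow k (y - w) = ppow k (y - w)" for y
    by (simp add: ppow_def)
  ultimately show ?thesis by simp
qed

lemma pgrow_ediff: "l - d \<le> q \<Longrightarrow> pgrow q (ediff d l)"
  unfolding ediff_def by (cases "d \<le> l") (auto intro: pgrow_zero pgrow_dpow0)

text \<open>The derivative of \<open>F\<close> telescopes to its last term. The point
  \<open>u\<close> is left out because the functions to which this is applied contain truncated
  powers of \<open>w - u\<close>, which may fail to be differentiable there; continuity bridges the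
  gap.\<close>

lemma taylor_segment:
  fixes Df :: "nat \<Rightarrow> real \<Rightarrow> real" and y :: real
  assumes cont: "\<And>k. k \<le> b \<Longrightarrow> continuous_on UNIV (Df k)"
    and deriv: "\<And>k w. k \<le> b \<Longrightarrow> w \<noteq> u \<Longrightarrow> (Df k has_real_derivative Df (Suc k) w) (at w)"
    and le: "p \<le> q"
  defines "F \<equiv> \<lambda>w. \<Sum>k\<le>b. Df k w * dpow k (y - w)"
  shows "((\<lambda>w. Df (Suc b) w * dpow b (y - w)) has_integral (F q - F p)) {p..q}"
proof (rule fundamental_theorem_of_calculus_interior_strong[of "{u}"])
  show "continuous_on {p..q} F"
    unfolding F_def
    by (intro continuous_intros continuous_on_subset[OF cont] continuous_on_compose2[OF continuous_dpow]) auto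
  fix w assume w: "w \<in> {p<..<q} - {u}"
  define G where "G k w = Df (Suc k) w * dpow k (y - w)" for k w
  have d: "((\<lambda>w. Df k w * dpow k (y - w)) has_real_derivative (G k w - (if k = 0 then 0 else G (k - 1) w))) (at w)"
    if "k \<le> b" for k
  proof (cases k)
    case 0
    show ?thesis using w deriv[of 0 w] by (simp add: 0 G_def)
  next
    case (Suc j)
    have "((\<lambda>w. dpow (Suc j) (y - w)) has_real_derivative (dpow j (y - w) * (-1))) (at w)"
      by (rule DERIV_chain2[OF dpow_has_derivative]) (auto intro!: derivative_eq_intros)
    from DERIV_mult[OF deriv[OF that] this] w
    show ?thesis by (simp add: Suc G_def algebra_simps)
  qed
  have "(F has_real_derivative (\<Sum>k\<le>b. G k w - (if k = 0 then 0 else G (k - 1) w))) (at w)"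
    unfolding F_def by (rule DERIV_sum) (use d in auto)
  moreover have "(\<Sum>k\<le>m. G k w - (if k = 0 then 0 else G (k - 1) w)) = G m w" for m
    by (induction m) auto
  ultimately show "(F has_vector_derivative Df (Suc b) w * dpow b (y - w)) (at w)"
    by (simp add: has_real_derivative_iff_has_vector_derivative G_def)
qed (use le in auto)

text \<open>Taylor's formula as an oriented integral from \<open>c\<close> to \<open>y\<close>, for
  either order of the two. The constant in the bound is a \<open>SOME\<close> term so that it
  depends only on \<open>Df (Suc b)\<close> and \<open>q\<close> and is the same for all
  \<open>y\<close>, over which the next lemma integrates.\<close>

lemma taylor_remainder:
  fixes Df :: "nat \<Rightarrow> real \<Rightarrow> real"
  assumes cont: "\<And>k. k \<le> b \<Longrightarrow> continuous_on UNIV (Df k)"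
    and deriv: "\<And>k w. k \<le> b \<Longrightarrow> w \<noteq> u \<Longrightarrow> (Df k has_real_derivative Df (Suc k) w) (at w)"
    and grow: "pgrow q (Df (Suc b))"
  shows "integrable lborel (\<lambda>w. Df (Suc b) w * (oind c y w * dpow b (y - w)))" (is ?int)
    and "(\<integral>w. Df (Suc b) w * (oind c y w * dpow b (y - w)) \<partial>lborel) =
      Df 0 y - (\<Sum>k\<le>b. Df k c * dpow k (y - c))" (is ?eq)
    and "(\<integral>w. \<bar>Df (Suc b) w * (oind c y w * dpow b (y - w))\<bar> \<partial>lborel) \<le>
      (SOME C. C \<ge> 0 \<and> (\<forall>y. \<bar>Df (Suc b) y\<bar> \<le> C * (1 + \<bar>y\<bar>) ^ q)) * (1 + \<bar>c\<bar>) ^ (q + b + 1) * (1 + \<bar>y\<bar>) ^ (q + b + 1)"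
      (is ?bound)
proof -
  let ?f = "\<lambda>w. Df (Suc b) w * dpow b (y - w)"
  let ?g = "\<lambda>w. Df (Suc b) w * (oind c y w * dpow b (y - w))"
  have [measurable]: "Df (Suc b) \<in> borel_measurable borel" using grow by (rule pgrow_measurable)
  define C where "C = (SOME C. C \<ge> 0 \<and> (\<forall>y. \<bar>Df (Suc b) y\<bar> \<le> C * (1 + \<bar>y\<bar>) ^ q))"
  have "\<exists>C. C \<ge> 0 \<and> (\<forall>y. \<bar>Df (Suc b) y\<bar> \<le> C * (1 + \<bar>y\<bar>) ^ q)"
    using grow by (rule pgrowE) auto
  then have "C \<ge> 0 \<and> (\<forall>y. \<bar>Df (Suc b) y\<bar> \<le> C * (1 + \<bar>y\<bar>) ^ q)"
    unfolding C_def by (rule someI_ex)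
  then have C: "C \<ge> 0" "\<And>y. \<bar>Df (Suc b) y\<bar> \<le> C * (1 + \<bar>y\<bar>) ^ q" by auto
  \<comment> \<open>This bounds \<open>1 + \<bar>w\<bar>\<close> and
    \<open>\<bar>y - w\<bar>\<close> for every \<open>w\<close> between \<open>c\<close> and
    \<open>y\<close>, and it splits into a factor in \<open>c\<close> and one in
    \<open>y\<close>.\<close>
  define R where "R = (1 + \<bar>c\<bar>) * (1 + \<bar>y\<bar>)"
  have cy: "0 \<le> \<bar>c\<bar> * \<bar>y\<bar>" by simp
  have R: "1 + \<bar>c\<bar> + \<bar>y\<bar> \<le> R" using cy unfolding R_def distrib_left distrib_right by linarith
  have R0: "R \<ge> 0" "R \<ge> 1" using R by auto
  have fb: "\<bar>?f w\<bar> \<le> C * R ^ q * R ^ b" if w: "w \<in> {min c y..max c y}" for w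
  proof -
    have 1: "1 + \<bar>w\<bar> \<le> R" and 2: "\<bar>y - w\<bar> \<le> R" using w R by (auto simp: min_def max_def split: if_splits)
    have "\<bar>dpow b (y - w)\<bar> \<le> \<bar>y - w\<bar> ^ b / 1"
      unfolding dpow_def by (simp add: power_abs) (rule divide_left_mono[where b = 1, simplified], auto)
    also have "\<dots> \<le> R ^ b" using 2 by (simp add: power_mono)
    finally have 3: "\<bar>dpow b (y - w)\<bar> \<le> R ^ b" .
    have "\<bar>Df (Suc b) w\<bar> \<le> C * R ^ q"
      using C(2)[of w] by (rule order_trans) (intro mult_left_mono power_mono 1 C, auto)
    then show ?thesis unfolding abs_mult by (intro mult_mono 3) (use C R0 in auto)
  qed
  have gb: "\<bar>?g w\<bar> \<le> C * R ^ q * R ^ b * indicator {min c y..max c y} w" for w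
  proof (cases "w \<in> {min c y..<max c y}")
    case True
    have "\<bar>?g w\<bar> = \<bar>?f w\<bar> * \<bar>oind c y w\<bar>" by (simp add: abs_mult)
    also have "\<dots> \<le> C * R ^ q * R ^ b * 1"
      by (intro mult_mono fb abs_oind_le) (use True C R0 in auto)
    finally show ?thesis using True by (simp add: indicator_def)
  next
    case False
    then have "oind c y w = 0" using abs_oind[of c y w] by simp
    then show ?thesis using C R0 by (auto simp: indicator_def)
  qed
  have ib: "integrable lborel (\<lambda>w. C * R ^ q * R ^ b * indicator {min c y..max c y} w :: real)"
    by (intro integrable_mult_right) (auto intro!: integrable_real_indicator simp: emeasure_lborel_Icc_eq)
  show int: ?int
    by (rule Bochner_Integration.integrable_bound[OF ib]) (use gb in \<open>auto intro!: AE_I2 order_trans[OF _ abs_ge_self]\<close>)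
  have "(\<integral>w. \<bar>?g w\<bar> \<partial>lborel) \<le> (\<integral>w. C * R ^ q * R ^ b * indicator {min c y..max c y} w \<partial>lborel)"
    by (rule integral_mono) (use int ib gb in \<open>auto intro: integrable_abs\<close>)
  also have "\<dots> = C * R ^ q * R ^ b * \<bar>y - c\<bar>"
    by (simp add: max_def min_def)
  also have "\<dots> \<le> C * R ^ q * R ^ b * R"
    by (intro mult_left_mono) (use C R0 R in auto)
  also have "\<dots> = C * (1 + \<bar>c\<bar>) ^ (q + b + 1) * (1 + \<bar>y\<bar>) ^ (q + b + 1)"
    by (simp add: R_def power_add power_mult_distrib mult_ac)
  finally show ?bound by (simp add: C_def)
  define F where "F = (\<lambda>w. \<Sum>k\<le>b. Df k w * dpow k (y - w))"
  have Fy: "F y = Df 0 y"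
    unfolding F_def by (simp add: dpow_zero of_bool_def if_distrib sum.delta cong: if_cong)
  have seg: "(\<integral>w. ?f w * indicator {p..<q'} w \<partial>lborel) = F q' - F p"
    if pq: "p \<le> q'" "{p..q'} \<subseteq> {min c y..max c y}" for p q'
  proof -
    have i: "set_integrable lborel {p..q'} ?f"
      unfolding set_integrable_def
      by (rule Bochner_Integration.integrable_bound[OF ib])
         (use fb pq C R0 in \<open>auto intro!: AE_I2 simp: indicator_def\<close>)
    have "(\<integral>w. ?f w * indicator {p..<q'} w \<partial>lborel) = (LINT w:{p..q'}|lborel. ?f w)"
      unfolding set_lebesgue_integral_def
      by (rule integral_cong_AE)
         (auto intro!: eventually_mono[OF AE_lborel_singleton[of q']] simp: indicator_def)
    also have "\<dots> = integral {p..q'} ?f" using i by (rule set_borel_integral_eq_integral(2))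
    also have "\<dots> = F q' - F p"
      unfolding F_def by (rule integral_unique[OF taylor_segment[where Df = Df and b = b and u = u and y = y, OF cont deriv pq(1)]])
    finally show ?thesis .
  qed
  have "(\<integral>w. ?g w \<partial>lborel) = F y - F c"
  proof (cases "c \<le> y")
    case True
    have "?g = (\<lambda>w. ?f w * indicator {c..<y} w)" using True by (auto simp: oind_def indicator_def)
    then show ?thesis using seg[of c y] True by (simp only:) simp
  next
    case False
    have "?g = (\<lambda>w. - (?f w * indicator {y..<c} w))" using False by (auto simp: oind_def indicator_def)
    then show ?thesis using seg[of y c] False by (simp only: integral_minus) simp
  qed
  then show ?eq using Fy by (simp add: F_def)
qed

text \<open>Repeated integration by parts with boundary terms at \<open>c\<close>, done as one
  exchange of integrals: for fixed \<open>y\<close> the integral over \<open>w\<close> is a Taylor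
  remainder. Its growth \<open>q + b + 1\<close> in \<open>y\<close> is the order of the moment
  required of \<open>\<beta>\<close>.\<close>

lemma integral_taylor_transfer:
  fixes M :: "real measure" and Df :: "nat \<Rightarrow> real \<Rightarrow> real" and \<beta> :: "real \<Rightarrow> real"
  assumes sf: "sigma_finite_measure M" and sets: "sets M = sets borel"
    and \<beta>: "\<beta> \<in> borel_measurable borel" "integrable M (\<lambda>y. \<beta> y * (1 + \<bar>y\<bar>) ^ (q + b + 1))"
    and cont: "\<And>k. k \<le> b \<Longrightarrow> continuous_on UNIV (Df k)"
    and deriv: "\<And>k w. k \<le> b \<Longrightarrow> w \<noteq> u \<Longrightarrow> (Df k has_real_derivative Df (Suc k) w) (at w)"
    and grow: "pgrow q (Df (Suc b))"
  shows "integrable lborel (\<lambda>w. Df (Suc b) w * (\<integral>y. \<beta> y * (oind c y w * dpow b (y - w)) \<partial>M))"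
    and "(\<integral>w. Df (Suc b) w * (\<integral>y. \<beta> y * (oind c y w * dpow b (y - w)) \<partial>M) \<partial>lborel) =
      (\<integral>y. \<beta> y * (Df 0 y - (\<Sum>k\<le>b. Df k c * dpow k (y - c))) \<partial>M)"
proof -
  interpret sigma_finite_measure M by (rule sf)
  interpret P: pair_sigma_finite M lborel ..
  note [measurable_cong] = sets
  have [measurable]: "Df (Suc b) \<in> borel_measurable borel" "\<beta> \<in> borel_measurable borel"
    using grow \<beta> by (auto intro: pgrow_measurable)
  let ?g = "\<lambda>y w. Df (Suc b) w * (oind c y w * dpow b (y - w))"
  define C where "C = (SOME C. C \<ge> 0 \<and> (\<forall>y. \<bar>Df (Suc b) y\<bar> \<le> C * (1 + \<bar>y\<bar>) ^ q))"
  note tr = taylor_remainder[OF cont deriv grow]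
  have ig: "integrable lborel (\<lambda>w. \<beta> y * ?g y w)" for y
    by (intro integrable_mult_right tr(1)) auto
  have int: "integrable (M \<Otimes>\<^sub>M lborel) (\<lambda>(y, w). \<beta> y * ?g y w)"
  proof (rule P.Fubini_integrable)
    show "(\<lambda>(y, w). \<beta> y * ?g y w) \<in> borel_measurable (M \<Otimes>\<^sub>M lborel)" by measurable
    show "AE y in M. integrable lborel (\<lambda>w. case (y, w) of (y, w) \<Rightarrow> \<beta> y * ?g y w)"
      using ig by simp
    have "integrable M (\<lambda>y. (C * (1 + \<bar>c\<bar>) ^ (q + b + 1)) * \<bar>\<beta> y * (1 + \<bar>y\<bar>) ^ (q + b + 1)\<bar>)"
      by (intro integrable_mult_right integrable_abs \<beta>)
    then show "integrable M (\<lambda>y. \<integral>w. norm (case (y, w) of (y, w) \<Rightarrow> \<beta> y * ?g y w) \<partial>lborel)"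
    proof (rule Bochner_Integration.integrable_bound)
      show "AE y in M. norm (\<integral>w. norm (case (y, w) of (y, w) \<Rightarrow> \<beta> y * ?g y w) \<partial>lborel)
          \<le> norm ((C * (1 + \<bar>c\<bar>) ^ (q + b + 1)) * \<bar>\<beta> y * (1 + \<bar>y\<bar>) ^ (q + b + 1)\<bar>)"
      proof (rule AE_I2)
        fix y
        have eq: "(\<integral>w. norm (case (y, w) of (y, w) \<Rightarrow> \<beta> y * ?g y w) \<partial>lborel) = \<bar>\<beta> y\<bar> * (\<integral>w. \<bar>?g y w\<bar> \<partial>lborel)"
          by (simp only: prod.case real_norm_def abs_mult[of "\<beta> y"] integral_mult_right_zero)
        have 0: "0 \<le> \<bar>\<beta> y\<bar> * (\<integral>w. \<bar>?g y w\<bar> \<partial>lborel)"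
          by (intro mult_nonneg_nonneg integral_nonneg_AE) auto
        have "\<bar>\<beta> y\<bar> * (\<integral>w. \<bar>?g y w\<bar> \<partial>lborel) \<le> \<bar>\<beta> y\<bar> * (C * (1 + \<bar>c\<bar>) ^ (q + b + 1) * (1 + \<bar>y\<bar>) ^ (q + b + 1))"
          unfolding C_def by (intro mult_left_mono tr(3)) auto
        also have "\<dots> = (C * (1 + \<bar>c\<bar>) ^ (q + b + 1)) * \<bar>\<beta> y * (1 + \<bar>y\<bar>) ^ (q + b + 1)\<bar>"
          by (simp add: abs_mult)
        also have "\<dots> \<le> norm \<dots>" by (simp only: real_norm_def abs_ge_self)
        finally show "norm (\<integral>w. norm (case (y, w) of (y, w) \<Rightarrow> \<beta> y * ?g y w) \<partial>lborel)
          \<le> norm ((C * (1 + \<bar>c\<bar>) ^ (q + b + 1)) * \<bar>\<beta> y * (1 + \<bar>y\<bar>) ^ (q + b + 1)\<bar>)"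
          unfolding eq using 0 by simp
      qed
    qed measurable
  qed
  have eq: "(\<integral>y. \<beta> y * ?g y w \<partial>M) = Df (Suc b) w * (\<integral>y. \<beta> y * (oind c y w * dpow b (y - w)) \<partial>M)" for w
    by (subst integral_mult_right_zero[symmetric]) (simp add: mult_ac)
  show "integrable lborel (\<lambda>w. Df (Suc b) w * (\<integral>y. \<beta> y * (oind c y w * dpow b (y - w)) \<partial>M))"
    using P.integrable_snd[OF int] by (simp add: eq)
  show "(\<integral>w. Df (Suc b) w * (\<integral>y. \<beta> y * (oind c y w * dpow b (y - w)) \<partial>M) \<partial>lborel) =
      (\<integral>y. \<beta> y * (Df 0 y - (\<Sum>k\<le>b. Df k c * dpow k (y - c))) \<partial>M)"
    using P.Fubini_integral[OF int] by (simp add: eq tr(2))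
qed

lemma integrable_mult_pgrow:
  fixes M :: "real measure"
  assumes sets: "sets M = sets borel" and f: "f \<in> borel_measurable borel" "integrable M (\<lambda>y. f y * (1 + \<bar>y\<bar>) ^ q)"
    and g: "pgrow q g"
  shows "integrable M (\<lambda>y. f y * g y)"
proof -
  obtain C where C: "C \<ge> 0" "\<And>y. \<bar>g y\<bar> \<le> C * (1 + \<bar>y\<bar>) ^ q" using g by (rule pgrowE) blast
  note [measurable] = f(1) pgrow_measurable[OF g] and [measurable_cong] = sets
  have "integrable M (\<lambda>y. C * (f y * (1 + \<bar>y\<bar>) ^ q))" using f(2) by (rule integrable_mult_right)
  then show ?thesis
  proof (rule Bochner_Integration.integrable_bound)
    have "\<bar>f y * g y\<bar> \<le> \<bar>C * (f y * (1 + \<bar>y\<bar>) ^ q)\<bar>" for y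
    proof -
      have "\<bar>f y * g y\<bar> \<le> \<bar>f y\<bar> * (C * (1 + \<bar>y\<bar>) ^ q)"
        unfolding abs_mult by (intro mult_left_mono C) auto
      also have "\<dots> = \<bar>C * (f y * (1 + \<bar>y\<bar>) ^ q)\<bar>" using C(1) by (simp add: abs_mult)
      finally show ?thesis .
    qed
    then show "AE y in M. norm (f y * g y) \<le> norm (C * (f y * (1 + \<bar>y\<bar>) ^ q))"
      by simp
  qed measurable
qed

section \<open>The kernel of a biorthogonal system\<close>

locale biorthogonal = sigma_finite_measure \<mu> for \<mu> :: "real measure" +
  fixes n :: nat and \<psi> :: "nat \<Rightarrow> real \<Rightarrow> real"
  assumes sets_\<mu>: "sets \<mu> = sets borel"
    and n_pos: "1 \<le> n"
    and \<psi>_measurable: "\<And>l. l < n \<Longrightarrow> \<psi> l \<in> borel_measurable borel"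
    and \<psi>_moment: "\<And>l. l < n \<Longrightarrow> integrable \<mu> (\<lambda>y. \<psi> l y * (1 + \<bar>y\<bar>) ^ (n - 1))"
    and \<psi>_dual: "\<And>l k. l < n \<Longrightarrow> k < n \<Longrightarrow> (\<integral>y. \<psi> l y * dpow k y \<partial>\<mu>) = of_bool (l = k)"
begin

definition row_measure :: "nat \<Rightarrow> real measure" where
  "row_measure s = (if s < n then lborel else \<mu>)"

text \<open>
  The individual terms of \<open>Kf s w t v\<close> do not decay as \<open>w\<close> tends to \<open>- \<infinity>\<close>; the lemma \<open>Kf_oind\<close> below
  exhibits the cancellation that makes their sum decay in both directions.
\<close>

definition H :: "nat \<Rightarrow> nat \<Rightarrow> real \<Rightarrow> real" where
  "H r l u = (if r < n then \<integral>y. \<psi> l y * ppow (n - r - 1) (y - u) \<partial>\<mu> else \<psi> l u)"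

definition Kf :: "nat \<Rightarrow> real \<Rightarrow> nat \<Rightarrow> real \<Rightarrow> real" where
  "Kf r u s v = (\<Sum>l<n. H r l u * ediff (n - s) l v) - (if r < s then ppow (s - r - 1) (v - u) else 0)"

text \<open>Row \<open>n\<close> of the kernel, as a function of its first variable. It is a
  reproducing kernel: integration against it takes a polynomial of degree below \<open>n\<close> to
  its \<open>n - t\<close>-th derivative at \<open>v\<close>.\<close>

definition \<beta> :: "nat \<Rightarrow> real \<Rightarrow> real \<Rightarrow> real" where
  "\<beta> t v y = (\<Sum>l<n. \<psi> l y * ediff (n - t) l v)"

lemmas integrable_\<psi> = integrable_mult_pgrow[OF sets_\<mu> \<psi>_measurable \<psi>_moment]

lemma \<beta>_measurable [measurable]: "\<beta> t v \<in> borel_measurable borel"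
  unfolding \<beta>_def by (intro borel_measurable_sum borel_measurable_times) (auto intro: \<psi>_measurable)

lemma integral_\<beta>:
  assumes "pgrow (n - 1) g"
  shows "integrable \<mu> (\<lambda>y. \<beta> t v y * g y)"
    and "(\<integral>y. \<beta> t v y * g y \<partial>\<mu>) = (\<Sum>l<n. (\<integral>y. \<psi> l y * g y \<partial>\<mu>) * ediff (n - t) l v)"
proof -
  have eq: "\<beta> t v y * g y = (\<Sum>l<n. \<psi> l y * g y * ediff (n - t) l v)" for y
    by (simp add: \<beta>_def sum_distrib_left sum_distrib_right mult_ac)
  have i: "integrable \<mu> (\<lambda>y. \<psi> l y * g y * ediff (n - t) l v)" if "l \<in> {..<n}" for l
    using that assms by (intro integrable_mult_left integrable_\<psi>) auto
  show "integrable \<mu> (\<lambda>y. \<beta> t v y * g y)"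
    unfolding eq by (intro Bochner_Integration.integrable_sum i)
  show "(\<integral>y. \<beta> t v y * g y \<partial>\<mu>) = (\<Sum>l<n. (\<integral>y. \<psi> l y * g y \<partial>\<mu>) * ediff (n - t) l v)"
    unfolding eq by (subst Bochner_Integration.integral_sum[OF i]) auto
qed

lemma \<beta>_moment: "integrable \<mu> (\<lambda>y. \<beta> t v y * (1 + \<bar>y\<bar>) ^ (n - 1))"
  by (rule integral_\<beta>(1)) (auto simp: pgrow_def intro!: exI[of _ 1])

lemma integral_\<beta>_dpow:
  assumes "k < n"
  shows "(\<integral>y. \<beta> t v y * dpow k y \<partial>\<mu>) = ediff (n - t) k v"
proof -
  have "(\<integral>y. \<beta> t v y * dpow k y \<partial>\<mu>) = (\<Sum>l<n. of_bool (l = k) * ediff (n - t) l v)"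
    using assms by (subst integral_\<beta>(2)) (auto intro: pgrow_dpow0 simp: \<psi>_dual)
  also have "\<dots> = (\<Sum>l<n. if l = k then ediff (n - t) l v else 0)"
    by (intro sum.cong refl) auto
  also have "\<dots> = ediff (n - t) k v" using assms by simp
  finally show ?thesis .
qed

text \<open>The binomial theorem carries the reproducing property over to powers centred at
  \<open>w\<close>.\<close>

lemma integral_\<beta>_shift:
  assumes k: "k < n"
  shows "(\<integral>y. \<beta> t v y * dpow k (y - w) \<partial>\<mu>) = ediff (n - t) k (v - w)"
proof -
  let ?d = "n - t"
  have eq: "dpow k (y - w) = (\<Sum>j\<le>k. dpow j y * dpow (k - j) (- w))" for y
    using dpow_add[of k y "- w"] by simp
  have "(\<integral>y. \<beta> t v y * dpow k (y - w) \<partial>\<mu>) = (\<integral>y. (\<Sum>j\<le>k. \<beta> t v y * dpow j y * dpow (k - j) (- w)) \<partial>\<mu>)"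
    by (simp add: eq sum_distrib_left mult_ac)
  also have "\<dots> = (\<Sum>j\<le>k. ediff ?d j v * dpow (k - j) (- w))"
    using k by (subst Bochner_Integration.integral_sum)
      (auto intro!: integrable_mult_left integral_\<beta> pgrow_dpow0 simp: integral_\<beta>_dpow)
  also have "\<dots> = ediff ?d k (v - w)"
  proof (cases "?d \<le> k")
    case True
    have "(\<Sum>j\<le>k. ediff ?d j v * dpow (k - j) (- w)) = (\<Sum>j\<in>{?d..k}. dpow (j - ?d) v * dpow (k - j) (- w))"
      by (rule sum.mono_neutral_cong_right) (auto simp: ediff_def)
    also have "\<dots> = (\<Sum>i\<le>k - ?d. dpow i v * dpow (k - ?d - i) (- w))"
      by (rule sum.reindex_bij_witness[of _ "\<lambda>i. i + ?d" "\<lambda>j. j - ?d"]) (use True in auto)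
    also have "\<dots> = dpow (k - ?d) (v - w)" using dpow_add[of "k - ?d" v "- w"] by simp
    finally show ?thesis using True by (simp add: ediff_def)
  qed (simp add: ediff_def)
  finally show ?thesis .
qed

lemma integral_\<beta>_ppow:
  assumes "r < n"
  shows "(\<integral>y. \<beta> t v y * ppow (n - Suc r) (y - u) \<partial>\<mu>) = (\<Sum>l<n. H r l u * ediff (n - t) l v)"
  using assms by (subst integral_\<beta>(2)) (auto intro: pgrow_ppow simp: H_def)

text \<open>By \<open>integral_\<beta>_shift\<close> the subtracted truncated power (zero for
  \<open>t \<le> s\<close>) is, for \<open>w < v\<close>, the integral of \<open>\<beta> t v\<close>
  against \<open>dpow (n - s - 1) (y - w)\<close>. Subtracting it replaces the indicator of
  \<open>w < y\<close> by the oriented one, which is supported between \<open>v\<close> and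
  \<open>y\<close>. This form is the source of both indicators in the final formula.\<close>

lemma Kf_oind:
  assumes s: "1 \<le> s" "s < n" and t: "t \<le> n"
  shows "Kf s w t v = (\<integral>y. \<beta> t v y * (oind v y w * dpow (n - s - 1) (y - w)) \<partial>\<mu>)"
proof -
  let ?b = "n - s - 1"
  have eq: "\<beta> t v y * (oind v y w * dpow ?b (y - w))
      = \<beta> t v y * ppow ?b (y - w) - of_bool (w < v) * (\<beta> t v y * dpow ?b (y - w))" for y
    by (simp add: oind_def ppow_def algebra_simps)
  have "(\<integral>y. \<beta> t v y * (oind v y w * dpow ?b (y - w)) \<partial>\<mu>) =
      (\<Sum>l<n. H s l w * ediff (n - t) l v) - of_bool (w < v) * ediff (n - t) ?b (v - w)"
    unfolding eq
    by (subst Bochner_Integration.integral_diff)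
       (use s in \<open>auto intro!: integrable_mult_right integral_\<beta> pgrow_ppow pgrow_dpow
         simp: integral_\<beta>_ppow integral_\<beta>_shift\<close>)
  moreover have "of_bool (w < v) * ediff (n - t) ?b (v - w) = (if s < t then ppow (t - s - 1) (v - w) else 0)"
  proof (cases "s < t")
    case True
    then have "n - t \<le> ?b" "?b - (n - t) = t - s - 1" using s t by auto
    then show ?thesis using True by (auto simp: ediff_def ppow_def)
  next
    case False
    then have "\<not> n - t \<le> ?b" using s t by auto
    then show ?thesis using False by (simp add: ediff_def)
  qed
  ultimately show ?thesis by (simp add: Kf_def)
qed

text \<open>For \<open>k \<le> n - s\<close> this is an \<open>(n - s - k)\<close>-fold antiderivative of \<open>v \<mapsto> Kf r u s v\<close>.\<close>

definition Kanti :: "nat \<Rightarrow> real \<Rightarrow> nat \<Rightarrow> nat \<Rightarrow> real \<Rightarrow> real" where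
  "Kanti r u s k w = (\<Sum>l<n. H r l u * ediff k l w) - (if r < s then ppow (n - r - 1 - k) (w - u) else 0)"

lemma Kanti_Suc:
  assumes "1 \<le> s" "s < n"
  shows "Kanti r u s (Suc (n - s - 1)) w = Kf r u s w"
proof -
  have "Suc (n - s - 1) = n - s" "r < s \<Longrightarrow> n - r - 1 - (n - s) = s - r - 1" using assms by auto
  then show ?thesis unfolding Kanti_def Kf_def by auto
qed

lemma continuous_Kanti:
  assumes "1 \<le> s" "s < n" "k \<le> n - s - 1"
  shows "continuous_on UNIV (Kanti r u s k)"
proof (cases "r < s")
  case True
  define m where "m = n - r - 2 - k"
  have m: "n - r - 1 - k = Suc m" using True assms by (auto simp: m_def)
  show ?thesis
    unfolding Kanti_def m using True
    by (auto intro!: continuous_intros continuous_ediff continuous_on_compose2[OF continuous_ppow])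
qed (auto simp: Kanti_def intro!: continuous_intros continuous_ediff)

lemma Kanti_has_derivative:
  assumes "1 \<le> s" "s < n" "k \<le> n - s - 1" "w \<noteq> u"
  shows "(Kanti r u s k has_real_derivative Kanti r u s (Suc k) w) (at w)"
proof -
  have p: "((\<lambda>w. \<Sum>l<n. H r l u * ediff k l w) has_real_derivative (\<Sum>l<n. H r l u * ediff (Suc k) l w)) (at w)"
    by (intro DERIV_sum DERIV_cmult ediff_has_derivative)
  show ?thesis
  proof (cases "r < s")
    case True
    define m where "m = n - r - 1 - Suc k"
    have m: "n - r - 1 - k = Suc m" using True assms by (auto simp: m_def)
    have "((\<lambda>w. ppow (Suc m) (w - u)) has_real_derivative (ppow m (w - u) * 1)) (at w)"
      by (rule DERIV_chain2[OF ppow_has_derivative]) (use assms in \<open>auto intro!: derivative_eq_intros\<close>)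
    from DERIV_diff[OF p this] show ?thesis by (simp only: Kanti_def[abs_def] m m_def[symmetric] True if_True mult_1_right)
  next
    case False
    then show ?thesis using p by (simp add: Kanti_def[abs_def])
  qed
qed

lemma pgrow_Kf:
  assumes "1 \<le> s" "s \<le> n"
  shows "pgrow (s - 1) (Kf r u s)"
  unfolding Kf_def[abs_def]
  by (cases "r < s")
     (use assms in \<open>auto intro!: pgrow_diff pgrow_sum pgrow_cmult pgrow_ediff pgrow_ppow pgrow_zero\<close>)

text \<open>For \<open>s = n\<close> the second factor is \<open>\<beta> t v\<close>, and its
  reproducing property applies directly. For \<open>s < n\<close> the first factor is integrated
  \<open>n - s\<close> times, which takes the second back to \<open>\<beta> t v\<close>. The
  integral of \<open>Kanti r u s 0\<close> then gives the term with \<open>s \<le> r\<close>, and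
  the boundary terms at \<open>v\<close> give the one with \<open>s < t\<close>.\<close>

lemma Kf_composition:
  assumes r: "1 \<le> r" "r \<le> n" and s: "1 \<le> s" "s \<le> n" and t: "1 \<le> t" "t \<le> n"
  shows "integrable (row_measure s) (\<lambda>w. Kf r u s w * Kf s w t v)" (is ?int)
    and "(\<integral>w. Kf r u s w * Kf s w t v \<partial>row_measure s) =
      (of_bool (s \<le> r) - of_bool (s < t)) * Kf r u t v" (is ?eq)
proof -
  have "?int \<and> ?eq"
  proof (cases "s = n")
    case True
    have K: "Kf s w t v = \<beta> t v w" for w
      using True t by (simp add: Kf_def H_def \<beta>_def)
    have g: "pgrow (n - 1) (Kf r u n)" using pgrow_Kf[of n r u] n_pos by simp
    have mu: "row_measure s = \<mu>" by (simp add: row_measure_def True)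
    have "?int" unfolding K mu using integral_\<beta>(1)[OF g, of t v] by (simp add: True mult_ac)
    moreover have "?eq"
    proof (cases "r = n")
      case True
      then have "Kf r u n w = (\<Sum>l<n. H r l u * dpow l w)" for w by (simp add: Kf_def ediff_def)
      then have "(\<integral>w. Kf r u s w * Kf s w t v \<partial>row_measure s) = (\<integral>w. (\<Sum>l<n. H r l u * (\<beta> t v w * dpow l w)) \<partial>\<mu>)"
        unfolding K mu by (simp add: \<open>s = n\<close> sum_distrib_left mult_ac)
      also have "\<dots> = (\<Sum>l<n. H r l u * ediff (n - t) l v)"
        by (subst Bochner_Integration.integral_sum)
           (auto intro!: integrable_mult_right integral_\<beta> pgrow_dpow0 simp: integral_\<beta>_dpow)
      finally show ?thesis using True \<open>s = n\<close> t by (simp add: Kf_def)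
    next
      case False
      then have rn: "r < n" using r by simp
      then have "Kf r u s w * Kf s w t v =
          (\<Sum>l<n. H r l u * (\<beta> t v w * dpow l w)) - \<beta> t v w * ppow (n - r - 1) (w - u)" for w
        unfolding K using \<open>s = n\<close>
        by (simp add: Kf_def ediff_def left_diff_distrib right_diff_distrib sum_distrib_left sum_distrib_right mult_ac)
      then have "(\<integral>w. Kf r u s w * Kf s w t v \<partial>row_measure s) =
          (\<integral>w. (\<Sum>l<n. H r l u * (\<beta> t v w * dpow l w)) - \<beta> t v w * ppow (n - r - 1) (w - u) \<partial>\<mu>)"
        unfolding mu by simp
      also have "\<dots> = (\<integral>w. (\<Sum>l<n. H r l u * (\<beta> t v w * dpow l w)) \<partial>\<mu>) - (\<integral>w. \<beta> t v w * ppow (n - r - 1) (w - u) \<partial>\<mu>)"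
        by (rule Bochner_Integration.integral_diff)
           (use rn in \<open>auto intro!: Bochner_Integration.integrable_sum integrable_mult_right integral_\<beta> pgrow_dpow0 pgrow_ppow\<close>)
      also have "(\<integral>w. (\<Sum>l<n. H r l u * (\<beta> t v w * dpow l w)) \<partial>\<mu>) = (\<Sum>l<n. H r l u * ediff (n - t) l v)"
        by (subst Bochner_Integration.integral_sum)
           (auto intro!: integrable_mult_right integral_\<beta> pgrow_dpow0 simp: integral_\<beta>_dpow)
      finally show ?thesis using rn t by (simp add: integral_\<beta>_ppow \<open>s = n\<close>)
    qed
    ultimately show ?thesis ..
  next
    case False
    then have sn: "s < n" using s by simp
    let ?b = "n - s - 1"
    let ?P = "\<Sum>l<n. H r l u * ediff (n - t) l v"
    have lb: "row_measure s = lborel" using sn by (simp add: row_measure_def)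
    \<comment> \<open>Growth \<open>s - 1\<close> of \<open>Kf r u s\<close> plus
      \<open>n - s\<close> integrations uses up the available moments of order
      \<open>n - 1\<close>.\<close>
    have e: "s - 1 + ?b + 1 = n - 1" using s sn by auto
    note D = integral_taylor_transfer[where Df = "Kanti r u s" and b = ?b and u = u and q = "s - 1" and
        c = v and \<beta> = "\<beta> t v", OF sigma_finite_measure_axioms sets_\<mu> \<beta>_measurable \<beta>_moment[of t v, folded e]
        continuous_Kanti[OF s(1) sn] Kanti_has_derivative[OF s(1) sn],
        unfolded Kanti_Suc[OF s(1) sn] Kf_oind[OF s(1) sn t(2), symmetric]]
    have g: "pgrow (s - 1) (Kanti r u s (Suc ?b))"
      using pgrow_Kf[OF s, of r u] by (simp only: Kanti_Suc[OF s(1) sn, abs_def])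
    have "?int" unfolding lb by (rule D(1)) (use g pgrow_Kf[OF s, of r u] in auto)
    moreover have "?eq"
    proof -
      have 0: "pgrow (n - 1) (Kanti r u s 0)"
        unfolding Kanti_def by (cases "r < s") (auto intro!: pgrow_diff pgrow_sum pgrow_cmult pgrow_ediff pgrow_ppow pgrow_zero)
      have "(\<integral>w. Kf r u s w * Kf s w t v \<partial>row_measure s)
          = (\<integral>y. \<beta> t v y * (Kanti r u s 0 y - (\<Sum>k\<le>?b. Kanti r u s k v * dpow k (y - v))) \<partial>\<mu>)"
        unfolding lb by (rule D(2)) (use g pgrow_Kf[OF s, of r u] in auto)
      also have "\<dots> = (\<integral>y. \<beta> t v y * Kanti r u s 0 y - (\<Sum>k\<le>?b. Kanti r u s k v * (\<beta> t v y * dpow k (y - v))) \<partial>\<mu>)"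
        by (simp add: right_diff_distrib sum_distrib_left mult_ac)
      also have "\<dots> = (\<integral>y. \<beta> t v y * Kanti r u s 0 y \<partial>\<mu>) - (\<Sum>k\<le>?b. Kanti r u s k v * (\<integral>y. \<beta> t v y * dpow k (y - v) \<partial>\<mu>))"
      proof -
        have i: "integrable \<mu> (\<lambda>y. Kanti r u s k v * (\<beta> t v y * dpow k (y - v)))" if "k \<in> {..?b}" for k
          using that by (intro integrable_mult_right integral_\<beta> pgrow_dpow) auto
        show ?thesis
          by (subst Bochner_Integration.integral_diff[OF integral_\<beta>(1)[OF 0] Bochner_Integration.integrable_sum[OF i]])
             (simp_all only: Bochner_Integration.integral_sum[OF i] integral_mult_right_zero)
      qed
      \<comment> \<open>Reproduction at the centre \<open>v\<close> gives a divided power at 0, so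
        only \<open>k = n - t\<close> survives; it lies in the range exactly when
        \<open>s < t\<close>.\<close>
      also have "(\<Sum>k\<le>?b. Kanti r u s k v * (\<integral>y. \<beta> t v y * dpow k (y - v) \<partial>\<mu>))
          = (\<Sum>k\<le>?b. if k = n - t then Kanti r u s (n - t) v else 0)"
        by (intro sum.cong refl) (use sn in \<open>auto simp: integral_\<beta>_shift ediff_def dpow_zero\<close>)
      also have "\<dots> = of_bool (s < t) * Kanti r u s (n - t) v"
        using sn t by auto
      \<comment> \<open>The polynomial part reproduces \<open>?P\<close>; for \<open>r < s\<close>
        the truncated power integrates to \<open>?P\<close> as well and cancels it.\<close>
      also have "(\<integral>y. \<beta> t v y * Kanti r u s 0 y \<partial>\<mu>) = of_bool (s \<le> r) * ?P"
      proof -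
        have "(\<integral>y. \<beta> t v y * Kanti r u s 0 y \<partial>\<mu>)
           = (\<integral>y. (\<Sum>l<n. H r l u * (\<beta> t v y * dpow l y)) - of_bool (r < s) * (\<beta> t v y * ppow (n - r - 1) (y - u)) \<partial>\<mu>)"
          by (simp add: Kanti_def ediff_def right_diff_distrib sum_distrib_left mult_ac)
        also have "\<dots> = ?P - of_bool (r < s) * (\<integral>y. \<beta> t v y * ppow (n - r - 1) (y - u) \<partial>\<mu>)"
        proof -
          have i: "integrable \<mu> (\<lambda>y. H r l u * (\<beta> t v y * dpow l y))" if "l \<in> {..<n}" for l
            using that by (intro integrable_mult_right integral_\<beta> pgrow_dpow0) auto
          have i': "integrable \<mu> (\<lambda>y. of_bool (r < s) * (\<beta> t v y * ppow (n - r - 1) (y - u)))"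
            by (intro integrable_mult_right integral_\<beta> pgrow_ppow) auto
          have "(\<integral>y. (\<Sum>l<n. H r l u * (\<beta> t v y * dpow l y)) \<partial>\<mu>) = (\<Sum>l<n. \<integral>y. H r l u * (\<beta> t v y * dpow l y) \<partial>\<mu>)"
            by (rule Bochner_Integration.integral_sum[OF i])
          also have "\<dots> = ?P" by (simp add: integral_\<beta>_dpow)
          finally show ?thesis
            by (subst Bochner_Integration.integral_diff[OF Bochner_Integration.integrable_sum[OF i] i'])
               (simp_all only: integral_mult_right_zero)
        qed
        also have "\<dots> = of_bool (s \<le> r) * ?P"
          using sn by (auto simp: integral_\<beta>_ppow)
        finally show ?thesis .
      qed
      also have "of_bool (s \<le> r) * ?P - of_bool (s < t) * Kanti r u s (n - t) v = (of_bool (s \<le> r) - of_bool (s < t)) * Kf r u t v"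
      proof -
        have "s < t \<Longrightarrow> r < s \<Longrightarrow> n - r - 1 - (n - t) = t - r - 1" using sn t by auto
        then show ?thesis by (auto simp: Kanti_def Kf_def)
      qed
      finally show ?thesis .
    qed
    ultimately show ?thesis ..
  qed
  then show ?int ?eq by auto
qed

text \<open>On the diagonal there is no truncated power, and \<open>ediff (n - s) l\<close> vanishes
  for \<open>l < n - s\<close>. Each of the \<open>s\<close> remaining terms integrates to 1, by
  \<open>n - s\<close> integrations by parts and biorthogonality.\<close>

lemma Kf_trace:
  assumes s: "1 \<le> s" "s \<le> n"
  shows "integrable (row_measure s) (\<lambda>w. Kf s w s w)" (is ?int)
    and "(\<integral>w. Kf s w s w \<partial>row_measure s) = real s" (is ?eq)
proof -
  have K: "Kf s w s w = (\<Sum>l\<in>{n - s..<n}. H s l w * ediff (n - s) l w)" for w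
    unfolding Kf_def by (simp, rule sum.mono_neutral_right) (auto simp: ediff_def)
  have main: "integrable (row_measure s) (\<lambda>w. H s l w * ediff (n - s) l w) \<and>
      (\<integral>w. H s l w * ediff (n - s) l w \<partial>row_measure s) = 1" if l: "l \<in> {n - s..<n}" for l
  proof (cases "s = n")
    case True
    then show ?thesis using l
      by (auto simp: row_measure_def H_def ediff_def \<psi>_dual intro!: integrable_\<psi> pgrow_dpow0)
  next
    case False
    then have sn: "s < n" using s by simp
    let ?b = "n - s - 1"
    have lb: "row_measure s = lborel" using sn by (simp add: row_measure_def)
    have e: "s - 1 + ?b + 1 = n - 1" using s sn by auto
    have Sb: "Suc ?b = n - s" using sn by simp
    have ln: "l < n" using l by simp
    \<comment> \<open>Since \<open>l \<ge> n - s\<close>, \<open>\<psi> l\<close> is orthogonal to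
      the powers up to \<open>n - s - 1\<close>. Its antiderivatives from both ends therefore agree,
      and an oriented indicator may replace \<open>ppow\<close>. It is based at 0 because the
      boundary terms \<open>ediff k l 0\<close> with \<open>k < l\<close> vanish there.\<close>
    have H: "(\<integral>y. \<psi> l y * (oind 0 y w * dpow ?b (y - w)) \<partial>\<mu>) = H s l w" for w
    proof -
      have i: "integrable \<mu> (\<lambda>y. \<psi> l y * dpow ?b (y - w))" "integrable \<mu> (\<lambda>y. \<psi> l y * ppow ?b (y - w))"
        using ln by (auto intro!: integrable_\<psi> pgrow_dpow pgrow_ppow)
      have "(\<integral>y. \<psi> l y * dpow ?b (y - w) \<partial>\<mu>) = (\<integral>y. (\<Sum>j\<le>?b. \<psi> l y * dpow j y * dpow (?b - j) (- w)) \<partial>\<mu>)"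
        using dpow_add[of ?b _ "- w"] by (simp add: sum_distrib_left mult_ac)
      also have "\<dots> = (\<Sum>j\<le>?b. (\<integral>y. \<psi> l y * dpow j y \<partial>\<mu>) * dpow (?b - j) (- w))"
        using ln by (subst Bochner_Integration.integral_sum) (auto intro!: integrable_mult_left integrable_\<psi> pgrow_dpow0)
      also have "\<dots> = 0"
        using l sn by (intro sum.neutral) (auto simp: \<psi>_dual)
      finally have z: "(\<integral>y. \<psi> l y * dpow ?b (y - w) \<partial>\<mu>) = 0" .
      have "(\<integral>y. \<psi> l y * (oind 0 y w * dpow ?b (y - w)) \<partial>\<mu>) =
          (\<integral>y. \<psi> l y * ppow ?b (y - w) - of_bool (w < 0) * (\<psi> l y * dpow ?b (y - w)) \<partial>\<mu>)"
        by (rule Bochner_Integration.integral_cong) (auto simp: oind_def ppow_def algebra_simps)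
      also have "\<dots> = (\<integral>y. \<psi> l y * ppow ?b (y - w) \<partial>\<mu>)"
        by (subst Bochner_Integration.integral_diff) (use i z in auto)
      finally show ?thesis using sn by (simp add: H_def)
    qed
    have g: "pgrow (s - 1) (ediff (Suc ?b) l)"
      unfolding Sb by (rule pgrow_ediff) (use ln in auto)
    note D = integral_taylor_transfer[where Df = "\<lambda>k. ediff k l" and b = ?b and u = 0 and q = "s - 1" and
        c = 0 and \<beta> = "\<psi> l", OF sigma_finite_measure_axioms sets_\<mu> \<psi>_measurable[OF ln] \<psi>_moment[OF ln, folded e]
        continuous_ediff ediff_has_derivative g, unfolded H Sb]
    have "(\<integral>w. ediff (n - s) l w * H s l w \<partial>lborel) = (\<integral>y. \<psi> l y * dpow l y \<partial>\<mu>)"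
      unfolding D(2)
    proof (rule Bochner_Integration.integral_cong[OF refl])
      fix y
      have "(\<Sum>k\<le>?b. ediff k l 0 * dpow k (y - 0)) = 0"
        by (rule sum.neutral) (use l sn in \<open>auto simp: ediff_def dpow_zero\<close>)
      then show "\<psi> l y * (ediff 0 l y - (\<Sum>k\<le>?b. ediff k l 0 * dpow k (y - 0))) = \<psi> l y * dpow l y"
        by (simp add: ediff_def)
    qed
    then show ?thesis using D(1) \<psi>_dual[OF ln ln] by (simp add: lb mult.commute)
  qed
  show ?int unfolding K using main by (intro Bochner_Integration.integrable_sum) auto
  have "(\<integral>w. Kf s w s w \<partial>row_measure s) = (\<Sum>l\<in>{n - s..<n}. 1)"
    unfolding K using main by (subst Bochner_Integration.integral_sum) auto
  then show ?eq using s by simp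
qed

end

section \<open>Integrating out points\<close>

lemma gdet_id: "finite J \<Longrightarrow> gdet J (\<lambda>i j. of_bool (i = j)) = 1"
proof -
  assume J: "finite J"
  obtain f where f: "bij_betw f {..<card J} J" using ex_enum[OF J] .
  then have inj: "inj_on f {..<card J}" by (simp add: bij_betw_def)
  have "Matrix.mat (card J) (card J) (\<lambda>(i, j). of_bool (f i = f j)) = (1\<^sub>m (card J) :: real mat)"
    by (rule eq_matI) (use inj in \<open>auto simp: inj_on_def\<close>)
  then show ?thesis by (simp add: gdet_det_enum[OF f])
qed

lemma gdet_singleton: "gdet {a} M = M a a"
  using gdet_insert[of "{}" a M] by (simp add: gdet_def)

lemma gdet_upper_triangular:
  fixes s :: nat
  assumes "\<And>i j. j < i \<Longrightarrow> M i j = 0"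
  shows "gdet {1..s} M = (\<Prod>i\<in>{1..s}. M i i)"
proof (induction s)
  case (Suc s)
  have "gdet ({1..s} \<union> {Suc s}) M = gdet {1..s} M * gdet {Suc s} M"
    by (rule gdet_block) (use assms in auto)
  moreover have "{1..Suc s} = {1..s} \<union> {Suc s}" by auto
  ultimately show ?case using Suc by (simp add: gdet_singleton)
qed simp

lemma gdet_lower_unitriangular: "gdet {1..s} (\<lambda>i j. of_bool (j \<le> i)) = 1" for s :: nat
proof -
  have "gdet {1..s} (\<lambda>i j. of_bool (j \<le> i)) = gdet {1..s} (\<lambda>i j. of_bool (i \<le> j))"
    by (rule gdet_transpose) simp
  also have "\<dots> = 1" by (subst gdet_upper_triangular) auto
  finally show ?thesis .
qed

text \<open>
  Row \<open>i < s\<close> of the matrix is determined by the number \<open>c i\<close> of \<open>j\<close> with \<open>a i < b j\<close>; the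
  determinant vanishes unless these numbers are distinct and lie in \<open>{1..<s}\<close>.
\<close>

lemma gdet_interlacing:
  fixes a b :: "nat \<Rightarrow> real"
  assumes a: "\<And>i j. 1 \<le> i \<Longrightarrow> i < j \<Longrightarrow> j < s \<Longrightarrow> a j < a i"
    and b: "\<And>i j. 1 \<le> i \<Longrightarrow> i < j \<Longrightarrow> j \<le> s \<Longrightarrow> b j < b i"
    and ab: "\<And>i j. i \<in> {1..<s} \<Longrightarrow> j \<in> {1..s} \<Longrightarrow> a i \<noteq> b j"
  shows "gdet {1..s} (\<lambda>i j. of_bool (i < s \<longrightarrow> a i < b j)) =
    of_bool (\<forall>i\<in>{1..<s}. b (i + 1) < a i \<and> a i < b i)"
proof -
  let ?M = "\<lambda>i j. of_bool (i < s \<longrightarrow> a i < b j) :: real"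
  have bmono: "i \<le> j \<longleftrightarrow> b j \<le> b i" if "i \<in> {1..s}" "j \<in> {1..s}" for i j
    using that b[of i j] b[of j i] by (cases i j rule: linorder_cases) auto
  define c where "c i = card {j\<in>{1..s}. a i < b j}" for i
  have c: "j \<le> c i \<longleftrightarrow> a i < b j" if j: "j \<in> {1..s}" for i j
  proof
    assume *: "a i < b j"
    have "a i < b k" if "k \<in> {1..j}" for k using bmono[of k j] that j * by auto
    then have "{1..j} \<subseteq> {j\<in>{1..s}. a i < b j}" using j by auto
    from card_mono[OF _ this] show "j \<le> c i" by (simp add: c_def)
  next
    assume *: "j \<le> c i"
    show "a i < b j"
    proof (rule ccontr)
      assume "\<not> a i < b j"
      then have "j' < j" if "j' \<in> {1..s}" "a i < b j'" for j' using bmono[OF j that(1)] that by linarith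
      then have "{j\<in>{1..s}. a i < b j} \<subseteq> {1..<j}" by auto
      from card_mono[OF _ this] have "c i \<le> j - 1" by (simp add: c_def)
      then show False using * j by auto
    qed
  qed
  have cs: "c i \<le> s" for i
  proof -
    have "c i \<le> card {1..s}" unfolding c_def by (rule card_mono) auto
    then show ?thesis by simp
  qed
  show ?thesis
  proof (cases "\<forall>i\<in>{1..<s}. c i = i")
    case True
    have "gdet {1..s} ?M = gdet {1..s} (\<lambda>i j. of_bool (j \<le> i))"
    proof (rule gdet_cong)
      fix i j assume ij: "i \<in> {1..s}" "j \<in> {1..s}"
      show "?M i j = of_bool (j \<le> i)"
        using c[OF ij(2), of i] True ij by (cases "i < s") auto
    qed
    moreover have "of_bool (\<forall>i\<in>{1..<s}. b (i + 1) < a i \<and> a i < b i) = (1 :: real)"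
    proof (rule iffD2[OF of_bool_eq_1_iff], rule ballI)
      fix i assume i: "i \<in> {1..<s}"
      have "a i < b i" using c[of i i] True i by auto
      moreover have "\<not> a i < b (i + 1)" using c[of "i + 1" i] True i by auto
      moreover have "a i \<noteq> b (i + 1)" using i by (intro ab) auto
      ultimately show "b (i + 1) < a i \<and> a i < b i" by auto
    qed
    ultimately show ?thesis by (simp only: gdet_lower_unitriangular)
  next
    case False
    then obtain i0 where i0: "i0 \<in> {1..<s}" "c i0 \<noteq> i0" by auto
    \<comment> \<open>A non-zero determinant has no zero row and no repeated row, row
      \<open>s\<close> being constant 1; this makes \<open>c\<close> an injective map of
      \<open>{1..<s}\<close> into itself. As \<open>a\<close> decreases, \<open>c\<close> is also
      monotone, and an injective monotone self-map is the identity.\<close>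
    have "gdet {1..s} ?M = 0"
    proof (rule ccontr)
      assume nz: "gdet {1..s} ?M \<noteq> 0"
      have c0: "c i \<in> {1..<s}" if i: "i \<in> {1..<s}" for i
      proof (rule ccontr)
        assume "c i \<notin> {1..<s}"
        then consider "c i = 0" | "c i = s" using cs[of i] by force
        then show False
        proof cases
          case 1
          have "gdet {1..s} ?M = 0"
            by (rule gdet_zero_row[of _ i]) (use i 1 c[of _ i] in auto)
          then show False using nz by simp
        next
          case 2
          have "gdet {1..s} ?M = 0"
            by (rule gdet_identical_rows[of _ i s]) (use i 2 c[of _ i] in auto)
          then show False using nz by simp
        qed
      qed
      have inj: "inj_on c {1..<s}"
      proof (rule inj_onI, rule ccontr)
        fix i j assume ij: "i \<in> {1..<s}" "j \<in> {1..<s}" "c i = c j" "i \<noteq> j"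
        have "gdet {1..s} ?M = 0"
          by (rule gdet_identical_rows[of _ i j]) (use ij c[of _ i] c[of _ j] in auto)
        then show False using nz by simp
      qed
      have mono: "c i \<le> c j" if "1 \<le> i" "i \<le> j" "j < s" for i j
      proof -
        have "a j \<le> a i" using a[of i j] that by (cases "i = j") auto
        then show ?thesis unfolding c_def by (intro card_mono) auto
      qed
      from i0 have "c ` {1..i0} \<subseteq> {1..c i0}" using mono[of _ i0] i0 c0 by fastforce
      moreover have "{1..i0} \<subseteq> {1..<s}" using i0 by auto
      ultimately have "card {1..i0} \<le> card {1..c i0}" by (intro card_inj_on_le[OF inj_on_subset[OF inj]]) auto
      then have "i0 \<le> c i0" by simp
      have "c ` {i0..<s} \<subseteq> {c i0..<s}" using mono[of i0] i0 c0 by fastforce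
      moreover have "{i0..<s} \<subseteq> {1..<s}" using i0 by auto
      ultimately have "card {i0..<s} \<le> card {c i0..<s}" by (intro card_inj_on_le[OF inj_on_subset[OF inj]]) auto
      then have "s - i0 \<le> s - c i0" by simp
      with \<open>i0 \<le> c i0\<close> show False using i0 cs[of i0] by auto
    qed
    moreover have "\<not> (\<forall>i\<in>{1..<s}. b (i + 1) < a i \<and> a i < b i)"
    proof
      assume *: "\<forall>i\<in>{1..<s}. b (i + 1) < a i \<and> a i < b i"
      have "a i0 < b i0" "b (i0 + 1) < a i0" using * i0 by auto
      then have "i0 \<le> c i0" "\<not> i0 + 1 \<le> c i0" using c[of i0 i0] c[of "i0 + 1" i0] i0 by auto
      then show False using i0 by auto
    qed
    ultimately show ?thesis by (simp only: of_bool_eq)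
  qed
qed

text \<open>
  With \<open>x (s - 1, s) = - \<infinity>\<close> as a virtual particle, the row group \<open>s\<close> of this matrix compares rows
  \<open>s - 1\<close> and \<open>s\<close> of the pattern.
\<close>

definition Rmat :: "nat \<Rightarrow> (nat \<times> nat \<Rightarrow> real) \<Rightarrow> nat \<times> nat \<Rightarrow> nat \<times> nat \<Rightarrow> real" where
  "Rmat n x p q =
    (if snd p < fst p
     then if fst p - 1 < fst q then ppow (fst q - fst p) (x q - x (fst p - 1, snd p)) else 0
     else ediff (n - fst q) (n - fst p) (x q))"

lemma finite_particle_index [simp]: "finite (particle_index n)"
proof -
  have "particle_index n \<subseteq> {1..n} \<times> {1..n}" by (auto simp: particle_index_def)
  then show ?thesis by (rule finite_subset) simp
qed

lemma particle_index_Suc: "particle_index (Suc m) = particle_index m \<union> Pair (Suc m) ` {1..Suc m}"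
  by (auto simp: particle_index_def image_iff)

text \<open>Entries with \<open>fst q < fst p\<close> vanish: the truncated power is absent, and
  \<open>ediff\<close> differentiates more often than the degree allows. In the diagonal blocks only
  \<open>ppow 0\<close> and \<open>dpow 0\<close> remain, that is indicators and ones.\<close>

lemma gdet_Rmat:
  assumes "m \<le> n"
  shows "gdet (particle_index m) (Rmat n x) =
    (\<Prod>s\<in>{1..m}. gdet {1..s} (\<lambda>i j. of_bool (i < s \<longrightarrow> x (s - 1, i) < x (s, j))))"
  using assms
proof (induction m)
  case 0
  have "particle_index 0 = {}" by (auto simp: particle_index_def)
  then show ?case by simp
next
  case (Suc m)
  have "gdet (particle_index (Suc m)) (Rmat n x) =
      gdet (particle_index m) (Rmat n x) * gdet (Pair (Suc m) ` {1..Suc m}) (Rmat n x)"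
    unfolding particle_index_Suc
  proof (rule gdet_block)
    fix p q assume p: "p \<in> Pair (Suc m) ` {1..Suc m}" and q: "q \<in> particle_index m"
    have "fst p = Suc m" "fst q \<le> m" using p q by (auto simp: particle_index_def)
    then show "Rmat n x p q = 0" using Suc.prems by (auto simp: Rmat_def ediff_def)
  next
    show "particle_index m \<inter> Pair (Suc m) ` {1..Suc m} = {}" by (auto simp: particle_index_def)
  qed simp_all
  also have "gdet (Pair (Suc m) ` {1..Suc m}) (Rmat n x) =
      gdet {1..Suc m} (\<lambda>i j. Rmat n x (Suc m, i) (Suc m, j))"
    by (rule gdet_reindex) (auto simp: bij_betw_def inj_on_def)
  also have "\<dots> = gdet {1..Suc m} (\<lambda>i j. of_bool (i < Suc m \<longrightarrow> x (Suc m - 1, i) < x (Suc m, j)))"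
    by (rule gdet_cong) (auto simp: Rmat_def ppow_def ediff_def)
  finally show ?case using Suc by simp
qed

text \<open>Without ties the weak inequalities of \<open>GT_closed\<close> are the strict ones of
  \<open>gdet_interlacing\<close>, so the product of indicators says whether the whole pattern
  interlaces.\<close>

lemma gdet_Rmat_sorted:
  assumes inj: "inj_on x (particle_index n)"
    and sorted: "\<And>r i j. 1 \<le> i \<Longrightarrow> i < j \<Longrightarrow> j \<le> r \<Longrightarrow> r \<le> n \<Longrightarrow> x (r, j) < x (r, i)"
  shows "gdet (particle_index n) (Rmat n x) =
    of_bool (\<forall>i r. 1 \<le> i \<and> i \<le> r \<and> r \<le> n - 1 \<longrightarrow> x (r + 1, i) \<ge> x (r, i) \<and> x (r, i) \<ge> x (r + 1, i + 1))"
proof -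
  have neq: "x p \<noteq> x q" if "p \<in> particle_index n" "q \<in> particle_index n" "p \<noteq> q" for p q
    using inj that by (auto simp: inj_on_def)
  let ?I = "\<lambda>s. \<forall>i\<in>{1..<s}. x (s, i + 1) < x (s - 1, i) \<and> x (s - 1, i) < x (s, i)"
  have "gdet (particle_index n) (Rmat n x) = (\<Prod>s\<in>{1..n}. of_bool (?I s))"
    unfolding gdet_Rmat[OF order_refl]
  proof (intro prod.cong refl)
    fix s assume s: "s \<in> {1..n}"
    show "gdet {1..s} (\<lambda>i j. of_bool (i < s \<longrightarrow> x (s - 1, i) < x (s, j))) = of_bool (?I s)"
    proof (rule gdet_interlacing)
      fix i j assume "i \<in> {1..<s}" "j \<in> {1..s}"
      then show "x (s - 1, i) \<noteq> x (s, j)" using s by (intro neq) (auto simp: particle_index_def)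
    qed (use s in \<open>auto intro!: sorted\<close>)
  qed
  also have "\<dots> = of_bool (\<forall>s\<in>{1..n}. ?I s)"
    by (induction n) (auto simp: atLeastAtMostSuc_conv)
  also have "(\<forall>s\<in>{1..n}. ?I s) \<longleftrightarrow> (\<forall>i r. 1 \<le> i \<and> i \<le> r \<and> r \<le> n - 1 \<longrightarrow> x (r + 1, i) \<ge> x (r, i) \<and> x (r, i) \<ge> x (r + 1, i + 1))"
    (is "?A \<longleftrightarrow> ?B")
  proof
    assume A: ?A
    show ?B
    proof (intro allI impI)
      fix i r assume "1 \<le> i \<and> i \<le> r \<and> r \<le> n - 1"
      then have "r + 1 \<in> {1..n}" "i \<in> {1..<r + 1}" by auto
      with A have "x (r + 1, i + 1) < x (r + 1 - 1, i) \<and> x (r + 1 - 1, i) < x (r + 1, i)" by blast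
      then show "x (r + 1, i) \<ge> x (r, i) \<and> x (r, i) \<ge> x (r + 1, i + 1)" by simp
    qed
  next
    assume B: ?B
    show ?A
    proof (intro ballI)
      fix s i assume s: "s \<in> {1..n}" and i: "i \<in> {1..<s}"
      have "1 \<le> i \<and> i \<le> s - 1 \<and> s - 1 \<le> n - 1" using s i by auto
      from B[rule_format, OF this]
      have "x (s - 1 + 1, i) \<ge> x (s - 1, i) \<and> x (s - 1, i) \<ge> x (s - 1 + 1, i + 1)" .
      moreover have "s - 1 + 1 = s" using s by simp
      moreover have "x (s, i) \<noteq> x (s - 1, i)" "x (s - 1, i) \<noteq> x (s, i + 1)"
      proof -
        have m: "(s, i) \<in> particle_index n" "(s - 1, i) \<in> particle_index n" "(s, i + 1) \<in> particle_index n"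
          using s i by (auto simp: particle_index_def)
        show "x (s, i) \<noteq> x (s - 1, i)" by (rule neq[OF m(1,2)]) (use i in auto)
        show "x (s - 1, i) \<noteq> x (s, i + 1)" by (rule neq[OF m(2,3)]) auto
      qed
      ultimately show "x (s, i + 1) < x (s - 1, i) \<and> x (s - 1, i) < x (s, i)" by simp
    qed
  qed
  finally show ?thesis .
qed

text \<open>In \<open>Lmat\<close> the column \<open>(r + 1, i)\<close> with
  \<open>i \<le> r\<close> belongs to the particle \<open>(r, i)\<close>, and the column
  \<open>(i, i)\<close> to the function of index \<open>n - i\<close>. This permutation sends each
  particle below row \<open>n\<close> to its column and \<open>(n, i)\<close> to the column
  \<open>(i, i)\<close>.\<close>

definition row_shift :: "nat \<Rightarrow> nat \<times> nat \<Rightarrow> nat \<times> nat" where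
  "row_shift n p = (if p \<notin> particle_index n then p
     else if fst p < n then (fst p + 1, snd p) else (snd p, snd p))"

lemma row_shift_permutes: "row_shift n permutes particle_index n"
proof (rule bij_imp_permutes)
  show "bij_betw (row_shift n) (particle_index n) (particle_index n)"
    by (rule bij_betw_byWitness[where f' = "\<lambda>p. if snd p < fst p then (fst p - 1, snd p) else (n, snd p)"])
       (auto simp: row_shift_def particle_index_def)
qed (simp add: row_shift_def)

text \<open>The sign of \<open>row_shift\<close> times one factor -1 for each particle below row
  \<open>n\<close>; these are the signs that arise in \<open>gdet_Lmat\<close>.\<close>

definition top_sign :: "nat \<Rightarrow> real" where
  "top_sign n = of_int (sign (row_shift n)) * (-1) ^ card (particle_index n - Pair n ` {1..n})"

lemma top_sign_nonzero: "top_sign n \<noteq> 0"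
  by (simp add: top_sign_def sign_def)

section \<open>Integrating one point out of a determinant of the kernel\<close>

context biorthogonal
begin

text \<open>Rows and positions are separate arguments, so that a position can be integrated while
  all row labels stay fixed.\<close>

definition corr :: "'a set \<Rightarrow> ('a \<Rightarrow> nat) \<Rightarrow> ('a \<Rightarrow> real) \<Rightarrow> real" where
  "corr A \<rho> x = gdet A (\<lambda>i j. Kf (\<rho> i) (x i) (\<rho> j) (x j))"

lemma corr_cong:
  assumes "\<And>i. i \<in> A \<Longrightarrow> \<rho> i = \<rho>' i" "\<And>i. i \<in> A \<Longrightarrow> x i = x' i"
  shows "corr A \<rho> x = corr A \<rho>' x'"
  unfolding corr_def by (rule gdet_cong) (simp add: assms)

text \<open>
  Removing \<open>a\<close> from its cycle \<open>j \<rightarrow> a \<rightarrow> q j\<close> flips the sign of a permutation, and the composition rule gives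
  the weight \<open>of_bool (s \<le> \<rho> j) - of_bool (s < \<rho> (q j))\<close>; summed over \<open>j\<close>, these weights do not depend
  on \<open>q\<close> and count the points of row \<open>s\<close>.
\<close>

lemma integrate_out:
  assumes A: "finite A" "a \<notin> A" and rows: "\<rho> ` insert a A \<subseteq> {1..n}"
  shows "integrable (row_measure (\<rho> a)) (\<lambda>w. corr (insert a A) \<rho> (x(a := w)))" (is ?int)
    and "(\<integral>w. corr (insert a A) \<rho> (x(a := w)) \<partial>row_measure (\<rho> a)) =
      (real (\<rho> a) - real (card {j\<in>A. \<rho> j = \<rho> a})) * corr A \<rho> x" (is ?eq)
proof -
  let ?s = "\<rho> a"
  let ?K = "\<lambda>i j. Kf (\<rho> i) (x i) (\<rho> j) (x j)"
  let ?G = "\<lambda>q j w. of_int (sign q) * (Kf (\<rho> j) (x j) ?s w * Kf ?s w (\<rho> (q j)) (x (q j)) * (\<Prod>i\<in>A - {j}. ?K i (q i)))"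
  let ?c = "\<lambda>q j. of_bool (?s \<le> \<rho> j) - of_bool (?s < \<rho> (q j)) :: real"
  have s: "1 \<le> ?s" "?s \<le> n" and r: "1 \<le> \<rho> j" "\<rho> j \<le> n" if "j \<in> A" for j
    using rows that by auto
  have s: "1 \<le> ?s" "?s \<le> n" using rows by auto
  have expand: "corr (insert a A) \<rho> (x(a := w)) =
      Kf ?s w ?s w * corr A \<rho> x - (\<Sum>q | q permutes A. \<Sum>j\<in>A. ?G q j w)" for w
  proof -
    have ne: "i \<noteq> a" if "i \<in> A" for i using that A by auto
    have "gdet A (\<lambda>i j. Kf (\<rho> i) ((x(a := w)) i) (\<rho> j) ((x(a := w)) j)) = corr A \<rho> x"
      unfolding corr_def by (rule gdet_cong) (simp add: ne)
    moreover have "(\<Sum>q | q permutes A. of_int (sign q) *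
        (\<Sum>j\<in>A. Kf (\<rho> j) ((x(a := w)) j) ?s ((x(a := w)) a) * Kf ?s ((x(a := w)) a) (\<rho> (q j)) ((x(a := w)) (q j)) *
          (\<Prod>i\<in>A - {j}. Kf (\<rho> i) ((x(a := w)) i) (\<rho> (q i)) ((x(a := w)) (q i)))))
       = (\<Sum>q | q permutes A. \<Sum>j\<in>A. ?G q j w)"
      unfolding sum_distrib_left
    proof (intro sum.cong refl)
      fix q j assume q: "q \<in> {q. q permutes A}" and j: "j \<in> A"
      have qa: "q i \<noteq> a" if "i \<in> A" for i using q that A by (auto simp: permutes_in_image)
      have "(\<Prod>i\<in>A - {j}. Kf (\<rho> i) ((x(a := w)) i) (\<rho> (q i)) ((x(a := w)) (q i))) = (\<Prod>i\<in>A - {j}. ?K i (q i))"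
        by (intro prod.cong refl) (simp add: ne qa)
      then show "of_int (sign q) * (Kf (\<rho> j) ((x(a := w)) j) ?s ((x(a := w)) a) * Kf ?s ((x(a := w)) a) (\<rho> (q j)) ((x(a := w)) (q j)) *
          (\<Prod>i\<in>A - {j}. Kf (\<rho> i) ((x(a := w)) i) (\<rho> (q i)) ((x(a := w)) (q i)))) = ?G q j w"
        using j by (simp add: ne qa)
    qed
    ultimately show ?thesis
      unfolding corr_def[of "insert a A"] gdet_insert[OF A] by simp
  qed
  have iG: "integrable (row_measure ?s) (?G q j)"
    and eG: "(\<integral>w. ?G q j w \<partial>row_measure ?s) = ?c q j * (of_int (sign q) * (\<Prod>i\<in>A. ?K i (q i)))"
    if q: "q permutes A" and j: "j \<in> A" for q j
  proof -
    have qj: "q j \<in> A" using q j by (simp add: permutes_in_image)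
    note comp = Kf_composition[OF r[OF j] s r[OF qj], of "x j" "x (q j)"]
    show "integrable (row_measure ?s) (?G q j)"
      by (intro integrable_mult_right integrable_mult_left comp(1))
    have "(\<integral>w. ?G q j w \<partial>row_measure ?s) = of_int (sign q) * (?c q j * ?K j (q j) * (\<Prod>i\<in>A - {j}. ?K i (q i)))"
      by (simp add: comp(2))
    then show "(\<integral>w. ?G q j w \<partial>row_measure ?s) = ?c q j * (of_int (sign q) * (\<Prod>i\<in>A. ?K i (q i)))"
      using prod.remove[OF A(1) j, of "\<lambda>i. ?K i (q i)"] by (simp add: mult_ac)
  qed
  have it: "integrable (row_measure ?s) (\<lambda>w. Kf ?s w ?s w * corr A \<rho> x)"
    by (intro integrable_mult_left Kf_trace s)
  have iS: "integrable (row_measure ?s) (\<lambda>w. \<Sum>q | q permutes A. \<Sum>j\<in>A. ?G q j w)"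
    by (intro Bochner_Integration.integrable_sum iG) auto
  show ?int unfolding expand by (intro Bochner_Integration.integrable_diff it iS)
  have "(\<integral>w. corr (insert a A) \<rho> (x(a := w)) \<partial>row_measure ?s) =
      (\<integral>w. Kf ?s w ?s w * corr A \<rho> x \<partial>row_measure ?s) - (\<integral>w. (\<Sum>q | q permutes A. \<Sum>j\<in>A. ?G q j w) \<partial>row_measure ?s)"
    unfolding expand by (rule Bochner_Integration.integral_diff[OF it iS])
  also have "(\<integral>w. Kf ?s w ?s w * corr A \<rho> x \<partial>row_measure ?s) = real ?s * corr A \<rho> x"
    using Kf_trace[OF s] by simp
  also have "(\<integral>w. (\<Sum>q | q permutes A. \<Sum>j\<in>A. ?G q j w) \<partial>row_measure ?s) =
      (\<Sum>q | q permutes A. \<integral>w. (\<Sum>j\<in>A. ?G q j w) \<partial>row_measure ?s)"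
    by (rule Bochner_Integration.integral_sum) (intro Bochner_Integration.integrable_sum iG, auto)
  also have "\<dots> = (\<Sum>q | q permutes A. \<Sum>j\<in>A. ?c q j * (of_int (sign q) * (\<Prod>i\<in>A. ?K i (q i))))"
    by (intro sum.cong refl, subst Bochner_Integration.integral_sum) (auto simp only: iG eG mem_Collect_eq intro!: sum.cong)
  also have "\<dots> = (\<Sum>q | q permutes A. real (card {j\<in>A. \<rho> j = ?s}) * (of_int (sign q) * (\<Prod>i\<in>A. ?K i (q i))))"
  proof (intro sum.cong refl)
    fix q assume "q \<in> {q. q permutes A}"
    then have q: "q permutes A" by simp
    have "(\<Sum>j\<in>A. ?c q j) = (\<Sum>j\<in>A. of_bool (?s \<le> \<rho> j)) - (\<Sum>j\<in>A. of_bool (?s < \<rho> (q j)))"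
      by (rule sum_subtractf)
    also have "(\<Sum>j\<in>A. of_bool (?s < \<rho> (q j)) :: real) = (\<Sum>j\<in>A. of_bool (?s < \<rho> j))"
      by (rule sum.reindex_bij_betw[OF permutes_imp_bij[OF q]])
    also have "(\<Sum>j\<in>A. of_bool (?s \<le> \<rho> j)) - (\<Sum>j\<in>A. of_bool (?s < \<rho> j)) = (\<Sum>j\<in>A. of_bool (\<rho> j = ?s) :: real)"
      unfolding sum_subtractf[symmetric] by (intro sum.cong) auto
    also have "\<dots> = real (card {j\<in>A. \<rho> j = ?s})"
      using A by (simp add: of_bool_def sum.If_cases Int_def)
    finally show "(\<Sum>j\<in>A. ?c q j * (of_int (sign q) * (\<Prod>i\<in>A. ?K i (q i)))) =
        real (card {j\<in>A. \<rho> j = ?s}) * (of_int (sign q) * (\<Prod>i\<in>A. ?K i (q i)))"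
      by (simp only: sum_distrib_right[symmetric])
  qed
  also have "\<dots> = real (card {j\<in>A. \<rho> j = ?s}) * corr A \<rho> x"
    by (simp add: corr_def gdet_def sum_distrib_left)
  finally show ?eq by (simp only: left_diff_distrib)
qed

text \<open>\<open>\<eta>\<close> will be \<open>1 / \<kappa>\<close>, whose sign is not yet known.
  The second claim hands non-negativity down to the remaining points, where the induction needs
  it.\<close>

lemma nn_integrate_out:
  assumes A: "finite A" "a \<notin> A" and rows: "\<rho> ` insert a A \<subseteq> {1..n}"
    and pos: "AE w in row_measure (\<rho> a). 0 \<le> \<eta> * corr (insert a A) \<rho> (x(a := w))"
  shows "(\<integral>\<^sup>+w. ennreal (\<eta> * corr (insert a A) \<rho> (x(a := w))) \<partial>row_measure (\<rho> a)) =
      ennreal ((real (\<rho> a) - real (card {j\<in>A. \<rho> j = \<rho> a})) * (\<eta> * corr A \<rho> x))"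
    and "0 \<le> (real (\<rho> a) - real (card {j\<in>A. \<rho> j = \<rho> a})) * (\<eta> * corr A \<rho> x)"
proof -
  note I = integrate_out[OF A rows, of x]
  have eq: "(\<integral>w. \<eta> * corr (insert a A) \<rho> (x(a := w)) \<partial>row_measure (\<rho> a)) =
      (real (\<rho> a) - real (card {j\<in>A. \<rho> j = \<rho> a})) * (\<eta> * corr A \<rho> x)"
    by (simp add: I(2) mult_ac)
  show "(\<integral>\<^sup>+w. ennreal (\<eta> * corr (insert a A) \<rho> (x(a := w))) \<partial>row_measure (\<rho> a)) =
      ennreal ((real (\<rho> a) - real (card {j\<in>A. \<rho> j = \<rho> a})) * (\<eta> * corr A \<rho> x))"
    using nn_integral_eq_integral[OF integrable_mult_right[OF I(1)] pos] by (simp only: eq)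
  show "0 \<le> (real (\<rho> a) - real (card {j\<in>A. \<rho> j = \<rho> a})) * (\<eta> * corr A \<rho> x)"
    using integral_nonneg_AE[OF pos] by (simp only: eq)
qed

text \<open>The kernel factors through the particles and the indices \<open>l < n\<close>. A column
  in a row up to \<open>s\<close> meets only particles in rows below \<open>s\<close> and the
  \<open>s\<close> indices \<open>l \<ge> n - s\<close>; these are fewer than the columns in rows up
  to \<open>s\<close> as soon as row \<open>s\<close> holds more than \<open>s\<close>
  points.\<close>

lemma corr_eq_0:
  assumes A: "finite A" and rows: "\<rho> ` A \<subseteq> {1..n}" and s: "s \<le> n" "s < card {j\<in>A. \<rho> j = s}"
  shows "corr A \<rho> x = 0"
proof -
  let ?X = "A <+> {..<n}"
  define L where "L i k = (case k of Inl j \<Rightarrow> - of_bool (i = j) | Inr l \<Rightarrow> H (\<rho> i) l (x i))" for i and k :: "'a + nat"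
  define R where "R k j = (case k of Inl i \<Rightarrow> (if \<rho> i < \<rho> j then ppow (\<rho> j - \<rho> i - 1) (x j - x i) else 0)
      | Inr l \<Rightarrow> ediff (n - \<rho> j) l (x j))" for j and k :: "'a + nat"
  have "corr A \<rho> x = gdet A (\<lambda>i j. \<Sum>k\<in>?X. L i k * R k j)"
    unfolding corr_def
  proof (rule gdet_cong)
    fix i j assume i: "i \<in> A"
    have "(\<Sum>k\<in>A. - of_bool (i = k) * (if \<rho> k < \<rho> j then ppow (\<rho> j - \<rho> k - 1) (x j - x k) else 0)) =
        (\<Sum>k\<in>A. if k = i then - (if \<rho> i < \<rho> j then ppow (\<rho> j - \<rho> i - 1) (x j - x i) else 0) else 0)"
      by (intro sum.cong) auto
    then show "Kf (\<rho> i) (x i) (\<rho> j) (x j) = (\<Sum>k\<in>?X. L i k * R k j)"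
      using A i by (simp add: sum.Plus L_def R_def Kf_def)
  qed
  also have "\<dots> = 0"
  proof (rule gdet_rank_zero)
    let ?Y = "{k\<in>A. \<rho> k < s} <+> {n - s..<n}"
    let ?C = "{j\<in>A. \<rho> j \<le> s}"
    have "card ?C = card ({k\<in>A. \<rho> k < s} \<union> {j\<in>A. \<rho> j = s})" by (rule arg_cong[of _ _ card]) auto
    also have "\<dots> = card {k\<in>A. \<rho> k < s} + card {j\<in>A. \<rho> j = s}" using A by (intro card_Un_disjoint) auto
    finally show "card ?Y < card ?C" using A s by (simp add: card_Plus)
    show "R k j = 0" if "k \<in> ?X - ?Y" "j \<in> ?C" for k j
      using that by (cases k) (auto simp: R_def ediff_def)
  qed (use A in auto)
  finally show ?thesis .
qed

text \<open>Together with \<open>Rmat\<close> this factors the kernel: an index \<open>k\<close>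
  with \<open>snd k < fst k\<close> stands for the particle \<open>(fst k - 1, snd k)\<close> and
  yields the truncated power, and \<open>(j, j)\<close>, a virtual particle, yields the summand
  \<open>l = n - j\<close>.\<close>

definition Lmat :: "(nat \<times> nat \<Rightarrow> real) \<Rightarrow> nat \<times> nat \<Rightarrow> nat \<times> nat \<Rightarrow> real" where
  "Lmat x p q = (if snd q < fst q then - of_bool (p = (fst q - 1, snd q)) else H (fst p) (n - fst q) (x p))"

text \<open>After \<open>row_shift\<close> the columns of the particles below row \<open>n\<close>
  are minus unit vectors, which leaves the block of row \<open>n\<close>, where \<open>H\<close> is
  \<open>\<psi>\<close>.\<close>

lemma gdet_Lmat:
  "gdet (particle_index n) (Lmat x) = top_sign n * gdet {1..n} (\<lambda>i j. \<psi> (n - j) (x (n, i)))"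
proof -
  let ?I = "particle_index n" and ?T = "Pair n ` {1..n}"
  let ?M = "\<lambda>p q. Lmat x p (row_shift n q)"
  have I: "?I = (?I - ?T) \<union> ?T" by (auto simp: particle_index_def)
  have low: "?M p q = - of_bool (p = q)" if "q \<in> ?I - ?T" for p q
    using that by (auto simp: Lmat_def row_shift_def particle_index_def image_iff)
  have top: "?M p (n, j) = H (fst p) (n - j) (x p)" if "j \<in> {1..n}" for p j
    using that by (auto simp: Lmat_def row_shift_def particle_index_def)
  have "gdet ?I ?M = gdet (?I - ?T) ?M * gdet ?T ?M"
    by (subst I, rule gdet_block) (auto simp: low)
  also have "gdet (?I - ?T) ?M = gdet (?I - ?T) (\<lambda>p q. (-1) * of_bool (p = q))"
    by (rule gdet_cong) (simp add: low)
  also have "\<dots> = (-1) ^ card (?I - ?T)"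
    by (subst gdet_scale_rows) (simp add: gdet_id)
  also have "gdet ?T ?M = gdet {1..n} (\<lambda>i j. ?M (n, i) (n, j))"
    by (rule gdet_reindex) (auto simp: bij_betw_def inj_on_def)
  also have "\<dots> = gdet {1..n} (\<lambda>i j. \<psi> (n - j) (x (n, i)))"
    by (rule gdet_cong) (simp add: top H_def)
  finally have 1: "gdet ?I ?M = (-1) ^ card (?I - ?T) * gdet {1..n} (\<lambda>i j. \<psi> (n - j) (x (n, i)))" .
  have 2: "gdet ?I ?M = of_int (sign (row_shift n)) * gdet ?I (Lmat x)"
    by (rule gdet_permute_cols[OF finite_particle_index row_shift_permutes])
  have "of_int (sign (row_shift n)) * of_int (sign (row_shift n)) = (1::real)"
    by (metis of_int_1 of_int_mult sign_idempotent)
  then have "gdet ?I (Lmat x) = of_int (sign (row_shift n)) * gdet ?I ?M"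
    unfolding 2 by (simp only: mult.assoc[symmetric] mult_1_left)
  then show ?thesis by (simp only: 1 top_sign_def mult.assoc)
qed

lemma corr_particle_index:
  "corr (particle_index n) fst x =
    top_sign n * gdet {1..n} (\<lambda>i j. \<psi> (n - j) (x (n, i))) * gdet (particle_index n) (Rmat n x)"
proof -
  let ?I = "particle_index n"
  have "corr ?I fst x = gdet ?I (\<lambda>p q. \<Sum>k\<in>?I. Lmat x p k * Rmat n x k q)"
    unfolding corr_def
  proof (rule gdet_cong)
    fix p q assume p: "p \<in> ?I" and q: "q \<in> ?I"
    let ?d = "{k\<in>?I. snd k < fst k}"
    have "(\<Sum>k\<in>?I. Lmat x p k * Rmat n x k q) =
        (\<Sum>k\<in>?d. Lmat x p k * Rmat n x k q) + (\<Sum>k\<in>?I - ?d. Lmat x p k * Rmat n x k q)"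
      by (subst sum.subset_diff[of ?d ?I]) auto
    also have "(\<Sum>k\<in>?I - ?d. Lmat x p k * Rmat n x k q) = (\<Sum>l<n. H (fst p) l (x p) * ediff (n - fst q) l (x q))"
      by (rule sum.reindex_bij_witness[of _ "\<lambda>l. (n - l, n - l)" "\<lambda>k. n - fst k"])
         (auto simp: particle_index_def Lmat_def Rmat_def)
    also have "(\<Sum>k\<in>?d. Lmat x p k * Rmat n x k q) =
        (\<Sum>k\<in>?d. if k = (fst p + 1, snd p) then - (if fst p < fst q then ppow (fst q - fst p - 1) (x q - x p) else 0) else 0)"
      by (intro sum.cong refl) (auto simp: Lmat_def Rmat_def particle_index_def)
    also have "\<dots> = - (if fst p < fst q then ppow (fst q - fst p - 1) (x q - x p) else 0)"
      by (subst sum.delta) (simp_all, use p q in \<open>auto simp: particle_index_def\<close>)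
    finally show "Kf (fst p) (x p) (fst q) (x q) = (\<Sum>k\<in>?I. Lmat x p k * Rmat n x k q)"
      by (simp add: Kf_def)
  qed
  also have "\<dots> = gdet ?I (Lmat x) * gdet ?I (Rmat n x)"
    by (rule gdet_mult) simp
  finally show ?thesis by (simp add: gdet_Lmat)
qed

end

section \<open>Labelled configurations\<close>

interpretation lborel_prod: product_sigma_finite "\<lambda>_. lborel :: real measure"
  by (simp add: product_sigma_finite_def lborel.sigma_finite_measure_axioms)

lemma sigma_finite_lebesgue_vec: "sigma_finite_measure (lebesgue_vec r)"
  unfolding lebesgue_vec_def by (rule lborel_prod.sigma_finite) simp

interpretation lebesgue_rows: product_sigma_finite lebesgue_vec
  by (simp add: product_sigma_finite_def sigma_finite_lebesgue_vec)

lemma measurable_lebesgue_vec_component: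
  assumes "i \<in> {1..r}"
  shows "(\<lambda>y. y i) \<in> borel_measurable (lebesgue_vec r)"
  using measurable_component_singleton[OF assms, of "\<lambda>_. lborel"] by (simp add: lebesgue_vec_def)

lemma measurable_lebesgue_pattern_component:
  assumes "(r, i) \<in> particle_index n"
  shows "(\<lambda>y. y r i) \<in> borel_measurable (lebesgue_pattern n)"
proof -
  have "r \<in> {1..n}" "i \<in> {1..r}" using assms by (auto simp: particle_index_def)
  then show ?thesis
    using measurable_compose[OF measurable_component_singleton[of r "{1..n}" lebesgue_vec] measurable_lebesgue_vec_component[of i r]]
    by (simp add: lebesgue_pattern_def)
qed

text \<open>Each hyperplane \<open>x a = x b\<close> is null: for fixed other coordinates it allows
  a single value of \<open>x a\<close>.\<close>

lemma AE_inj_on_PiM_lborel: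
  assumes A: "finite A"
  shows "AE x in PiM A (\<lambda>_. lborel :: real measure). inj_on x A"
proof -
  have "AE x in PiM A (\<lambda>_. lborel :: real measure). a \<noteq> b \<longrightarrow> x a \<noteq> x b" if ab: "a \<in> A" "b \<in> A" for a b
  proof (cases "a = b")
    case False
    let ?N = "{x \<in> space (PiM A (\<lambda>_. lborel :: real measure)). x a = x b}"
    have A': "A = insert a (A - {a})" using ab by auto
    have N: "?N \<in> sets (PiM A (\<lambda>_. lborel))" using ab by measurable
    have "emeasure (PiM A (\<lambda>_. lborel)) ?N = (\<integral>\<^sup>+x. indicator ?N x \<partial>PiM A (\<lambda>_. lborel))"
      using N by simp
    also have "\<dots> = (\<integral>\<^sup>+x. (\<integral>\<^sup>+w. indicator ?N (x(a := w)) \<partial>lborel) \<partial>PiM (A - {a}) (\<lambda>_. lborel :: real measure))"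
      using N A A' lborel_prod.product_nn_integral_insert[of "A - {a}" a "indicator ?N"] by simp
    also have "\<dots> \<le> (\<integral>\<^sup>+x. (\<integral>\<^sup>+w. (indicator {x b} w :: ennreal) \<partial>lborel) \<partial>PiM (A - {a}) (\<lambda>_. lborel :: real measure))"
      by (intro nn_integral_mono) (use False in \<open>auto simp: indicator_def\<close>)
    also have "\<dots> = 0" by simp
    finally have "emeasure (PiM A (\<lambda>_. lborel)) ?N = 0" by simp
    then have "?N \<in> null_sets (PiM A (\<lambda>_. lborel))" using N by auto
    then show ?thesis by (rule AE_I'[of ?N]) auto
  qed simp
  then have "AE x in PiM A (\<lambda>_. lborel :: real measure). \<forall>a\<in>A. \<forall>b\<in>A. a \<noteq> b \<longrightarrow> x a \<noteq> x b"
    using A by (intro AE_finite_allI) auto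
  then show ?thesis by eventually_elim (auto simp: inj_on_def)
qed

lemma distr_PiM_lborel_reindex:
  assumes \<sigma>: "bij_betw \<sigma> A B" and A: "finite A"
  shows "distr (PiM B (\<lambda>_. lborel)) (PiM A (\<lambda>_. lborel)) (\<lambda>x. \<lambda>a\<in>A. x (\<sigma> a)) = PiM A (\<lambda>_. lborel :: real measure)"
proof (rule lborel_prod.PiM_eqI[OF A])
  have B: "finite B" using \<sigma> A bij_betw_finite by blast
  have m: "(\<lambda>x. \<lambda>a\<in>A. x (\<sigma> a)) \<in> measurable (PiM B (\<lambda>_. lborel)) (PiM A (\<lambda>_. lborel :: real measure))"
    by (intro measurable_restrict measurable_component_singleton) (use \<sigma> in \<open>auto simp: bij_betw_def\<close>)
  fix E :: "'a \<Rightarrow> real set" assume E: "\<And>a. a \<in> A \<Longrightarrow> E a \<in> sets lborel"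
  have inv: "inv_into A \<sigma> b \<in> A" "\<sigma> (inv_into A \<sigma> b) = b" if "b \<in> B" for b
    using that \<sigma> by (auto simp: bij_betw_def inv_into_into f_inv_into_f)
  have pre: "(\<lambda>x. \<lambda>a\<in>A. x (\<sigma> a)) -` PiE A E \<inter> space (PiM B (\<lambda>_. lborel)) = PiE B (\<lambda>b. E (inv_into A \<sigma> b))"
  proof -
    have "(\<forall>a\<in>A. x (\<sigma> a) \<in> E a) \<longleftrightarrow> (\<forall>b\<in>B. x b \<in> E (inv_into A \<sigma> b))" for x
      using \<sigma> inv by (auto simp: bij_betw_def)
    then show ?thesis by (auto simp: space_PiM PiE_iff)
  qed
  have "emeasure (distr (PiM B (\<lambda>_. lborel)) (PiM A (\<lambda>_. lborel)) (\<lambda>x. \<lambda>a\<in>A. x (\<sigma> a))) (PiE A E)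
      = emeasure (PiM B (\<lambda>_. lborel)) (PiE B (\<lambda>b. E (inv_into A \<sigma> b)))"
    by (subst emeasure_distr[OF m]) (use A E in \<open>auto simp: pre intro!: sets_PiM_I_finite\<close>)
  also have "\<dots> = (\<Prod>b\<in>B. emeasure lborel (E (inv_into A \<sigma> b)))"
    by (rule lborel_prod.emeasure_PiM) (use B E inv in auto)
  also have "\<dots> = (\<Prod>a\<in>A. emeasure lborel (E (inv_into A \<sigma> (\<sigma> a))))"
    by (rule prod.reindex_bij_betw[OF \<sigma>, symmetric])
  also have "\<dots> = (\<Prod>a\<in>A. emeasure lborel (E a))"
    by (intro prod.cong refl) (use \<sigma> in \<open>auto simp: bij_betw_def\<close>)
  finally show "emeasure (distr (PiM B (\<lambda>_. lborel)) (PiM A (\<lambda>_. lborel)) (\<lambda>x. \<lambda>a\<in>A. x (\<sigma> a))) (PiE A E) = \<dots>" .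
qed simp

definition sample :: "('a \<Rightarrow> nat \<times> nat) \<Rightarrow> 'a set \<Rightarrow> (nat \<Rightarrow> nat \<Rightarrow> real) \<Rightarrow> 'a \<Rightarrow> real" where
  "sample \<tau> A y = (\<lambda>a\<in>A. y (fst (\<tau> a)) (snd (\<tau> a)))"

text \<open>For a labelling \<open>\<tau>\<close> of all particles this inverts
  \<open>sample\<close>, so that the nested product of rows becomes one flat product over
  labels.\<close>

definition unsample :: "nat \<Rightarrow> ('a \<Rightarrow> nat \<times> nat) \<Rightarrow> 'a set \<Rightarrow> ('a \<Rightarrow> real) \<Rightarrow> nat \<Rightarrow> nat \<Rightarrow> real" where
  "unsample n \<tau> A x = (\<lambda>r\<in>{1..n}. \<lambda>i\<in>{1..r}. x (inv_into A \<tau> (r, i)))"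

lemma measurable_sample:
  assumes "\<tau> ` A \<subseteq> particle_index n"
  shows "sample \<tau> A \<in> measurable (lebesgue_pattern n) (PiM A (\<lambda>_. lborel))"
  unfolding sample_def
  by (intro measurable_restrict) (use assms in \<open>auto intro!: measurable_lebesgue_pattern_component\<close>)

lemma measurable_unsample:
  assumes "bij_betw \<tau> A (particle_index n)"
  shows "unsample n \<tau> A \<in> measurable (PiM A (\<lambda>_. lborel)) (lebesgue_pattern n)"
  unfolding unsample_def lebesgue_pattern_def lebesgue_vec_def
  by (intro measurable_restrict measurable_component_singleton)
     (use assms in \<open>auto simp: bij_betw_def particle_index_def intro!: inv_into_into\<close>)

lemma unsample_sample:
  assumes \<tau>: "bij_betw \<tau> A (particle_index n)" and y: "y \<in> space (lebesgue_pattern n)"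
  shows "unsample n \<tau> A (sample \<tau> A y) = y"
proof -
  have y: "y \<in> (\<Pi>\<^sub>E r\<in>{1..n}. {1..r} \<rightarrow>\<^sub>E UNIV)"
    using y by (simp add: lebesgue_pattern_def lebesgue_vec_def space_PiM)
  have inv: "inv_into A \<tau> p \<in> A" "\<tau> (inv_into A \<tau> p) = p" if "p \<in> particle_index n" for p
    using that \<tau> by (auto simp: bij_betw_def inv_into_into f_inv_into_f)
  show ?thesis
  proof (rule PiE_ext[OF _ y])
    show "unsample n \<tau> A (sample \<tau> A y) \<in> (\<Pi>\<^sub>E r\<in>{1..n}. {1..r} \<rightarrow>\<^sub>E UNIV)"
      by (auto simp: unsample_def)
    fix r assume r: "r \<in> {1..n}"
    have yr: "y r \<in> {1..r} \<rightarrow>\<^sub>E UNIV" using y r by (rule PiE_mem)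
    show "unsample n \<tau> A (sample \<tau> A y) r = y r"
    proof (rule PiE_ext[OF _ yr])
      show "unsample n \<tau> A (sample \<tau> A y) r \<in> {1..r} \<rightarrow>\<^sub>E UNIV"
        using r by (auto simp: unsample_def)
      fix i assume "i \<in> {1..r}"
      then show "unsample n \<tau> A (sample \<tau> A y) r i = y r i"
        using r inv[of "(r, i)"] by (auto simp: unsample_def sample_def particle_index_def)
    qed
  qed
qed

text \<open>Both measures give a box the product of the lengths of its sides, nested by rows on one
  side and flat on the other.\<close>

lemma distr_sample:
  assumes \<tau>: "bij_betw \<tau> A (particle_index n)" and A: "finite A"
  shows "distr (lebesgue_pattern n) (PiM A (\<lambda>_. lborel)) (sample \<tau> A) = PiM A (\<lambda>_. lborel)"
proof (rule lborel_prod.PiM_eqI[OF A])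
  fix E :: "'a \<Rightarrow> real set" assume E: "\<And>a. a \<in> A \<Longrightarrow> E a \<in> sets lborel"
  have I: "particle_index n = Sigma {1..n} (\<lambda>r. {1..r})" by (auto simp: particle_index_def)
  have inv: "inv_into A \<tau> p \<in> A" "\<tau> (inv_into A \<tau> p) = p" if "p \<in> particle_index n" for p
    using that \<tau> by (auto simp: bij_betw_def inv_into_into f_inv_into_f)
  let ?E = "\<lambda>r. PiE {1..r} (\<lambda>i. E (inv_into A \<tau> (r, i)))"
  have sE: "E (inv_into A \<tau> (r, i)) \<in> sets lborel" if "r \<in> {1..n}" "i \<in> {1..r}" for r i
    using that inv[of "(r, i)"] by (intro E) (auto simp: particle_index_def)
  have pre: "sample \<tau> A -` PiE A E \<inter> space (lebesgue_pattern n) = PiE {1..n} ?E"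
  proof -
    have "(\<forall>a\<in>A. y (fst (\<tau> a)) (snd (\<tau> a)) \<in> E a) \<longleftrightarrow> (\<forall>r\<in>{1..n}. \<forall>i\<in>{1..r}. y r i \<in> E (inv_into A \<tau> (r, i)))" for y
    proof -
      have "(\<forall>a\<in>A. y (fst (\<tau> a)) (snd (\<tau> a)) \<in> E a) \<longleftrightarrow> (\<forall>p\<in>particle_index n. y (fst p) (snd p) \<in> E (inv_into A \<tau> p))"
        (is "?L \<longleftrightarrow> ?R")
      proof
        assume ?L
        then show ?R using inv by metis
      next
        assume R: ?R
        have "inv_into A \<tau> (\<tau> a) = a \<and> \<tau> a \<in> particle_index n" if "a \<in> A" for a
          using that \<tau> by (auto simp: bij_betw_def)
        with R show ?L by metis
      qed
      then show ?thesis by (auto simp: I)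
    qed
    then show ?thesis
      by (auto simp: space_PiM lebesgue_pattern_def lebesgue_vec_def PiE_iff sample_def)
  qed
  have "emeasure (distr (lebesgue_pattern n) (PiM A (\<lambda>_. lborel)) (sample \<tau> A)) (PiE A E)
      = emeasure (lebesgue_pattern n) (PiE {1..n} ?E)"
    by (subst emeasure_distr[OF measurable_sample])
       (use A E \<tau> in \<open>auto simp: pre bij_betw_def intro!: sets_PiM_I_finite\<close>)
  also have "\<dots> = (\<Prod>r\<in>{1..n}. emeasure (lebesgue_vec r) (?E r))"
    unfolding lebesgue_pattern_def
    by (rule lebesgue_rows.emeasure_PiM) (auto simp: lebesgue_vec_def intro!: sets_PiM_I_finite sE)
  also have "\<dots> = (\<Prod>r\<in>{1..n}. \<Prod>i\<in>{1..r}. emeasure lborel (E (inv_into A \<tau> (r, i))))"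
    unfolding lebesgue_vec_def by (intro prod.cong refl lborel_prod.emeasure_PiM sE) auto
  also have "\<dots> = (\<Prod>p\<in>particle_index n. emeasure lborel (E (inv_into A \<tau> p)))"
    unfolding I by (subst prod.Sigma) (auto simp: case_prod_beta)
  also have "\<dots> = (\<Prod>a\<in>A. emeasure lborel (E (inv_into A \<tau> (\<tau> a))))"
    by (rule prod.reindex_bij_betw[OF \<tau>, symmetric])
  also have "\<dots> = (\<Prod>a\<in>A. emeasure lborel (E a))"
    by (intro prod.cong refl) (use \<tau> in \<open>auto simp: bij_betw_def\<close>)
  finally show "emeasure (distr (lebesgue_pattern n) (PiM A (\<lambda>_. lborel)) (sample \<tau> A)) (PiE A E) = \<dots>" .
qed simp

lemma nn_integral_sample:
  assumes \<tau>: "bij_betw \<tau> A (particle_index n)" and A: "finite A"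
    and h: "h \<in> borel_measurable (PiM A (\<lambda>_. lborel))" and F: "F \<in> borel_measurable (lebesgue_pattern n)"
  shows "(\<integral>\<^sup>+y. h (sample \<tau> A y) * F y \<partial>lebesgue_pattern n) =
    (\<integral>\<^sup>+x. h x * F (unsample n \<tau> A x) \<partial>PiM A (\<lambda>_. lborel))"
proof -
  have s: "sample \<tau> A \<in> measurable (lebesgue_pattern n) (PiM A (\<lambda>_. lborel))"
    by (rule measurable_sample) (use \<tau> in \<open>auto simp: bij_betw_def\<close>)
  have "(\<integral>\<^sup>+x. h x * F (unsample n \<tau> A x) \<partial>PiM A (\<lambda>_. lborel)) =
      (\<integral>\<^sup>+x. h x * F (unsample n \<tau> A x) \<partial>distr (lebesgue_pattern n) (PiM A (\<lambda>_. lborel)) (sample \<tau> A))"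
    by (simp add: distr_sample[OF \<tau> A])
  also have "\<dots> = (\<integral>\<^sup>+y. h (sample \<tau> A y) * F (unsample n \<tau> A (sample \<tau> A y)) \<partial>lebesgue_pattern n)"
    by (rule nn_integral_distr[OF s], simp only: measurable_distr_eq1)
       (intro borel_measurable_times_ennreal h measurable_compose[OF measurable_unsample[OF \<tau>] F])
  also have "\<dots> = (\<integral>\<^sup>+y. h (sample \<tau> A y) * F y \<partial>lebesgue_pattern n)"
    by (rule nn_integral_cong) (simp add: unsample_sample[OF \<tau>])
  finally show ?thesis by simp
qed

lemma AE_unsample:
  assumes \<tau>: "bij_betw \<tau> A (particle_index n)" and A: "finite A"
    and P: "{y \<in> space (lebesgue_pattern n). P y} \<in> sets (lebesgue_pattern n)"
    and AE: "AE y in lebesgue_pattern n. P y"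
  shows "AE x in PiM A (\<lambda>_. lborel). P (unsample n \<tau> A x)"
proof -
  have s: "sample \<tau> A \<in> measurable (lebesgue_pattern n) (PiM A (\<lambda>_. lborel))"
    by (rule measurable_sample) (use \<tau> in \<open>auto simp: bij_betw_def\<close>)
  have "{x \<in> space (PiM A (\<lambda>_. lborel)). P (unsample n \<tau> A x)} =
      unsample n \<tau> A -` {y \<in> space (lebesgue_pattern n). P y} \<inter> space (PiM A (\<lambda>_. lborel))"
    using measurable_space[OF measurable_unsample[OF \<tau>]] by auto
  also have "\<dots> \<in> sets (PiM A (\<lambda>_. lborel))"
    by (rule measurable_sets[OF measurable_unsample[OF \<tau>] P])
  finally have m: "{x \<in> space (PiM A (\<lambda>_. lborel)). P (unsample n \<tau> A x)} \<in> sets (PiM A (\<lambda>_. lborel))" .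
  have "AE y in lebesgue_pattern n. P (unsample n \<tau> A (sample \<tau> A y))"
    using AE AE_space by eventually_elim (simp add: unsample_sample[OF \<tau>])
  then show ?thesis
    by (subst distr_sample[OF \<tau> A, symmetric], subst AE_distr_iff[OF s m])
qed

text \<open>Ranks count from the largest value, in agreement with the decreasing order of the rows
  of a pattern.\<close>

lemma rank_bij:
  fixes x :: "'a \<Rightarrow> real"
  assumes A: "finite A" and inj: "inj_on x A"
  defines "rk \<equiv> \<lambda>a. Suc (card {b\<in>A. x a < x b})"
  shows "bij_betw rk A {1..card A}" and "\<And>a b. a \<in> A \<Longrightarrow> b \<in> A \<Longrightarrow> rk a < rk b \<longleftrightarrow> x b < x a"
proof -
  have less: "rk a < rk b" if "a \<in> A" "b \<in> A" "x b < x a" for a b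
  proof -
    have "{c\<in>A. x a < x c} \<subset> {c\<in>A. x b < x c}" using that by auto
    then show ?thesis using A by (simp add: rk_def psubset_card_mono)
  qed
  show iff: "rk a < rk b \<longleftrightarrow> x b < x a" if ab: "a \<in> A" "b \<in> A" for a b
  proof
    assume *: "rk a < rk b"
    show "x b < x a"
    proof (rule ccontr)
      assume "\<not> x b < x a"
      then have "x a < x b \<or> a = b"
        using inj_onD[OF inj _ ab] by (cases "x a" "x b" rule: linorder_cases) auto
      then show False using less[of b a] ab * by auto
    qed
  qed (use less ab in auto)
  have "inj_on rk A"
  proof (rule inj_onI, rule ccontr)
    fix a b assume ab: "a \<in> A" "b \<in> A" "rk a = rk b" "a \<noteq> b"
    then have "x a \<noteq> x b" using inj by (auto simp: inj_on_def)
    then show False using iff[of a b] iff[of b a] ab by auto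
  qed
  moreover have "rk ` A \<subseteq> {1..card A}"
  proof
    fix k assume "k \<in> rk ` A"
    then obtain a where a: "a \<in> A" "k = rk a" by auto
    have "{b\<in>A. x a < x b} \<subset> A" using a by auto
    then have "card {b\<in>A. x a < x b} < card A" using A by (rule psubset_card_mono[rotated])
    then show "k \<in> {1..card A}" using a by (simp add: rk_def)
  qed
  ultimately have "rk ` A = {1..card A}"
    by (intro card_subset_eq) (auto simp: card_image)
  with \<open>inj_on rk A\<close> show "bij_betw rk A {1..card A}" by (simp add: bij_betw_def)
qed

text \<open>Almost every slice of a null set is null. This passes almost sure non-negativity to the
  slices that are integrated.\<close>

lemma AE_PiM_insert_lborel:
  assumes A: "finite A" "a \<notin> A"
    and P: "{x \<in> space (PiM (insert a A) (\<lambda>_. lborel :: real measure)). P x} \<in> sets (PiM (insert a A) (\<lambda>_. lborel))"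
    and AE: "AE x in PiM (insert a A) (\<lambda>_. lborel :: real measure). P x"
  shows "AE x in PiM A (\<lambda>_. lborel :: real measure). AE w in lborel. P (x(a := w))"
proof -
  let ?S = "space (PiM (insert a A) (\<lambda>_. lborel :: real measure))"
  define g where "g = (indicator {x \<in> ?S. \<not> P x} :: _ \<Rightarrow> ennreal)"
  have m: "{x \<in> ?S. \<not> P x} \<in> sets (PiM (insert a A) (\<lambda>_. lborel))"
    using P by (rule sets.sets_Collect_neg)
  have g[measurable]: "g \<in> borel_measurable (PiM (insert a A) (\<lambda>_. lborel))"
    unfolding g_def using m by simp
  have "(\<integral>\<^sup>+x. g x \<partial>PiM (insert a A) (\<lambda>_. lborel)) = 0"
    using AE by (subst nn_integral_0_iff_AE[OF g]) (auto simp: g_def elim!: eventually_mono)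
  then have "(\<integral>\<^sup>+x. (\<integral>\<^sup>+w. g (x(a := w)) \<partial>lborel) \<partial>PiM A (\<lambda>_. lborel)) = 0"
    using lborel_prod.product_nn_integral_insert[OF A g] by simp
  then have "AE x in PiM A (\<lambda>_. lborel). (\<integral>\<^sup>+w. g (x(a := w)) \<partial>lborel) = 0"
    by (subst (asm) nn_integral_0_iff_AE) measurable
  with AE_space show ?thesis
  proof eventually_elim
    fix x assume x: "x \<in> space (PiM A (\<lambda>_. lborel :: real measure))" and 0: "(\<integral>\<^sup>+w. g (x(a := w)) \<partial>lborel) = 0"
    have [measurable]: "(\<lambda>w. x(a := w)) \<in> measurable lborel (PiM (insert a A) (\<lambda>_. lborel))"
      using x by (intro measurable_fun_upd[where J = A]) auto
    have "AE w in lborel. g (x(a := w)) = 0"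
      using 0 by (subst (asm) nn_integral_0_iff_AE) measurable
    then show "AE w in lborel. P (x(a := w))"
    proof eventually_elim
      fix w assume "g (x(a := w)) = 0"
      moreover have "x(a := w) \<in> ?S" using x by (auto simp: space_PiM PiE_iff extensional_def)
      ultimately show "P (x(a := w))" by (auto simp: g_def indicator_def split: if_splits)
    qed
  qed
qed

section \<open>Labellings of points by particles in prescribed rows\<close>

definition labellings :: "nat \<Rightarrow> nat \<Rightarrow> (nat \<Rightarrow> nat) \<Rightarrow> (nat \<Rightarrow> nat \<times> nat) set" where
  "labellings n m \<rho> = {\<tau> \<in> {..<m} \<rightarrow>\<^sub>E particle_index n. inj_on \<tau> {..<m} \<and> (\<forall>a<m. fst (\<tau> a) = \<rho> a)}"

lemma finite_labellings [simp]: "finite (labellings n m \<rho>)"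
  by (rule finite_subset[of _ "{..<m} \<rightarrow>\<^sub>E particle_index n"]) (auto simp: labellings_def intro: finite_PiE)

lemma card_particle_index: "card (particle_index n) = (\<Sum>s\<in>{1..n}. s)"
proof -
  have "particle_index n = Sigma {1..n} (\<lambda>r. {1..r})" by (auto simp: particle_index_def)
  then show ?thesis by simp
qed

lemma sum_row_counts:
  fixes \<rho> :: "nat \<Rightarrow> nat"
  assumes "\<rho> ` {..<m} \<subseteq> {1..n}"
  shows "(\<Sum>s\<in>{1..n}. card {a\<in>{..<m}. \<rho> a = s}) = m"
  using sum_card_image[of "{1..n}"] sum.group[of "{..<m}" "{1..n}" \<rho> "\<lambda>_. 1::nat"] assms by auto

lemma bij_betw_particle_index:
  assumes "\<tau> \<in> {..<card (particle_index n)} \<rightarrow>\<^sub>E particle_index n" "inj_on \<tau> {..<card (particle_index n)}"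
  shows "bij_betw \<tau> {..<card (particle_index n)} (particle_index n)"
proof -
  have "\<tau> ` {..<card (particle_index n)} \<subseteq> particle_index n" using assms(1) by (auto simp: PiE_iff)
  moreover have "card (\<tau> ` {..<card (particle_index n)}) = card (particle_index n)"
    using assms(2) by (simp add: card_image)
  ultimately have "\<tau> ` {..<card (particle_index n)} = particle_index n"
    by (intro card_subset_eq) simp_all
  then show ?thesis using assms(2) by (simp add: bij_betw_def)
qed

lemma labellings_empty:
  assumes s: "s < card {a\<in>{..<m}. \<rho> a = s}"
  shows "labellings n m \<rho> = {}"
proof (rule ccontr)
  assume "labellings n m \<rho> \<noteq> {}"
  then obtain \<tau> where \<tau>: "\<tau> \<in> {..<m} \<rightarrow>\<^sub>E particle_index n" "inj_on \<tau> {..<m}" "\<forall>a<m. fst (\<tau> a) = \<rho> a"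
    by (auto simp: labellings_def)
  have "\<tau> ` {a\<in>{..<m}. \<rho> a = s} \<subseteq> Pair s ` {1..s}"
  proof
    fix p assume "p \<in> \<tau> ` {a\<in>{..<m}. \<rho> a = s}"
    then obtain a where a: "a < m" "\<rho> a = s" "p = \<tau> a" by auto
    have "p \<in> particle_index n" "fst p = s" using \<tau> a by auto
    then show "p \<in> Pair s ` {1..s}" by (cases p) (auto simp: particle_index_def)
  qed
  moreover have "inj_on \<tau> {a\<in>{..<m}. \<rho> a = s}" using \<tau>(2) by (rule inj_on_subset) auto
  ultimately have "card {a\<in>{..<m}. \<rho> a = s} \<le> card (Pair s ` {1..s})"
    by (intro card_inj_on_le) auto
  also have "\<dots> \<le> s" using card_image_le[of "{1..s}" "Pair s"] by simp
  finally show False using s by simp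
qed

text \<open>A labelling extends to a further point of row \<open>s\<close> by any particle of that
  row not yet in use. The number of choices is the factor that \<open>integrate_out\<close>
  produces, so that the induction step can cancel it.\<close>

lemma sum_labellings_Suc:
  fixes g :: "(nat \<Rightarrow> nat \<times> nat) \<Rightarrow> ennreal"
  assumes s: "s \<in> {1..n}" and le: "card {a\<in>{..<m}. \<rho> a = s} \<le> s"
  shows "(\<Sum>\<tau>\<in>labellings n (Suc m) (\<rho>(m := s)). g (restrict \<tau> {..<m})) =
    of_nat (s - card {a\<in>{..<m}. \<rho> a = s}) * (\<Sum>\<tau>\<in>labellings n m \<rho>. g \<tau>)"
proof -
  let ?F = "\<lambda>\<tau>. Pair s ` {1..s} - \<tau> ` {..<m}"
  have "(\<Sum>\<tau>\<in>labellings n (Suc m) (\<rho>(m := s)). g (restrict \<tau> {..<m})) =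
      (\<Sum>(\<tau>, p)\<in>Sigma (labellings n m \<rho>) ?F. g \<tau>)"
  proof (rule sum.reindex_bij_witness[of _ "\<lambda>(\<tau>, p). \<tau>(m := p)" "\<lambda>\<tau>. (restrict \<tau> {..<m}, \<tau> m)"])
    fix \<tau> assume "\<tau> \<in> labellings n (Suc m) (\<rho>(m := s))"
    then have \<tau>: "\<tau> \<in> {..<Suc m} \<rightarrow>\<^sub>E particle_index n" "inj_on \<tau> {..<Suc m}"
        "\<And>a. a < Suc m \<Longrightarrow> fst (\<tau> a) = (\<rho>(m := s)) a"
      by (auto simp: labellings_def)
    show "(case (restrict \<tau> {..<m}, \<tau> m) of (\<tau>, p) \<Rightarrow> \<tau>(m := p)) = \<tau>"
      using \<tau>(1) by (auto simp: fun_eq_iff PiE_iff extensional_def)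
    have "\<tau> m \<in> particle_index n" "fst (\<tau> m) = s" using \<tau> by auto
    then have "\<tau> m \<in> Pair s ` {1..s}" by (cases "\<tau> m") (auto simp: particle_index_def)
    moreover have "\<tau> m \<notin> \<tau> ` {..<m}" using inj_onD[OF \<tau>(2), of m] by force
    moreover have "restrict \<tau> {..<m} \<in> labellings n m \<rho>"
      unfolding labellings_def
      using \<tau>(1,2) \<tau>(3)[OF less_SucI] by (auto simp: inj_on_def)
    ultimately show "(restrict \<tau> {..<m}, \<tau> m) \<in> Sigma (labellings n m \<rho>) ?F" by auto
  next
    fix tp assume "tp \<in> Sigma (labellings n m \<rho>) ?F"
    then obtain \<tau> p where tp: "tp = (\<tau>, p)" and \<tau>: "\<tau> \<in> {..<m} \<rightarrow>\<^sub>E particle_index n" "inj_on \<tau> {..<m}"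
        "\<And>a. a < m \<Longrightarrow> fst (\<tau> a) = \<rho> a" and p: "p \<in> Pair s ` {1..s}" "p \<notin> \<tau> ` {..<m}"
      by (auto simp: labellings_def)
    show "(restrict (case tp of (\<tau>, p) \<Rightarrow> \<tau>(m := p)) {..<m}, (case tp of (\<tau>, p) \<Rightarrow> \<tau>(m := p)) m) = tp"
      using \<tau>(1) by (auto simp: tp fun_eq_iff PiE_iff extensional_def)
    have "p \<in> particle_index n" using p s by (auto simp: particle_index_def)
    then have "\<tau>(m := p) \<in> {..<Suc m} \<rightarrow>\<^sub>E particle_index n"
      using \<tau>(1) by (auto simp: PiE_iff extensional_def less_Suc_eq)
    moreover have "inj_on (\<tau>(m := p)) {..<Suc m}"
      using \<tau>(2) p(2) by (auto simp: inj_on_def less_Suc_eq)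
    ultimately show "(case tp of (\<tau>, p) \<Rightarrow> \<tau>(m := p)) \<in> labellings n (Suc m) (\<rho>(m := s))"
      using \<tau>(3) p(1) by (auto simp: tp labellings_def less_Suc_eq)
  qed auto
  also have "\<dots> = (\<Sum>\<tau>\<in>labellings n m \<rho>. \<Sum>p\<in>?F \<tau>. g \<tau>)"
    by (rule sum.Sigma[symmetric]) auto
  also have "\<dots> = (\<Sum>\<tau>\<in>labellings n m \<rho>. of_nat (s - card {a\<in>{..<m}. \<rho> a = s}) * g \<tau>)"
  proof (intro sum.cong refl)
    fix \<tau> assume "\<tau> \<in> labellings n m \<rho>"
    then have \<tau>: "\<tau> \<in> {..<m} \<rightarrow>\<^sub>E particle_index n" "inj_on \<tau> {..<m}" "\<And>a. a < m \<Longrightarrow> fst (\<tau> a) = \<rho> a"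
      by (auto simp: labellings_def)
    let ?R = "{a\<in>{..<m}. \<rho> a = s}"
    have sub: "\<tau> ` ?R \<subseteq> Pair s ` {1..s}"
    proof
      fix p assume "p \<in> \<tau> ` ?R"
      then obtain a where a: "a < m" "\<rho> a = s" "p = \<tau> a" by auto
      have "p \<in> particle_index n" "fst p = s" using \<tau> a by auto
      then show "p \<in> Pair s ` {1..s}" by (cases p) (auto simp: particle_index_def)
    qed
    have "\<rho> a = s" if "a < m" "\<tau> a \<in> Pair s ` {1..s}" for a
      using \<tau>(3)[OF that(1)] that(2) by auto
    then have "p \<in> \<tau> ` ?R" if "p \<in> \<tau> ` {..<m}" "p \<in> Pair s ` {1..s}" for p
      using that by blast
    then have "?F \<tau> = Pair s ` {1..s} - \<tau> ` ?R" by blast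
    then have "card (?F \<tau>) = card (Pair s ` {1..s}) - card (\<tau> ` ?R)"
      using sub by (simp add: card_Diff_subset)
    also have "card (Pair s ` {1..s}) = s" by (subst card_image) (auto simp: inj_on_def)
    also have "card (\<tau> ` ?R) = card ?R" by (rule card_image) (rule inj_on_subset[OF \<tau>(2)], auto)
    finally show "(\<Sum>p\<in>?F \<tau>. g \<tau>) = of_nat (s - card ?R) * g \<tau>" by simp
  qed
  finally show ?thesis by (simp add: sum_distrib_left)
qed

context biorthogonal
begin

lemma H_measurable:
  assumes "l < n"
  shows "H r l \<in> borel_measurable borel"
proof -
  note [measurable] = \<psi>_measurable[OF assms] and [measurable_cong] = sets_\<mu>
  show ?thesis unfolding H_def[abs_def] by (cases "r < n") simp_all
qed

lemma Kf_measurable: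
  assumes f: "f \<in> borel_measurable M" and g: "g \<in> borel_measurable M"
  shows "(\<lambda>x. Kf r (f x) s (g x)) \<in> borel_measurable M"
proof -
  note [measurable] = f g
  have [measurable]: "(\<lambda>x. H r l (f x)) \<in> borel_measurable M" if "l \<in> {..<n}" for l
    using measurable_compose[OF f H_measurable[of l r]] that by simp
  show ?thesis unfolding Kf_def by measurable
qed

lemma corr_measurable: "corr A \<rho> \<in> borel_measurable (PiM A (\<lambda>_. lborel))"
  unfolding corr_def[abs_def] gdet_def
proof (intro borel_measurable_sum borel_measurable_times borel_measurable_prod borel_measurable_const)
  fix \<sigma> i assume \<sigma>: "\<sigma> \<in> {\<sigma>. \<sigma> permutes A}" and i: "i \<in> A"
  have "\<sigma> i \<in> A" using \<sigma> i by (simp add: permutes_in_image)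
  then show "(\<lambda>x. Kf (\<rho> i) (x i) (\<rho> (\<sigma> i)) (x (\<sigma> i))) \<in> borel_measurable (PiM A (\<lambda>_. lborel))"
    using i by (intro Kf_measurable) measurable
qed

end

text \<open>Isolates what the integration argument uses of the weights: a density \<open>f\<close>,
  and the full determinant as a fixed multiple of it on sorted configurations without ties. The
  multiple is left open and is found to be 1 in the end.\<close>

locale gt_density = biorthogonal lborel n \<psi> for n \<psi> +
  fixes f :: "(nat \<Rightarrow> nat \<Rightarrow> real) \<Rightarrow> real" and \<kappa> :: real
  assumes f_measurable: "f \<in> borel_measurable (lebesgue_pattern n)"
    and f_nonneg: "AE y in lebesgue_pattern n. 0 \<le> f y"
    and f_prob: "(\<integral>\<^sup>+y. ennreal (f y) \<partial>lebesgue_pattern n) = 1"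
    and f_support: "\<And>y. y \<notin> GT_closed n \<Longrightarrow> f y = 0"
    and \<kappa>_nonzero: "\<kappa> \<noteq> 0"
    and corr_sorted: "\<And>z. inj_on z (particle_index n) \<Longrightarrow>
      (\<And>r i j. 1 \<le> i \<Longrightarrow> i < j \<Longrightarrow> j \<le> r \<Longrightarrow> r \<le> n \<Longrightarrow> z (r, j) < z (r, i)) \<Longrightarrow>
      corr (particle_index n) fst z = \<kappa> * f (\<lambda>r\<in>{1..n}. \<lambda>i\<in>{1..r}. z (r, i))"
begin

lemma row_measure_eq [simp]: "row_measure s = lborel"
  by (simp add: row_measure_def)

text \<open>The determinant does not depend on how the points are named, so they may be named by
  their ranks within the rows (\<open>\<tau>0\<close>). Without ties, any other labelling puts some
  row in the wrong order, where \<open>f\<close> vanishes; hence at most one term of the sum is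
  non-zero.\<close>

lemma corr_eq_sum_labellings:
  fixes \<rho> :: "nat \<Rightarrow> nat" and x :: "nat \<Rightarrow> real"
  defines "N \<equiv> card (particle_index n)"
  assumes \<rho>: "\<rho> ` {..<N} \<subseteq> {1..n}" and count: "\<And>s. s \<in> {1..n} \<Longrightarrow> card {a\<in>{..<N}. \<rho> a = s} = s"
    and x: "inj_on x {..<N}"
  shows "corr {..<N} \<rho> x = \<kappa> * (\<Sum>\<tau>\<in>labellings n N \<rho>. f (unsample n \<tau> {..<N} x))"
proof -
  let ?A = "{..<N}" and ?I = "particle_index n"
  let ?R = "\<lambda>s. {a\<in>?A. \<rho> a = s}"
  define rk where "rk s a = Suc (card {b\<in>?R s. x a < x b})" for s a
  have rk: "bij_betw (rk s) (?R s) {1..card (?R s)}" "\<And>a b. a \<in> ?R s \<Longrightarrow> b \<in> ?R s \<Longrightarrow> rk s a < rk s b \<longleftrightarrow> x b < x a" for s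
  proof -
    have i: "inj_on x (?R s)" by (rule inj_on_subset[OF x]) auto
    show "bij_betw (rk s) (?R s) {1..card (?R s)}"
      unfolding rk_def by (rule rank_bij(1)[OF _ i]) simp
    show "rk s a < rk s b \<longleftrightarrow> x b < x a" if "a \<in> ?R s" "b \<in> ?R s" for a b
      unfolding rk_def by (rule rank_bij(2)[OF _ i that]) simp
  qed
  define \<tau>0 where "\<tau>0 = (\<lambda>a\<in>?A. (\<rho> a, rk (\<rho> a) a))"
  note bijI = bij_betw_particle_index[of _ n, folded N_def]
  have \<rho>n: "\<rho> a \<in> {1..n}" if "a < N" for a using \<rho> that by auto
  have rk1: "rk (\<rho> a) a \<in> {1..\<rho> a}" if "a < N" for a
    using rk(1)[of "\<rho> a"] count[OF \<rho>n[OF that]] that by (auto simp: bij_betw_def)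
  have \<tau>0: "\<tau>0 \<in> labellings n N \<rho>"
    unfolding labellings_def
  proof (intro CollectI conjI)
    have "(\<rho> a, rk (\<rho> a) a) \<in> ?I" if "a < N" for a
      using rk1[OF that] \<rho>n[OF that] by (simp add: particle_index_def)
    then show "\<tau>0 \<in> ?A \<rightarrow>\<^sub>E ?I" by (auto simp: \<tau>0_def)
    show "inj_on \<tau>0 ?A"
    proof (rule inj_onI)
      fix a b assume ab: "a \<in> ?A" "b \<in> ?A" "\<tau>0 a = \<tau>0 b"
      then have e: "\<rho> b = \<rho> a" "rk (\<rho> a) a = rk (\<rho> a) b" by (auto simp: \<tau>0_def)
      have m: "a \<in> ?R (\<rho> a)" "b \<in> ?R (\<rho> a)" using ab(1,2) e(1) by simp_all
      show "a = b" by (rule inj_onD[OF bij_betw_imp_inj_on[OF rk(1)] e(2) m])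
    qed
    show "\<forall>a<N. fst (\<tau>0 a) = \<rho> a" by (simp add: \<tau>0_def)
  qed
  then have b0: "bij_betw \<tau>0 ?A ?I" by (intro bijI) (auto simp: labellings_def)
  define z where "z p = x (inv_into ?A \<tau>0 p)" for p
  have z: "z (\<tau>0 a) = x a" if "a < N" for a
    using b0 that by (simp add: z_def bij_betw_def)
  have "corr ?A \<rho> x = corr ?I fst z"
    unfolding corr_def gdet_reindex[OF b0 finite_lessThan]
    by (rule gdet_cong) (simp add: z, simp add: \<tau>0_def)
  also have "\<dots> = \<kappa> * f (unsample n \<tau>0 ?A x)"
    unfolding unsample_def z_def[symmetric]
  proof (rule corr_sorted)
    have "inj_on (inv_into ?A \<tau>0) ?I" "inv_into ?A \<tau>0 ` ?I = ?A"
      using bij_betw_inv_into[OF b0] by (auto simp: bij_betw_def)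
    then show "inj_on z ?I"
      unfolding z_def[abs_def] using x comp_inj_on[of "inv_into ?A \<tau>0" ?I x] by (simp add: comp_def)
    fix r i j assume ij: "1 \<le> i" "i < j" "j \<le> r" "r \<le> n"
    have "(r, i) \<in> ?I" "(r, j) \<in> ?I" using ij by (auto simp: particle_index_def)
    moreover have "\<tau>0 ` ?A = ?I" using b0 by (simp add: bij_betw_def)
    ultimately obtain a b where ab: "a < N" "b < N" "\<tau>0 a = (r, i)" "\<tau>0 b = (r, j)"
      by (metis imageE lessThan_iff)
    then have "\<rho> a = r" "\<rho> b = r" "rk r a = i" "rk r b = j" by (auto simp: \<tau>0_def)
    then have "x b < x a" using rk(2)[of a r b] ab ij by auto
    then show "z (r, j) < z (r, i)" using z[OF ab(1)] z[OF ab(2)] ab by simp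
  qed
  also have "f (unsample n \<tau>0 ?A x) = (\<Sum>\<tau>\<in>{\<tau>0}. f (unsample n \<tau> ?A x))" by simp
  also have "\<dots> = (\<Sum>\<tau>\<in>labellings n N \<rho>. f (unsample n \<tau> ?A x))"
  proof (rule sum.mono_neutral_left)
    show "\<forall>\<tau>\<in>labellings n N \<rho> - {\<tau>0}. f (unsample n \<tau> ?A x) = 0"
    proof (intro ballI f_support notI)
      fix \<tau> assume \<tau>': "\<tau> \<in> labellings n N \<rho> - {\<tau>0}" and gt: "unsample n \<tau> ?A x \<in> GT_closed n"
      have \<tau>: "\<tau> \<in> ?A \<rightarrow>\<^sub>E ?I" "inj_on \<tau> ?A" "\<And>a. a < N \<Longrightarrow> fst (\<tau> a) = \<rho> a"
        using \<tau>' by (auto simp: labellings_def)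
      have b: "bij_betw \<tau> ?A ?I" using \<tau> by (intro bijI)
      have us: "unsample n \<tau> ?A x (fst (\<tau> a)) (snd (\<tau> a)) = x a" if "a < N" for a
      proof -
        have "\<tau> a \<in> ?I" using \<tau>(1) that by auto
        then show ?thesis
          using \<tau>(2) that by (cases "\<tau> a") (auto simp: unsample_def particle_index_def dest: sym[of "\<tau> a"])
      qed
      have ge: "x b \<le> x a" if "a < N" "b < N" "\<rho> a = \<rho> b" "snd (\<tau> a) < snd (\<tau> b)" for a b
      proof -
        have I: "\<tau> a \<in> ?I" "\<tau> b \<in> ?I" using \<tau>(1) that by auto
        let ?r = "\<rho> a"
        have "?r \<in> {1..n}" using \<rho>n that by auto
        then have "unsample n \<tau> ?A x ?r \<in> weyl_chamber_closure ?r"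
          using gt by (auto simp: GT_closed_def)
        moreover have "1 \<le> snd (\<tau> a)" "snd (\<tau> b) \<le> ?r"
          using I \<tau>(3)[OF that(1)] \<tau>(3)[OF that(2)] that(3) by (auto simp: particle_index_def case_prod_beta)
        ultimately have "unsample n \<tau> ?A x ?r (snd (\<tau> b)) \<le> unsample n \<tau> ?A x ?r (snd (\<tau> a))"
          using that by (auto simp: weyl_chamber_closure_eq)
        then show ?thesis using us[OF that(1)] us[OF that(2)] \<tau>(3)[OF that(1)] \<tau>(3)[OF that(2)] that(3) by simp
      qed
      have iff: "x a < x b \<longleftrightarrow> snd (\<tau> b) < snd (\<tau> a)" if "a < N" "b < N" "\<rho> a = \<rho> b" for a b
      proof (cases "a = b")
        case False
        then have "x a \<noteq> x b" using x that by (auto simp: inj_on_def)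
        moreover have "snd (\<tau> a) \<noteq> snd (\<tau> b)"
          using False \<tau>(2) \<tau>(3)[OF that(1)] \<tau>(3)[OF that(2)] that by (auto simp: inj_on_def prod_eq_iff)
        ultimately show ?thesis using ge[OF that] ge[OF that(2,1) that(3)[symmetric]]
          by (metis less_le not_less_iff_gr_or_eq not_less)
      qed simp
      \<comment> \<open>In a sorted row the label of a point is one more than the number of larger
        points, and that is its rank.\<close>
      have "\<tau> a = \<tau>0 a" if a: "a < N" for a
      proof -
        let ?r = "\<rho> a"
        have I: "\<tau> a \<in> ?I" using \<tau>(1) a by auto
        have "{b\<in>?R ?r. x a < x b} = {b\<in>?R ?r. snd (\<tau> b) < snd (\<tau> a)}"
          using iff[OF a] by auto
        also have "bij_betw (\<lambda>b. snd (\<tau> b)) \<dots> {1..<snd (\<tau> a)}"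
          unfolding bij_betw_def
        proof
          show "inj_on (\<lambda>b. snd (\<tau> b)) {b\<in>?R ?r. snd (\<tau> b) < snd (\<tau> a)}"
            using \<tau>(2,3) by (auto simp: inj_on_def prod_eq_iff)
          show "(\<lambda>b. snd (\<tau> b)) ` {b\<in>?R ?r. snd (\<tau> b) < snd (\<tau> a)} = {1..<snd (\<tau> a)}"
          proof safe
            fix b assume "b < N"
            then have "\<tau> b \<in> ?I" using \<tau>(1) by auto
            moreover assume "snd (\<tau> b) < snd (\<tau> a)"
            ultimately show "snd (\<tau> b) \<in> {1..<snd (\<tau> a)}" by (auto simp: particle_index_def)
          next
            fix i assume i: "i \<in> {1..<snd (\<tau> a)}"
            then have "(?r, i) \<in> ?I" using I \<tau>(3)[OF a] by (auto simp: particle_index_def)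
            moreover have "\<tau> ` ?A = ?I" using b by (simp add: bij_betw_def)
            ultimately obtain b where b': "b < N" "\<tau> b = (?r, i)" by (metis imageE lessThan_iff)
            then have "\<rho> b = ?r" using \<tau>(3)[of b] by simp
            then show "i \<in> (\<lambda>b. snd (\<tau> b)) ` {b\<in>?R ?r. snd (\<tau> b) < snd (\<tau> a)}"
              using b' i by (intro image_eqI[of _ _ b]) auto
          qed
        qed
        then have "card {b\<in>?R ?r. snd (\<tau> b) < snd (\<tau> a)} = snd (\<tau> a) - 1"
          using bij_betw_same_card by fastforce
        finally have "rk ?r a = Suc (snd (\<tau> a) - 1)" by (simp add: rk_def)
        moreover have "1 \<le> snd (\<tau> a)" using I by (auto simp: particle_index_def)
        ultimately show ?thesis using \<tau>(3)[OF a] a by (simp add: \<tau>0_def prod_eq_iff)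
      qed
      then have "\<tau> = \<tau>0"
        using \<tau>(1) \<tau>0 by (intro PiE_ext[of _ ?A "\<lambda>_. ?I"]) (auto simp: labellings_def)
      then show False using \<tau>' by simp
    qed
  qed (use \<tau>0 in auto)
  finally show ?thesis .
qed

text \<open>
  The points are integrated out one at a time, starting from the full configuration. The case \<open>m = 0\<close>
  then determines \<open>\<kappa>\<close>, so that no sign or normalising constant has to be computed.
\<close>

lemma correlation_scaled:
  assumes "m \<le> card (particle_index n)"
  shows "\<forall>\<rho>. \<rho> ` {..<m} \<subseteq> {1..n} \<longrightarrow>
    (AE x in PiM {..<m} (\<lambda>_. lborel). 0 \<le> 1 / \<kappa> * corr {..<m} \<rho> x) \<and>
    (\<forall>h\<in>borel_measurable (PiM {..<m} (\<lambda>_. lborel)).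
      (\<integral>\<^sup>+x. h x * ennreal (1 / \<kappa> * corr {..<m} \<rho> x) \<partial>PiM {..<m} (\<lambda>_. lborel)) =
      (\<Sum>\<tau>\<in>labellings n m \<rho>. \<integral>\<^sup>+y. h (sample \<tau> {..<m} y) * ennreal (f y) \<partial>lebesgue_pattern n))"
  using assms
proof (induction m rule: inc_induct)
  case base
  let ?N = "card (particle_index n)"
  let ?A = "{..<?N}"
  let ?M = "PiM ?A (\<lambda>_. lborel :: real measure)"
  show ?case
  proof (intro allI impI)
    fix \<rho> :: "nat \<Rightarrow> nat" assume \<rho>: "\<rho> ` ?A \<subseteq> {1..n}"
    show "(AE x in ?M. 0 \<le> 1 / \<kappa> * corr ?A \<rho> x) \<and>
      (\<forall>h\<in>borel_measurable ?M. (\<integral>\<^sup>+x. h x * ennreal (1 / \<kappa> * corr ?A \<rho> x) \<partial>?M) =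
      (\<Sum>\<tau>\<in>labellings n ?N \<rho>. \<integral>\<^sup>+y. h (sample \<tau> ?A y) * ennreal (f y) \<partial>lebesgue_pattern n))"
    proof (cases "\<exists>s\<in>{1..n}. s < card {a\<in>?A. \<rho> a = s}")
      case True
      then obtain s where s: "s \<in> {1..n}" "s < card {a\<in>?A. \<rho> a = s}" by auto
      have "corr ?A \<rho> x = 0" for x by (rule corr_eq_0[OF _ \<rho>, of s]) (use s in auto)
      then show ?thesis by (simp add: labellings_empty[OF s(2)])
    next
      case False
      \<comment> \<open>No row is overfull and the counts add up to the number of particles, so
        every row \<open>s\<close> holds exactly \<open>s\<close> points.\<close>
      have count: "card {a\<in>?A. \<rho> a = s} = s" if s: "s \<in> {1..n}" for s
      proof (rule ccontr)
        assume "card {a\<in>?A. \<rho> a = s} \<noteq> s"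
        moreover have "\<not> s < card {a\<in>?A. \<rho> a = s}" using False s by blast
        ultimately have "card {a\<in>?A. \<rho> a = s} < s" by linarith
        then have "(\<Sum>s\<in>{1..n}. card {a\<in>?A. \<rho> a = s}) < (\<Sum>s\<in>{1..n}. s)"
          using s False by (intro sum_strict_mono_ex1) (auto simp: not_less)
        then show False using sum_row_counts[OF \<rho>] by (simp add: card_particle_index)
      qed
      have bij: "bij_betw \<tau> ?A (particle_index n)" if "\<tau> \<in> labellings n ?N \<rho>" for \<tau>
        using that by (intro bij_betw_particle_index) (simp_all add: labellings_def)
      have f0: "{y \<in> space (lebesgue_pattern n). 0 \<le> f y} \<in> sets (lebesgue_pattern n)"
        using f_measurable by measurable
      have pos: "AE x in ?M. \<forall>\<tau>\<in>labellings n ?N \<rho>. 0 \<le> f (unsample n \<tau> ?A x)"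
        by (intro AE_finite_allI AE_unsample bij f0 f_nonneg) auto
      have eq: "AE x in ?M. 1 / \<kappa> * corr ?A \<rho> x = (\<Sum>\<tau>\<in>labellings n ?N \<rho>. f (unsample n \<tau> ?A x))"
        using AE_inj_on_PiM_lborel[OF finite_lessThan]
        by eventually_elim (use corr_eq_sum_labellings[OF \<rho> count] \<kappa>_nonzero in simp)
      show ?thesis
      proof (intro conjI ballI)
        show "AE x in ?M. 0 \<le> 1 / \<kappa> * corr ?A \<rho> x"
          using pos eq by eventually_elim (simp add: sum_nonneg)
        fix h :: "(nat \<Rightarrow> real) \<Rightarrow> ennreal" assume h: "h \<in> borel_measurable ?M"
        have fu: "(\<lambda>x. ennreal (f (unsample n \<tau> ?A x))) \<in> borel_measurable ?M" if "\<tau> \<in> labellings n ?N \<rho>" for \<tau>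
          using measurable_compose[OF measurable_unsample[OF bij[OF that]] f_measurable] by simp
        have "(\<integral>\<^sup>+x. h x * ennreal (1 / \<kappa> * corr ?A \<rho> x) \<partial>?M) =
            (\<integral>\<^sup>+x. (\<Sum>\<tau>\<in>labellings n ?N \<rho>. h x * ennreal (f (unsample n \<tau> ?A x))) \<partial>?M)"
        proof (rule nn_integral_cong_AE)
          show "AE x in ?M. h x * ennreal (1 / \<kappa> * corr ?A \<rho> x) = (\<Sum>\<tau>\<in>labellings n ?N \<rho>. h x * ennreal (f (unsample n \<tau> ?A x)))"
            using pos eq
            by eventually_elim (simp only: sum_distrib_left[symmetric], subst sum_ennreal, auto)
        qed
        also have "\<dots> = (\<Sum>\<tau>\<in>labellings n ?N \<rho>. \<integral>\<^sup>+x. h x * ennreal (f (unsample n \<tau> ?A x)) \<partial>?M)"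
          by (rule nn_integral_sum) (intro borel_measurable_times_ennreal h fu)
        also have "\<dots> = (\<Sum>\<tau>\<in>labellings n ?N \<rho>. \<integral>\<^sup>+y. h (sample \<tau> ?A y) * ennreal (f y) \<partial>lebesgue_pattern n)"
          by (intro sum.cong refl nn_integral_sample[symmetric] bij h) (use f_measurable in auto)
        finally show "(\<integral>\<^sup>+x. h x * ennreal (1 / \<kappa> * corr ?A \<rho> x) \<partial>?M) = \<dots>" .
      qed
    qed
  qed
next
  case (step m)
  let ?A = "{..<m}"
  let ?M = "PiM ?A (\<lambda>_. lborel :: real measure)"
  have ins: "{..<Suc m} = insert m ?A" by (rule lessThan_Suc)
  have mA: "m \<notin> ?A" by simp
  show ?case
  proof (intro allI impI)
    fix \<rho> :: "nat \<Rightarrow> nat" assume \<rho>: "\<rho> ` ?A \<subseteq> {1..n}"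
    show "(AE x in ?M. 0 \<le> 1 / \<kappa> * corr ?A \<rho> x) \<and>
      (\<forall>h\<in>borel_measurable ?M. (\<integral>\<^sup>+x. h x * ennreal (1 / \<kappa> * corr ?A \<rho> x) \<partial>?M) =
      (\<Sum>\<tau>\<in>labellings n m \<rho>. \<integral>\<^sup>+y. h (sample \<tau> ?A y) * ennreal (f y) \<partial>lebesgue_pattern n))"
    proof (cases "\<exists>s\<in>{1..n}. s < card {a\<in>?A. \<rho> a = s}")
      case True
      then obtain s where s: "s \<in> {1..n}" "s < card {a\<in>?A. \<rho> a = s}" by auto
      have "corr ?A \<rho> x = 0" for x by (rule corr_eq_0[OF _ \<rho>, of s]) (use s in auto)
      then show ?thesis by (simp add: labellings_empty[OF s(2)])
    next
      case False
      \<comment> \<open>Not all particles are in use, so some row has room. The new point goes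
        there, which makes the factor \<open>s - ?c\<close> positive and hence cancellable.\<close>
      have "\<exists>s\<in>{1..n}. card {a\<in>?A. \<rho> a = s} < s"
      proof (rule ccontr)
        assume "\<not> (\<exists>s\<in>{1..n}. card {a\<in>?A. \<rho> a = s} < s)"
        then have "(\<Sum>s\<in>{1..n}. s) \<le> (\<Sum>s\<in>{1..n}. card {a\<in>?A. \<rho> a = s})"
          by (intro sum_mono) (metis not_less)
        then show False using sum_row_counts[OF \<rho>] step.hyps by (simp add: card_particle_index)
      qed
      then obtain s where s: "s \<in> {1..n}" and less: "card {a\<in>?A. \<rho> a = s} < s" by auto
      let ?c = "card {a\<in>?A. \<rho> a = s}"
      let ?\<rho> = "\<rho>(m := s)"
      let ?D = "\<lambda>x. 1 / \<kappa> * corr {..<Suc m} ?\<rho> x"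
      have rows: "?\<rho> ` insert m ?A \<subseteq> {1..n}" using \<rho> s by auto
      have IH: "AE x in PiM {..<Suc m} (\<lambda>_. lborel). 0 \<le> ?D x"
        "\<And>h. h \<in> borel_measurable (PiM {..<Suc m} (\<lambda>_. lborel)) \<Longrightarrow>
          (\<integral>\<^sup>+x. h x * ennreal (?D x) \<partial>PiM {..<Suc m} (\<lambda>_. lborel)) =
          (\<Sum>\<tau>\<in>labellings n (Suc m) ?\<rho>. \<integral>\<^sup>+y. h (sample \<tau> {..<Suc m} y) * ennreal (f y) \<partial>lebesgue_pattern n)"
        using step.IH rows unfolding ins[symmetric] by blast+
      have D_meas: "?D \<in> borel_measurable (PiM {..<Suc m} (\<lambda>_. lborel))"
        using corr_measurable by measurable
      have "{x \<in> space (PiM {..<Suc m} (\<lambda>_. lborel)). 0 \<le> ?D x} \<in> sets (PiM {..<Suc m} (\<lambda>_. lborel))"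
        using D_meas by measurable
      then have AE2: "AE x in ?M. AE w in lborel. 0 \<le> ?D (x(m := w))"
        by (intro AE_PiM_insert_lborel[OF finite_lessThan mA, folded ins] IH(1))
      have cnt: "{j\<in>?A. ?\<rho> j = ?\<rho> m} = {a\<in>?A. \<rho> a = s}" by auto
      have cc: "corr ?A ?\<rho> x = corr ?A \<rho> x" for x by (rule corr_cong) auto
      have inner: "(\<integral>\<^sup>+w. ennreal (?D (x(m := w))) \<partial>lborel) = ennreal ((real s - real ?c) * (1 / \<kappa> * corr ?A \<rho> x))"
        and inner0: "0 \<le> (real s - real ?c) * (1 / \<kappa> * corr ?A \<rho> x)"
        if "AE w in lborel. 0 \<le> ?D (x(m := w))" for x
        using nn_integrate_out[OF _ _ rows, of "1 / \<kappa>" x] that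
        unfolding ins[symmetric] row_measure_eq cnt cc by auto
      have sc: "real s - real ?c > 0" using less by simp
      show ?thesis
      proof (intro conjI ballI)
        show "AE x in ?M. 0 \<le> 1 / \<kappa> * corr ?A \<rho> x"
          using AE2
        proof eventually_elim
          fix x assume "AE w in lborel. 0 \<le> ?D (x(m := w))"
          from inner0[OF this] sc show "0 \<le> 1 / \<kappa> * corr ?A \<rho> x"
            by (simp only: zero_le_mult_iff) linarith
        qed
        fix h :: "(nat \<Rightarrow> real) \<Rightarrow> ennreal" assume h: "h \<in> borel_measurable ?M"
        \<comment> \<open>A test function that ignores the new point; the induction hypothesis
          applied to it computes the marginal.\<close>
        let ?h = "\<lambda>x. h (restrict x ?A)"
        have h': "?h \<in> borel_measurable (PiM {..<Suc m} (\<lambda>_. lborel))"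
          by (rule measurable_compose[OF measurable_restrict_subset h]) auto
        have hD: "(\<lambda>x. ?h x * ennreal (?D x)) \<in> borel_measurable (PiM (insert m ?A) (\<lambda>_. lborel))"
          using h' D_meas unfolding ins by measurable
        let ?L = "\<integral>\<^sup>+x. h x * ennreal (1 / \<kappa> * corr ?A \<rho> x) \<partial>?M"
        let ?S = "\<Sum>\<tau>\<in>labellings n m \<rho>. \<integral>\<^sup>+y. h (sample \<tau> ?A y) * ennreal (f y) \<partial>lebesgue_pattern n"
        have "(\<integral>\<^sup>+x. ?h x * ennreal (?D x) \<partial>PiM {..<Suc m} (\<lambda>_. lborel)) =
            (\<integral>\<^sup>+x. (\<integral>\<^sup>+w. ?h (x(m := w)) * ennreal (?D (x(m := w))) \<partial>lborel) \<partial>?M)"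
          using lborel_prod.product_nn_integral_insert[OF _ _ hD] unfolding ins by simp
        also have "\<dots> = (\<integral>\<^sup>+x. ennreal (real s - real ?c) * (h x * ennreal (1 / \<kappa> * corr ?A \<rho> x)) \<partial>?M)"
        proof (rule nn_integral_cong_AE)
          show "AE x in ?M. (\<integral>\<^sup>+w. ?h (x(m := w)) * ennreal (?D (x(m := w))) \<partial>lborel) =
              ennreal (real s - real ?c) * (h x * ennreal (1 / \<kappa> * corr ?A \<rho> x))"
            using AE2 AE_space
          proof eventually_elim
            fix x assume ae: "AE w in lborel. 0 \<le> ?D (x(m := w))" and x: "x \<in> space ?M"
            have hx: "?h (x(m := w)) = h x" for w
              by (rule arg_cong[of _ _ h]) (use x in \<open>auto simp: space_PiM PiE_iff extensional_def fun_eq_iff\<close>)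
            have upd: "(\<lambda>w. x(m := w)) \<in> measurable lborel (PiM {..<Suc m} (\<lambda>_. lborel))"
              unfolding ins using x by (intro measurable_fun_upd[where J = ?A]) auto
            have "(\<lambda>w. ennreal (?D (x(m := w)))) \<in> borel_measurable lborel"
              using measurable_compose[OF upd D_meas] by simp
            then have "(\<integral>\<^sup>+w. h x * ennreal (?D (x(m := w))) \<partial>lborel) = h x * (\<integral>\<^sup>+w. ennreal (?D (x(m := w))) \<partial>lborel)"
              by (rule nn_integral_cmult)
            then show "(\<integral>\<^sup>+w. ?h (x(m := w)) * ennreal (?D (x(m := w))) \<partial>lborel) =
              ennreal (real s - real ?c) * (h x * ennreal (1 / \<kappa> * corr ?A \<rho> x))"
              unfolding hx inner[OF ae] ennreal_mult'[OF less_imp_le[OF sc]]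
              by (simp only: mult.left_commute[of "h x"])
          qed
        qed
        also have "\<dots> = ennreal (real s - real ?c) * ?L"
          by (rule nn_integral_cmult) (use h corr_measurable in measurable)
        finally have 1: "(\<integral>\<^sup>+x. ?h x * ennreal (?D x) \<partial>PiM {..<Suc m} (\<lambda>_. lborel)) = ennreal (real s - real ?c) * ?L" .
        have "(\<integral>\<^sup>+x. ?h x * ennreal (?D x) \<partial>PiM {..<Suc m} (\<lambda>_. lborel)) =
            (\<Sum>\<tau>\<in>labellings n (Suc m) ?\<rho>. \<integral>\<^sup>+y. h (sample (restrict \<tau> ?A) ?A y) * ennreal (f y) \<partial>lebesgue_pattern n)"
          unfolding IH(2)[OF h']
        proof (intro sum.cong refl nn_integral_cong)
          fix \<tau> y
          have "restrict (sample \<tau> {..<Suc m} y) ?A = sample (restrict \<tau> ?A) ?A y"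
            by (auto simp: sample_def fun_eq_iff)
          then show "?h (sample \<tau> {..<Suc m} y) * ennreal (f y) = h (sample (restrict \<tau> ?A) ?A y) * ennreal (f y)"
            by simp
        qed
        also have "\<dots> = of_nat (s - ?c) * ?S"
          using sum_labellings_Suc[OF s, of m \<rho> "\<lambda>\<tau>. \<integral>\<^sup>+y. h (sample \<tau> ?A y) * ennreal (f y) \<partial>lebesgue_pattern n"] less
          by simp
        also have "(of_nat (s - ?c) :: ennreal) = ennreal (real s - real ?c)"
          using less by (simp add: ennreal_of_nat_eq_real_of_nat of_nat_diff)
        finally have "ennreal (real s - real ?c) * ?L = ennreal (real s - real ?c) * ?S"
          unfolding 1 .
        then show "?L = ?S"
          using sc by (subst (asm) ennreal_mult_cancel_left) auto
      qed
    qed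
  qed
qed

lemma \<kappa>_eq_1: "\<kappa> = 1"
proof -
  have lab: "labellings n 0 (\<lambda>_. 1) = {\<lambda>_. undefined}"
    by (auto simp: labellings_def)
  have c: "corr {..<0} (\<lambda>_. 1) x = 1" for x :: "nat \<Rightarrow> real" by (simp add: corr_def)
  have "(AE x in PiM {..<0::nat} (\<lambda>_. lborel :: real measure). 0 \<le> 1 / \<kappa> * 1) \<and>
      (\<integral>\<^sup>+x. 1 * ennreal (1 / \<kappa> * 1) \<partial>PiM {..<0::nat} (\<lambda>_. lborel :: real measure)) =
      (\<integral>\<^sup>+y. 1 * ennreal (f y) \<partial>lebesgue_pattern n)"
    using correlation_scaled[of 0, rule_format, of "\<lambda>_. 1"] unfolding lab c
    by (auto dest!: bspec[where x = "\<lambda>_. 1"])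
  then have "0 \<le> 1 / \<kappa>" "ennreal (1 / \<kappa>) = 1"
    by (simp_all add: PiM_empty f_prob AE_count_space)
  then have "1 / \<kappa> = 1" by (simp add: ennreal_eq_1)
  then show ?thesis by (simp add: divide_eq_eq split: if_splits)
qed

lemmas correlation = correlation_scaled[unfolded \<kappa>_eq_1 div_by_1 mult_1_left, rule_format]

end

section \<open>The reference measure\<close>

lemma sigma_finite_reference_measure: "sigma_finite_measure (reference_measure n)"
  unfolding reference_measure_def
  by (intro sigma_finite_pair_measure sigma_finite_measure_count_space_finite lborel.sigma_finite_measure_axioms) simp

interpretation reference_prod: product_sigma_finite "\<lambda>_. reference_measure n" for n
  by (simp add: product_sigma_finite_def sigma_finite_reference_measure)

lemma nn_integral_reference_measure:
  assumes "h \<in> borel_measurable (reference_measure n)"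
  shows "(\<integral>\<^sup>+p. h p \<partial>reference_measure n) = (\<Sum>r\<in>{1..n}. \<integral>\<^sup>+x. h (r, x) \<partial>lborel)"
  using assms unfolding reference_measure_def
  by (subst lborel.nn_integral_fst[symmetric]) (simp_all add: nn_integral_count_space_finite)

lemma measurable_label_rows:
  assumes "\<And>a. a \<in> A \<Longrightarrow> \<rho> a \<in> {1..n}"
  shows "(\<lambda>x. \<lambda>a\<in>A. (\<rho> a, x a)) \<in> measurable (PiM A (\<lambda>_. lborel)) (PiM A (\<lambda>_. reference_measure n))"
  unfolding reference_measure_def
  by (intro measurable_restrict measurable_Pair measurable_component_singleton) (use assms in auto)

text \<open>The row coordinate is discrete, so the integral splits into one Lebesgue integral for
  each assignment of rows to the points.\<close>

lemma nn_integral_PiM_reference_measure: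
  assumes "finite A" and "h \<in> borel_measurable (PiM A (\<lambda>_. reference_measure n))"
  shows "(\<integral>\<^sup>+p. h p \<partial>PiM A (\<lambda>_. reference_measure n)) =
    (\<Sum>\<rho>\<in>A \<rightarrow>\<^sub>E {1..n}. \<integral>\<^sup>+x. h (\<lambda>a\<in>A. (\<rho> a, x a)) \<partial>PiM A (\<lambda>_. lborel))"
  using assms
proof (induction A arbitrary: h rule: finite_induct)
  case empty
  show ?case
    by (simp add: PiM_empty nn_integral_count_space_finite restrict_def)
next
  case (insert a A h)
  let ?lab = "\<lambda>\<rho> x. \<lambda>b\<in>A. (\<rho> b, x b) :: nat \<times> real"
  have fin: "finite (A \<rightarrow>\<^sub>E {1..n})" using insert by (intro finite_PiE) auto
  have in_space: "p(a := q) \<in> space (PiM (insert a A) (\<lambda>_. reference_measure n))"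
    if "p \<in> space (PiM A (\<lambda>_. reference_measure n))" "q \<in> space (reference_measure n)" for p q
    using that by (auto simp: space_PiM PiE_iff extensional_def)
  have m1: "(\<lambda>q. h (p(a := q))) \<in> borel_measurable (reference_measure n)"
    if "p \<in> space (PiM A (\<lambda>_. reference_measure n))" for p
    by (rule measurable_compose[OF measurable_component_update[OF that insert.hyps(2)] insert.prems])
  have m2: "(\<lambda>p. \<integral>\<^sup>+w. h (p(a := (r, w))) \<partial>lborel) \<in> borel_measurable (PiM A (\<lambda>_. reference_measure n))"
    if "r \<in> {1..n}" for r
  proof (rule lborel.borel_measurable_nn_integral)
    have "(\<lambda>z. (fst z)(a := (r, snd z))) \<in> measurable (PiM A (\<lambda>_. reference_measure n) \<Otimes>\<^sub>M lborel) (PiM (insert a A) (\<lambda>_. reference_measure n))"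
      by (rule measurable_fun_upd[where J = A]) (use that in \<open>auto simp: reference_measure_def\<close>)
    from measurable_compose[OF this insert.prems]
    show "(\<lambda>(p, w). h (p(a := (r, w)))) \<in> borel_measurable (PiM A (\<lambda>_. reference_measure n) \<Otimes>\<^sub>M lborel)"
      unfolding case_prod_beta .
  qed
  have "(\<integral>\<^sup>+p. h p \<partial>PiM (insert a A) (\<lambda>_. reference_measure n)) =
      (\<integral>\<^sup>+p. (\<integral>\<^sup>+q. h (p(a := q)) \<partial>reference_measure n) \<partial>PiM A (\<lambda>_. reference_measure n))"
    by (rule reference_prod.product_nn_integral_insert) fact+
  also have "\<dots> = (\<integral>\<^sup>+p. (\<Sum>r\<in>{1..n}. \<integral>\<^sup>+w. h (p(a := (r, w))) \<partial>lborel) \<partial>PiM A (\<lambda>_. reference_measure n))"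
    by (intro nn_integral_cong nn_integral_reference_measure m1)
  also have "\<dots> = (\<Sum>\<rho>\<in>A \<rightarrow>\<^sub>E {1..n}. \<integral>\<^sup>+x. (\<Sum>r\<in>{1..n}. \<integral>\<^sup>+w. h ((?lab \<rho> x)(a := (r, w))) \<partial>lborel) \<partial>PiM A (\<lambda>_. lborel))"
    by (rule insert.IH) (intro borel_measurable_sum m2)
  also have "\<dots> = (\<Sum>\<rho>\<in>A \<rightarrow>\<^sub>E {1..n}. \<Sum>r\<in>{1..n}. \<integral>\<^sup>+x. (\<integral>\<^sup>+w. h ((?lab \<rho> x)(a := (r, w))) \<partial>lborel) \<partial>PiM A (\<lambda>_. lborel))"
  proof (intro sum.cong refl nn_integral_sum)
    fix \<rho> r assume \<rho>: "\<rho> \<in> A \<rightarrow>\<^sub>E {1..n}" and r: "r \<in> {1..n}"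
    have "?lab \<rho> \<in> measurable (PiM A (\<lambda>_. lborel)) (PiM A (\<lambda>_. reference_measure n))"
      by (rule measurable_label_rows) (use \<rho> in auto)
    from measurable_compose[OF this m2[OF r]]
    show "(\<lambda>x. \<integral>\<^sup>+w. h ((?lab \<rho> x)(a := (r, w))) \<partial>lborel) \<in> borel_measurable (PiM A (\<lambda>_. lborel))" .
  qed
  also have "\<dots> = (\<Sum>r\<in>{1..n}. \<Sum>\<rho>\<in>A \<rightarrow>\<^sub>E {1..n}. \<integral>\<^sup>+x. (\<integral>\<^sup>+w. h ((?lab \<rho> x)(a := (r, w))) \<partial>lborel) \<partial>PiM A (\<lambda>_. lborel))"
    by (rule sum.swap)
  also have "\<dots> = (\<Sum>(r, \<rho>)\<in>{1..n} \<times> (A \<rightarrow>\<^sub>E {1..n}). \<integral>\<^sup>+x. h (\<lambda>b\<in>insert a A. ((\<rho>(a := r)) b, x b)) \<partial>PiM (insert a A) (\<lambda>_. lborel))"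
    unfolding sum.cartesian_product
  proof (intro sum.cong refl, clarify)
    fix \<rho> r assume \<rho>: "\<rho> \<in> A \<rightarrow>\<^sub>E {1..n}" and r: "r \<in> {1..n}"
    have "(\<lambda>x. \<lambda>b\<in>insert a A. ((\<rho>(a := r)) b, x b)) \<in> measurable (PiM (insert a A) (\<lambda>_. lborel)) (PiM (insert a A) (\<lambda>_. reference_measure n))"
      by (rule measurable_label_rows) (use \<rho> r in auto)
    from measurable_compose[OF this insert.prems]
    have m: "(\<lambda>x. h (\<lambda>b\<in>insert a A. ((\<rho>(a := r)) b, x b))) \<in> borel_measurable (PiM (insert a A) (\<lambda>_. lborel))" .
    have "(\<lambda>b\<in>insert a A. ((\<rho>(a := r)) b, (x(a := w)) b)) = (?lab \<rho> x)(a := (r, w))" for x w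
      using insert.hyps by (auto simp: fun_eq_iff)
    then show "(\<integral>\<^sup>+x. (\<integral>\<^sup>+w. h ((?lab \<rho> x)(a := (r, w))) \<partial>lborel) \<partial>PiM A (\<lambda>_. lborel)) =
        (\<integral>\<^sup>+x. h (\<lambda>b\<in>insert a A. ((\<rho>(a := r)) b, x b)) \<partial>PiM (insert a A) (\<lambda>_. lborel))"
      by (simp only: lborel_prod.product_nn_integral_insert[OF insert.hyps m])
  qed
  also have "\<dots> = (\<Sum>\<rho>\<in>insert a A \<rightarrow>\<^sub>E {1..n}. \<integral>\<^sup>+x. h (\<lambda>b\<in>insert a A. (\<rho> b, x b)) \<partial>PiM (insert a A) (\<lambda>_. lborel))"
    unfolding PiE_insert_eq
    by (subst sum.reindex) (use insert.hyps in \<open>auto intro: inj_combinator simp: case_prod_beta comp_def\<close>)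
  finally show ?case .
qed

section \<open>Measurability and almost sure strictness of patterns\<close>

lemma GT_patterns_eq:
  "GT_patterns n = {y \<in> space (lebesgue_pattern n).
     (\<forall>(r, i, j)\<in>{(r, i, j). r \<in> {1..n} \<and> i \<in> {1..r} \<and> j \<in> {1..r} \<and> i < j}. y r j < y r i) \<and>
     (\<forall>(r, i)\<in>particle_index (n - 1). y r i < y (r + 1) i \<and> y (r + 1) (i + 1) \<le> y r i)}"
  (is "_ = ?R")
proof (rule Set.set_eqI, rule iffI)
  fix y assume y: "y \<in> GT_patterns n"
  have "y \<in> (\<Pi>\<^sub>E r\<in>{1..n}. {1..r} \<rightarrow>\<^sub>E UNIV)"
    using y by (auto simp: GT_patterns_def weyl_chamber_def PiE_iff)
  moreover have "y r j < y r i" if "r \<in> {1..n}" "i \<in> {1..r}" "j \<in> {1..r}" "i < j" for r i j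
  proof -
    have "y r \<in> weyl_chamber r" using y that by (auto simp: GT_patterns_def)
    then show ?thesis using that by (auto simp: weyl_chamber_def)
  qed
  ultimately show "y \<in> ?R"
    using y by (auto simp: space_PiM lebesgue_pattern_def lebesgue_vec_def GT_patterns_def particle_index_def)
next
  fix y assume y: "y \<in> ?R"
  have s: "y \<in> (\<Pi>\<^sub>E r\<in>{1..n}. {1..r} \<rightarrow>\<^sub>E UNIV)"
    using y by (auto simp: space_PiM lebesgue_pattern_def lebesgue_vec_def)
  have "y r \<in> weyl_chamber r" if "r \<in> {1..n}" for r
    using PiE_mem[OF s that] y that by (auto simp: weyl_chamber_def)
  then have "y \<in> (\<Pi>\<^sub>E r\<in>{1..n}. weyl_chamber r)" using s by (auto simp: PiE_iff)
  then show "y \<in> GT_patterns n" using y by (auto simp: GT_patterns_def particle_index_def)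
qed

lemma GT_patterns_sets [measurable]: "GT_patterns n \<in> sets (lebesgue_pattern n)"
proof -
  let ?S = "space (lebesgue_pattern n)"
  let ?T = "{(r, i, j). r \<in> {1..n} \<and> i \<in> {1..r} \<and> j \<in> {1..r} \<and> i < j}"
  let ?A = "\<lambda>(r, i, j). {y \<in> ?S. y r j < y r i}"
  let ?B = "\<lambda>(r, i). {y \<in> ?S. y r i < y (r + 1) i} \<inter> {y \<in> ?S. y (r + 1) (i + 1) \<le> y r i}"
  note less = borel_measurable_less[OF measurable_lebesgue_pattern_component measurable_lebesgue_pattern_component]
    and le = borel_measurable_le[OF measurable_lebesgue_pattern_component measurable_lebesgue_pattern_component]
  have fin: "finite ?T"
    by (rule finite_subset[of _ "{1..n} \<times> {1..n} \<times> {1..n}"]) auto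
  have A: "?A t \<in> sets (lebesgue_pattern n)" if "t \<in> ?T" for t
  proof -
    obtain r i j where t: "t = (r, i, j)" by (cases t)
    then have "(r, i) \<in> particle_index n" "(r, j) \<in> particle_index n"
      using that by (auto simp: particle_index_def)
    then show ?thesis unfolding t prod.case by (intro less)
  qed
  have B: "?B t \<in> sets (lebesgue_pattern n)" if "t \<in> particle_index (n - 1)" for t
  proof -
    obtain r i where t: "t = (r, i)" by (cases t)
    then have "(r, i) \<in> particle_index n" "(r + 1, i) \<in> particle_index n" "(r + 1, i + 1) \<in> particle_index n"
      using that by (auto simp: particle_index_def)
    then show ?thesis unfolding t prod.case by (intro sets.Int less le)
  qed
  have "GT_patterns n = ?S \<inter> (?S - (\<Union>t\<in>?T. ?S - ?A t)) \<inter> (?S - (\<Union>t\<in>particle_index (n - 1). ?S - ?B t))"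
    unfolding GT_patterns_eq by auto
  also have "\<dots> \<in> sets (lebesgue_pattern n)"
    by (intro sets.Int sets.Diff sets.finite_UN sets.top fin finite_particle_index A B)
  finally show ?thesis .
qed

text \<open>A closed pattern without ties satisfies its inequalities strictly, and ties form a null
  set.\<close>

lemma AE_GT_closed_imp_GT_patterns:
  "AE y in lebesgue_pattern n. y \<in> GT_closed n \<longrightarrow> y \<in> GT_patterns n"
proof -
  let ?I = "particle_index n"
  have b: "bij_betw (\<lambda>p. p) ?I ?I" by (simp add: bij_betw_def)
  have "AE y in lebesgue_pattern n. inj_on (sample (\<lambda>p. p) ?I y) ?I"
  proof (rule AE_distrD[OF measurable_sample])
    show "AE x in distr (lebesgue_pattern n) (PiM ?I (\<lambda>_. lborel)) (sample (\<lambda>p. p) ?I). inj_on x ?I"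
      unfolding distr_sample[OF b finite_particle_index] by (rule AE_inj_on_PiM_lborel) simp
  qed simp
  then show ?thesis
  proof eventually_elim
    fix y assume inj: "inj_on (sample (\<lambda>p. p) ?I y) ?I"
    have neq: "y r i \<noteq> y r' i'" if "(r, i) \<in> ?I" "(r', i') \<in> ?I" "(r, i) \<noteq> (r', i')" for r i r' i'
      using inj_onD[OF inj _ that(1,2)] that by (auto simp: sample_def)
    show "y \<in> GT_closed n \<longrightarrow> y \<in> GT_patterns n"
    proof
      assume y: "y \<in> GT_closed n"
      have "y r \<in> weyl_chamber r" if r: "r \<in> {1..n}" for r
      proof -
        have yr: "y r \<in> weyl_chamber_closure r" using y r by (auto simp: GT_closed_def)
        have "y r j < y r i" if "1 \<le> i" "i < j" "j \<le> r" for i j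
        proof -
          have "y r j \<le> y r i" using yr that by (auto simp: weyl_chamber_closure_eq)
          moreover have "y r j \<noteq> y r i" using that r by (intro neq) (auto simp: particle_index_def)
          ultimately show ?thesis by simp
        qed
        then show ?thesis using yr by (auto simp: weyl_chamber_closure_eq weyl_chamber_def)
      qed
      then have "y \<in> (\<Pi>\<^sub>E r\<in>{1..n}. weyl_chamber r)" using y by (auto simp: GT_closed_def PiE_iff)
      moreover have "y (r + 1) i > y r i" if "1 \<le> i" "i \<le> r" "r \<le> n - 1" for i r
      proof -
        have "y (r + 1) i \<ge> y r i" using y that by (auto simp: GT_closed_def)
        moreover have "y (r + 1) i \<noteq> y r i" using that by (intro neq) (auto simp: particle_index_def)
        ultimately show ?thesis by simp
      qed
      ultimately show "y \<in> GT_patterns n" using y by (auto simp: GT_closed_def GT_patterns_def)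
    qed
  qed
qed

section \<open>The correlation functions of the point field\<close>

context gt_density
begin

definition \<nu> :: "(nat \<Rightarrow> nat \<Rightarrow> real) measure" where
  "\<nu> = restrict_space (density (lebesgue_pattern n) (\<lambda>y. ennreal (f y))) (GT_patterns n)"

text \<open>The restriction loses no mass: \<open>f\<close> vanishes outside
  \<open>GT_closed\<close>, and almost every point of \<open>GT_closed\<close> lies in
  \<open>GT_patterns\<close>.\<close>

lemma nn_integral_\<nu>:
  assumes g: "g \<in> borel_measurable (lebesgue_pattern n)"
  shows "(\<integral>\<^sup>+y. g y \<partial>\<nu>) = (\<integral>\<^sup>+y. g y * ennreal (f y) \<partial>lebesgue_pattern n)"
proof -
  have "(\<integral>\<^sup>+y. g y \<partial>\<nu>) = (\<integral>\<^sup>+y. g y * indicator (GT_patterns n) y \<partial>density (lebesgue_pattern n) (\<lambda>y. ennreal (f y)))"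
    unfolding \<nu>_def by (rule nn_integral_restrict_space) (simp add: sets.Int_space_eq2)
  also have "\<dots> = (\<integral>\<^sup>+y. ennreal (f y) * (g y * indicator (GT_patterns n) y) \<partial>lebesgue_pattern n)"
    by (rule nn_integral_density) (use f_measurable g in measurable)
  also have "\<dots> = (\<integral>\<^sup>+y. g y * ennreal (f y) \<partial>lebesgue_pattern n)"
  proof (rule nn_integral_cong_AE)
    show "AE y in lebesgue_pattern n. ennreal (f y) * (g y * indicator (GT_patterns n) y) = g y * ennreal (f y)"
      using AE_GT_closed_imp_GT_patterns[of n]
      by eventually_elim (use f_support in \<open>auto simp: indicator_def mult.commute\<close>)
  qed
  finally show ?thesis .
qed

lemma prob_space_\<nu>: "prob_space \<nu>"
proof (rule prob_spaceI)
  have "emeasure \<nu> (space \<nu>) = (\<integral>\<^sup>+y. 1 \<partial>\<nu>)" by simp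
  also have "\<dots> = 1" by (subst nn_integral_\<nu>) (simp_all add: f_prob)
  finally show "emeasure \<nu> (space \<nu>) = 1" .
qed

abbreviation K :: "nat \<times> real \<Rightarrow> nat \<times> real \<Rightarrow> real" where
  "K p q \<equiv> Kf (fst p) (snd p) (fst q) (snd q)"

text \<open>Row labels are countable, so it suffices to fix both and use measurability in the
  positions.\<close>

lemma K_measurable:
  assumes ij: "i \<in> A" "j \<in> A"
  shows "(\<lambda>p. K (p i) (p j)) \<in> borel_measurable (PiM A (\<lambda>_. reference_measure n))"
proof -
  have fst: "(\<lambda>p. fst (p k)) \<in> measurable (PiM A (\<lambda>_. reference_measure n)) (count_space UNIV)" if "k \<in> A" for k
  proof (rule measurable_compose[OF measurable_component_singleton[OF that]])
    have "(\<lambda>p. id (fst p)) \<in> measurable (count_space {1..n} \<Otimes>\<^sub>M lborel) (count_space UNIV)"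
      by (rule measurable_compose[OF measurable_fst]) simp
    then show "fst \<in> measurable (reference_measure n) (count_space UNIV)"
      by (simp add: reference_measure_def)
  qed
  have snd: "(\<lambda>p. snd (p k)) \<in> borel_measurable (PiM A (\<lambda>_. reference_measure n))" if "k \<in> A" for k
    by (rule measurable_compose[OF measurable_component_singleton[OF that]])
       (simp add: reference_measure_def)
  show ?thesis
    by (rule measurable_compose_countable[OF _ fst[OF ij(1)], where f = "\<lambda>r p. Kf r (snd (p i)) (fst (p j)) (snd (p j))"],
        rule measurable_compose_countable[OF _ fst[OF ij(2)], where f = "\<lambda>s p. Kf _ (snd (p i)) s (snd (p j))"])
       (intro Kf_measurable snd ij)
qed

lemma det_K_eq_corr:
  "Determinant.det (Matrix.mat m m (\<lambda>(i, j). K (p i) (p j))) = corr {..<m} (\<lambda>a. fst (p a)) (\<lambda>a. snd (p a))"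
  by (simp add: gdet_det[of m "\<lambda>i j. K (p i) (p j)"] corr_def)

lemma corr_label_rows:
  "corr {..<m} (\<lambda>a. fst ((\<lambda>b\<in>{..<m}. (\<rho> b, x b)) a)) (\<lambda>a. snd ((\<lambda>b\<in>{..<m}. (\<rho> b, x b)) a)) = corr {..<m} \<rho> x"
  by (rule corr_cong) auto

text \<open>The tuples counted by the moment measure are injective labellings. Grouped by the rows
  of their particles they become the sums over \<open>labellings\<close> in
  \<open>correlation\<close>, and summing over rows reassembles the integral against the reference
  measure.\<close>

lemma determinantal_K: "determinantal \<nu> (particle_index n) particle (reference_measure n) K"
  unfolding determinantal_def
proof (intro conjI allI impI)
  have sets: "sets \<nu> = sets (restrict_space (lebesgue_pattern n) (GT_patterns n))"
    unfolding \<nu>_def by (rule sets_restrict_space_cong) simp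
  have "(\<lambda>w. particle w p) \<in> measurable (lebesgue_pattern n) (reference_measure n)" if p: "p \<in> particle_index n" for p
    unfolding particle_def reference_measure_def case_prod_beta
    using p measurable_lebesgue_pattern_component[of "fst p" "snd p" n]
    by (intro measurable_Pair) (auto simp: particle_index_def)
  then show "random_configuration \<nu> (particle_index n) particle (reference_measure n)"
    unfolding random_configuration_def using prob_space_\<nu>
    by (auto simp: measurable_cong_sets[OF sets refl] intro: measurable_restrict_space1)
next
  fix m assume m: "1 \<le> m \<and> m \<le> card (particle_index n)"
  let ?A = "{..<m}" and ?I = "particle_index n"
  let ?M = "PiM ?A (\<lambda>_. reference_measure n)" and ?L = "PiM ?A (\<lambda>_. lborel :: real measure)"
  let ?F = "\<lambda>p. corr ?A (\<lambda>a. fst (p a)) (\<lambda>a. snd (p a))"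
  let ?lab = "\<lambda>\<rho> x. \<lambda>b\<in>?A. (\<rho> b, x b) :: nat \<times> real"
  have F: "?F \<in> borel_measurable ?M"
    unfolding corr_def gdet_def
  proof (intro borel_measurable_sum borel_measurable_times borel_measurable_prod borel_measurable_const)
    fix \<sigma> i assume \<sigma>: "\<sigma> \<in> {\<sigma>. \<sigma> permutes ?A}" and i: "i \<in> ?A"
    have "\<sigma> i \<in> ?A" using \<sigma> i by (simp only: permutes_in_image mem_Collect_eq)
    from K_measurable[OF i this]
    show "(\<lambda>p. Kf (fst (p i)) (snd (p i)) (fst (p (\<sigma> i))) (snd (p (\<sigma> i)))) \<in> borel_measurable ?M" .
  qed
  have lab: "?lab \<rho> \<in> measurable ?L ?M" if "\<rho> \<in> ?A \<rightarrow>\<^sub>E {1..n}" for \<rho>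
    by (rule measurable_label_rows) (rule PiE_mem[OF that])
  have pos: "AE x in ?L. 0 \<le> corr ?A \<rho> x"
    and int: "\<And>h. h \<in> borel_measurable ?L \<Longrightarrow> (\<integral>\<^sup>+x. h x * ennreal (corr ?A \<rho> x) \<partial>?L) =
      (\<Sum>\<tau>\<in>labellings n m \<rho>. \<integral>\<^sup>+y. h (sample \<tau> ?A y) * ennreal (f y) \<partial>lebesgue_pattern n)"
    if "\<rho> \<in> ?A \<rightarrow>\<^sub>E {1..n}" for \<rho>
    using correlation[of m \<rho>] m that by auto
  show "is_correlation_function \<nu> ?I particle (reference_measure n) m
      (\<lambda>p. Determinant.det (Matrix.mat m m (\<lambda>(i, j). K (p i) (p j))))"
    unfolding is_correlation_function_def det_K_eq_corr
  proof (intro conjI ballI F)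
    \<comment> \<open>Non-negativity is known for each assignment of rows separately; integrating
      the indicator of the bad set combines these into one null set.\<close>
    let ?neg = "\<lambda>p. indicator {p \<in> space ?M. ?F p < 0} p :: ennreal"
    have neg: "{p \<in> space ?M. ?F p < 0} \<in> sets ?M" using F by measurable
    have "(\<integral>\<^sup>+p. ?neg p \<partial>?M) = (\<Sum>\<rho>\<in>?A \<rightarrow>\<^sub>E {1..n}. \<integral>\<^sup>+x. ?neg (?lab \<rho> x) \<partial>?L)"
      using neg by (intro nn_integral_PiM_reference_measure) simp_all
    also have "\<dots> = 0"
    proof (intro sum.neutral ballI)
      fix \<rho> assume \<rho>: "\<rho> \<in> ?A \<rightarrow>\<^sub>E {1..n}"
      have "(\<integral>\<^sup>+x. ?neg (?lab \<rho> x) \<partial>?L) = (\<integral>\<^sup>+x. 0 \<partial>?L)"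
        by (rule nn_integral_cong_AE)
           (use pos[OF \<rho>] in \<open>eventually_elim, simp only: indicator_def mem_Collect_eq corr_label_rows, simp\<close>)
      then show "(\<integral>\<^sup>+x. ?neg (?lab \<rho> x) \<partial>?L) = 0" by simp
    qed
    finally have "AE p in ?M. ?neg p = 0"
      using neg by (subst (asm) nn_integral_0_iff_AE) simp_all
    with AE_space show "AE p in ?M. 0 \<le> ?F p"
      by eventually_elim (auto simp: indicator_def split: if_splits)
  next
    fix B assume B: "B \<in> sets ?M"
    let ?T = "{\<tau> \<in> ?A \<rightarrow>\<^sub>E ?I. inj_on \<tau> ?A}"
    have finT: "finite ?T" by (rule finite_subset[of _ "?A \<rightarrow>\<^sub>E ?I"]) (auto intro: finite_PiE)
    let ?\<rho> = "\<lambda>\<tau>. \<lambda>a\<in>?A. fst (\<tau> a)"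
    let ?g = "\<lambda>\<tau> y. indicator B (?lab (?\<rho> \<tau>) (sample \<tau> ?A y)) :: ennreal"
    have \<rho>T: "?\<rho> \<tau> \<in> ?A \<rightarrow>\<^sub>E {1..n}" if "\<tau> \<in> ?T" for \<tau>
    proof
      fix a assume "a \<in> ?A"
      then have "\<tau> a \<in> ?I" using that by auto
      then show "?\<rho> \<tau> a \<in> {1..n}" using \<open>a \<in> ?A\<close> by (auto simp: particle_index_def)
    qed simp
    have gm: "?g \<tau> \<in> borel_measurable (lebesgue_pattern n)" if "\<tau> \<in> ?T" for \<tau>
    proof -
      have \<tau>: "\<tau> \<in> ?A \<rightarrow>\<^sub>E ?I" using that by simp
      have s: "sample \<tau> ?A \<in> measurable (lebesgue_pattern n) ?L"
        by (rule measurable_sample, rule image_subsetI, rule PiE_mem[OF \<tau>])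
      from measurable_compose[OF measurable_compose[OF s lab[OF \<rho>T[OF that]]] borel_measurable_indicator[OF B]]
      show ?thesis .
    qed
    have part: "(\<lambda>a\<in>?A. particle y (\<tau> a)) = ?lab (?\<rho> \<tau>) (sample \<tau> ?A y)" for \<tau> y
      by (auto simp: fun_eq_iff particle_def sample_def case_prod_beta)
    have "moment_measure \<nu> ?I particle m B = (\<integral>\<^sup>+y. (\<Sum>\<tau>\<in>?T. ?g \<tau> y) \<partial>\<nu>)"
      unfolding moment_measure_def
    proof (rule nn_integral_cong)
      fix y
      have "{\<tau> \<in> ?A \<rightarrow>\<^sub>E ?I. inj_on \<tau> ?A \<and> (\<lambda>a\<in>?A. particle y (\<tau> a)) \<in> B} = {\<tau>\<in>?T. ?lab (?\<rho> \<tau>) (sample \<tau> ?A y) \<in> B}"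
        unfolding part by auto
      then show "of_nat (card {\<tau> \<in> ?A \<rightarrow>\<^sub>E ?I. inj_on \<tau> ?A \<and> (\<lambda>a\<in>?A. particle y (\<tau> a)) \<in> B}) = (\<Sum>\<tau>\<in>?T. ?g \<tau> y)"
        using finT by (simp add: indicator_def sum.If_cases Int_def)
    qed
    also have "\<dots> = (\<integral>\<^sup>+y. (\<Sum>\<tau>\<in>?T. ?g \<tau> y) * ennreal (f y) \<partial>lebesgue_pattern n)"
      by (rule nn_integral_\<nu>) (intro borel_measurable_sum gm)
    also have "\<dots> = (\<Sum>\<tau>\<in>?T. \<integral>\<^sup>+y. ?g \<tau> y * ennreal (f y) \<partial>lebesgue_pattern n)"
      unfolding sum_distrib_right
      by (rule nn_integral_sum) (intro borel_measurable_times_ennreal gm measurable_compose[OF f_measurable measurable_ennreal])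
    also have "\<dots> = (\<Sum>\<rho>\<in>?A \<rightarrow>\<^sub>E {1..n}. \<Sum>\<tau>\<in>{\<tau>\<in>?T. ?\<rho> \<tau> = \<rho>}. \<integral>\<^sup>+y. ?g \<tau> y * ennreal (f y) \<partial>lebesgue_pattern n)"
    proof (rule sum.group[symmetric, OF finT])
      show "?\<rho> ` ?T \<subseteq> ?A \<rightarrow>\<^sub>E {1..n}" using \<rho>T by (rule image_subsetI)
    qed (intro finite_PiE, simp_all)
    also have "\<dots> = (\<Sum>\<rho>\<in>?A \<rightarrow>\<^sub>E {1..n}. \<Sum>\<tau>\<in>labellings n m \<rho>. \<integral>\<^sup>+y. indicator B (?lab \<rho> (sample \<tau> ?A y)) * ennreal (f y) \<partial>lebesgue_pattern n)"
    proof (rule sum.cong[OF refl])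
      fix \<rho> assume \<rho>: "\<rho> \<in> ?A \<rightarrow>\<^sub>E {1..n}"
      have eq: "{\<tau>\<in>?T. ?\<rho> \<tau> = \<rho>} = labellings n m \<rho>"
        using \<rho> by (auto simp: labellings_def fun_eq_iff PiE_iff extensional_def)
      show "(\<Sum>\<tau>\<in>{\<tau>\<in>?T. ?\<rho> \<tau> = \<rho>}. \<integral>\<^sup>+y. ?g \<tau> y * ennreal (f y) \<partial>lebesgue_pattern n) =
          (\<Sum>\<tau>\<in>labellings n m \<rho>. \<integral>\<^sup>+y. indicator B (?lab \<rho> (sample \<tau> ?A y)) * ennreal (f y) \<partial>lebesgue_pattern n)"
        unfolding eq[symmetric] by (rule sum.cong[OF refl]) (simp only: mem_Collect_eq)
    qed
    also have "\<dots> = (\<Sum>\<rho>\<in>?A \<rightarrow>\<^sub>E {1..n}. \<integral>\<^sup>+x. indicator B (?lab \<rho> x) * ennreal (corr ?A \<rho> x) \<partial>?L)"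
      by (intro sum.cong refl int[symmetric] measurable_compose[OF lab]) (use B in simp_all)
    also have "\<dots> = (\<integral>\<^sup>+p. ennreal (?F p) * indicator B p \<partial>?M)"
      using F B by (subst nn_integral_PiM_reference_measure) (simp_all add: corr_label_rows mult.commute del: restrict_apply)
    finally show "moment_measure \<nu> ?I particle m B = (\<integral>\<^sup>+p\<in>B. ennreal (?F p) \<partial>?M)" .
  qed
qed

end

section \<open>Vandermonde determinants\<close>

lemma gdet_scale_cols: "finite J \<Longrightarrow> gdet J (\<lambda>i j. c j * M i j) = (\<Prod>j\<in>J. c j) * gdet J M"
  using gdet_transpose[of J "\<lambda>i j. c j * M i j"] gdet_transpose[of J M] gdet_scale_rows[of J c "\<lambda>i j. M j i"]
  by simp

text \<open>As a sum over the permutations with \<open>\<sigma> j = l\<close> it keeps the index set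
  \<open>J\<close>, where a minor would need different sets for rows and columns.\<close>

definition cofactor :: "'a set \<Rightarrow> ('a \<Rightarrow> 'a \<Rightarrow> real) \<Rightarrow> 'a \<Rightarrow> 'a \<Rightarrow> real" where
  "cofactor J M j l = (\<Sum>\<sigma> | \<sigma> permutes J \<and> \<sigma> j = l. of_int (sign \<sigma>) * (\<Prod>k\<in>J - {j}. M k (\<sigma> k)))"

lemma sum_row_cofactor:
  assumes J: "finite J" and j: "j \<in> J"
  shows "(\<Sum>l\<in>J. r l * cofactor J M j l) = gdet J (\<lambda>i k. if i = j then r k else M i k)"
proof -
  have fin: "finite {\<sigma>. \<sigma> permutes J}" using J by (rule finite_permutations)
  have "gdet J (\<lambda>i k. if i = j then r k else M i k) =
      (\<Sum>\<sigma> | \<sigma> permutes J. r (\<sigma> j) * (of_int (sign \<sigma>) * (\<Prod>k\<in>J - {j}. M k (\<sigma> k))))"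
    unfolding gdet_def
  proof (intro sum.cong refl)
    fix \<sigma> assume "\<sigma> \<in> {\<sigma>. \<sigma> permutes J}"
    have "(\<Prod>k\<in>J. if k = j then r (\<sigma> k) else M k (\<sigma> k)) = r (\<sigma> j) * (\<Prod>k\<in>J - {j}. M k (\<sigma> k))"
      using J j by (subst prod.remove[of J j]) auto
    then show "of_int (sign \<sigma>) * (\<Prod>i\<in>J. if i = j then r (\<sigma> i) else M i (\<sigma> i)) =
        r (\<sigma> j) * (of_int (sign \<sigma>) * (\<Prod>k\<in>J - {j}. M k (\<sigma> k)))"
      by simp
  qed
  also have "\<dots> = (\<Sum>l\<in>J. \<Sum>\<sigma>\<in>{\<sigma>\<in>{\<sigma>. \<sigma> permutes J}. \<sigma> j = l}. r (\<sigma> j) * (of_int (sign \<sigma>) * (\<Prod>k\<in>J - {j}. M k (\<sigma> k))))"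
    by (rule sum.group[symmetric, OF fin J]) (use j in \<open>auto simp: permutes_in_image\<close>)
  also have "\<dots> = (\<Sum>l\<in>J. r l * cofactor J M j l)"
    unfolding cofactor_def sum_distrib_left by (intro sum.cong) auto
  finally show ?thesis by simp
qed

lemma sum_col_cofactor:
  assumes J: "finite J" and l: "l \<in> J"
  shows "(\<Sum>j\<in>J. c j * cofactor J M j l) = gdet J (\<lambda>i k. if k = l then c i else M i k)"
proof -
  have fin: "finite {\<sigma>. \<sigma> permutes J}" using J by (rule finite_permutations)
  have "(\<Sum>j\<in>J. c j * cofactor J M j l) =
      (\<Sum>j\<in>J. \<Sum>\<sigma> | \<sigma> permutes J. if \<sigma> j = l then of_int (sign \<sigma>) * (c j * (\<Prod>k\<in>J - {j}. M k (\<sigma> k))) else 0)"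
  proof (intro sum.cong refl)
    fix j
    have "{\<sigma>. \<sigma> permutes J \<and> \<sigma> j = l} = {\<sigma>\<in>{\<sigma>. \<sigma> permutes J}. \<sigma> j = l}" by simp
    then show "c j * cofactor J M j l =
      (\<Sum>\<sigma> | \<sigma> permutes J. if \<sigma> j = l then of_int (sign \<sigma>) * (c j * (\<Prod>k\<in>J - {j}. M k (\<sigma> k))) else 0)"
      unfolding cofactor_def sum_distrib_left
      by (simp only: sum.inter_filter[OF fin] mult.left_commute)
  qed
  also have "\<dots> = (\<Sum>\<sigma> | \<sigma> permutes J. \<Sum>j\<in>J. if \<sigma> j = l then of_int (sign \<sigma>) * (c j * (\<Prod>k\<in>J - {j}. M k (\<sigma> k))) else 0)"
    by (rule sum.swap)
  also have "\<dots> = gdet J (\<lambda>i k. if k = l then c i else M i k)"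
    unfolding gdet_def
  proof (intro sum.cong refl)
    fix \<sigma> assume "\<sigma> \<in> {\<sigma>. \<sigma> permutes J}"
    then have \<sigma>: "\<sigma> permutes J" by simp
    define i where "i = inv_into UNIV \<sigma> l"
    have i: "i \<in> J" "\<sigma> i = l"
      using \<sigma> l permutes_in_image[OF permutes_inv[OF \<sigma>]] by (auto simp: i_def permutes_inverses)
    have iff: "\<sigma> j = l \<longleftrightarrow> j = i" for j using i permutes_inj[OF \<sigma>] by (auto dest: injD)
    have "(\<Prod>k\<in>J. if \<sigma> k = l then c k else M k (\<sigma> k)) = c i * (\<Prod>k\<in>J - {i}. M k (\<sigma> k))"
      using J i by (subst prod.remove[of J i]) (auto simp: iff)
    then show "(\<Sum>j\<in>J. if \<sigma> j = l then of_int (sign \<sigma>) * (c j * (\<Prod>k\<in>J - {j}. M k (\<sigma> k))) else 0) =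
        of_int (sign \<sigma>) * (\<Prod>i\<in>J. if \<sigma> i = l then c i else M i (\<sigma> i))"
      using J i by (simp add: iff)
  qed
  finally show ?thesis .
qed

text \<open>This is the expansion along column \<open>l\<close> after column \<open>l'\<close> has
  been copied into it; for \<open>l \<noteq> l'\<close> that matrix has two equal columns.\<close>

lemma sum_cofactor_dual:
  assumes J: "finite J" and l: "l \<in> J" "l' \<in> J"
  shows "(\<Sum>j\<in>J. M j l' * cofactor J M j l) = of_bool (l = l') * gdet J M"
proof (cases "l = l'")
  case True
  have "(\<Sum>j\<in>J. M j l' * cofactor J M j l) = gdet J (\<lambda>i k. if k = l then M i l' else M i k)"
    by (rule sum_col_cofactor[OF J l(1)])
  also have "\<dots> = gdet J M" using True by (intro gdet_cong) auto
  finally show ?thesis using True by simp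
next
  case False
  have "(\<Sum>j\<in>J. M j l' * cofactor J M j l) = gdet J (\<lambda>i k. if k = l then M i l' else M i k)"
    by (rule sum_col_cofactor[OF J l(1)])
  also have "\<dots> = 0" by (rule gdet_identical_cols[OF J l False]) (use False in auto)
  finally show ?thesis using False by simp
qed

lemma gdet_vandermonde_power: "gdet {1..n} (\<lambda>i j. y i ^ (n - j)) = vandermonde n y"
proof (induction n)
  case 0
  show ?case by (simp add: vandermonde_def)
next
  case (Suc n)
  let ?J = "{1..Suc n}"
  \<comment> \<open>Multiplication by \<open>?U\<close> on the right subtracts
    \<open>y (Suc n)\<close> times the next column from each column. This clears the last row except
    for its final 1 and splits off \<open>y i - y (Suc n)\<close> from the others.\<close>
  let ?U = "\<lambda>k j. of_bool (k = j) - y (Suc n) * of_bool (k = Suc j) :: real"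
  have J: "?J = {1..n} \<union> {Suc n}" by auto
  have "gdet ?J ?U = gdet ?J (\<lambda>k j. ?U j k)" by (rule gdet_transpose[symmetric]) simp
  also have "\<dots> = 1" by (subst gdet_upper_triangular) auto
  finally have U: "gdet ?J ?U = 1" .
  define V where "V i j = (\<Sum>k\<in>?J. y i ^ (Suc n - k) * ?U k j)" for i j
  have V: "V i j = (if j = Suc n then 1 else (y i - y (Suc n)) * y i ^ (n - j))" if "j \<in> ?J" for i j
  proof -
    have "V i j = (\<Sum>k\<in>?J. if k = j then y i ^ (Suc n - k) else 0) - y (Suc n) * (\<Sum>k\<in>?J. if k = Suc j then y i ^ (Suc n - k) else 0)"
      unfolding V_def sum_distrib_left sum_subtractf[symmetric] by (intro sum.cong) (auto simp: algebra_simps)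
    then show ?thesis using that by (cases "n = j") (auto simp: algebra_simps Suc_diff_le)
  qed
  have "gdet ?J (\<lambda>i j. y i ^ (Suc n - j)) = gdet ?J V"
    unfolding V_def gdet_mult[OF finite_atLeastAtMost] U by simp
  also have "\<dots> = gdet {1..n} V * gdet {Suc n} V"
    by (subst J, rule gdet_block) (auto simp: V)
  also have "gdet {Suc n} V = 1" by (simp only: gdet_singleton) (simp add: V)
  also have "gdet {1..n} V = gdet {1..n} (\<lambda>i j. (y i - y (Suc n)) * y i ^ (n - j))"
    by (rule gdet_cong) (simp add: V)
  also have "\<dots> = (\<Prod>i\<in>{1..n}. y i - y (Suc n)) * vandermonde n y"
    by (simp only: gdet_scale_rows Suc.IH)
  also have "\<dots> = vandermonde (Suc n) y"
  proof -
    have "{i<..Suc n} = insert (Suc n) {i<..n}" if "i \<in> {1..n}" for i using that by auto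
    then have "(\<Prod>i\<in>{1..n}. \<Prod>j\<in>{i<..Suc n}. y i - y j) = (\<Prod>i\<in>{1..n}. (y i - y (Suc n)) * (\<Prod>j\<in>{i<..n}. y i - y j))"
      by (intro prod.cong) auto
    then show ?thesis by (simp add: vandermonde_def J prod.distrib)
  qed
  finally show ?case by simp
qed

definition vandermonde_const :: "nat \<Rightarrow> real" where
  "vandermonde_const n = (\<Prod>j\<in>{1..n}. inverse (fact (n - j)))"

lemma vandermonde_const_pos: "vandermonde_const n > 0"
  unfolding vandermonde_const_def by (intro prod_pos) auto

lemma gdet_dpow: "gdet {1..n} (\<lambda>i j. dpow (n - j) (y i)) = vandermonde_const n * vandermonde n y"
proof -
  have "gdet {1..n} (\<lambda>i j. dpow (n - j) (y i)) = gdet {1..n} (\<lambda>i j. inverse (fact (n - j)) * y i ^ (n - j))"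
    by (rule gdet_cong) (simp add: dpow_def divide_inverse)
  then show ?thesis
    by (simp only: gdet_scale_cols[OF finite_atLeastAtMost] gdet_vandermonde_power vandermonde_const_def)
qed

lemma gdet_permute_rows:
  assumes J: "finite J" and \<pi>: "\<pi> permutes J"
  shows "gdet J (\<lambda>i j. M (\<pi> i) j) = of_int (sign \<pi>) * gdet J M"
  using gdet_permute_cols[OF J \<pi>, of "\<lambda>i j. M j i"] gdet_transpose[OF J, of M] gdet_transpose[OF J, of "\<lambda>i j. M (\<pi> i) j"]
  by simp

lemma vandermonde_cong: "(\<And>i. i \<in> {1..n} \<Longrightarrow> y i = y' i) \<Longrightarrow> vandermonde n y = vandermonde n y'"
  unfolding vandermonde_def by (intro prod.cong refl arg_cong2[where f = minus]) auto

lemma vandermonde_permute: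
  assumes "\<sigma> permutes {1..n}"
  shows "vandermonde n (\<lambda>i. y (\<sigma> i)) = of_int (sign \<sigma>) * vandermonde n y"
  using gdet_permute_rows[OF finite_atLeastAtMost assms, of "\<lambda>i j. y i ^ (n - j)"]
  by (simp only: gdet_vandermonde_power)

text \<open>Collects the factors that contain \<open>y j\<close>, all with \<open>y j\<close> first;
  the sign comes from the \<open>j - 1\<close> pairs in which it stood second.\<close>

lemma vandermonde_factor:
  assumes j: "j \<in> {1..n}"
  shows "vandermonde n y = (\<Prod>(i, k)\<in>{(i, k). i \<in> {1..n} - {j} \<and> k \<in> {1..n} - {j} \<and> i < k}. y i - y k) *
    (-1) ^ (j - 1) * (\<Prod>i\<in>{1..n} - {j}. y j - y i)"
proof -
  let ?Q = "{(i, k). i \<in> {1..n} - {j} \<and> k \<in> {1..n} - {j} \<and> i < k}"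
  let ?f = "\<lambda>(i, k). y i - y k"
  have finQ: "finite ?Q" by (rule finite_subset[of _ "{1..n} \<times> {1..n}"]) auto
  have P: "Sigma {1..n} (\<lambda>i. {i<..n}) = ?Q \<union> (Pair j ` {j<..n} \<union> (\<lambda>i. (i, j)) ` {1..<j})"
    using j by auto
  have "vandermonde n y = prod ?f (Sigma {1..n} (\<lambda>i. {i<..n}))"
    unfolding vandermonde_def by (rule prod.Sigma) auto
  also have "\<dots> = prod ?f ?Q * (prod ?f (Pair j ` {j<..n}) * prod ?f ((\<lambda>i. (i, j)) ` {1..<j}))"
  proof -
    have d1: "?Q \<inter> (Pair j ` {j<..n} \<union> (\<lambda>i. (i, j)) ` {1..<j}) = {}" by auto
    have d2: "Pair j ` {j<..n} \<inter> (\<lambda>i. (i, j)) ` {1..<j} = {}" by auto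
    show ?thesis
      unfolding P by (subst prod.union_disjoint[OF finQ _ d1], simp, subst prod.union_disjoint[OF _ _ d2], simp_all)
  qed
  also have "prod ?f (Pair j ` {j<..n}) = (\<Prod>k\<in>{j<..n}. y j - y k)"
    by (subst prod.reindex) (auto simp: inj_on_def)
  also have "prod ?f ((\<lambda>i. (i, j)) ` {1..<j}) = (\<Prod>i\<in>{1..<j}. (-1) * (y j - y i))"
    by (subst prod.reindex) (auto simp: inj_on_def)
  also have "\<dots> = (-1) ^ (j - 1) * (\<Prod>i\<in>{1..<j}. y j - y i)"
    by (subst prod.distrib) simp
  also have "(\<Prod>k\<in>{j<..n}. y j - y k) * ((-1) ^ (j - 1) * (\<Prod>i\<in>{1..<j}. y j - y i)) =
      (-1) ^ (j - 1) * (\<Prod>i\<in>{j<..n} \<union> {1..<j}. y j - y i)"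
    by (subst prod.union_disjoint) auto
  also have "{j<..n} \<union> {1..<j} = {1..n} - {j}" using j by auto
  finally show ?thesis by (simp only: mult.assoc)
qed

text \<open>As a function of one coordinate the Vandermonde product is a Lagrange polynomial up to a
  factor. Written without quotients, this holds for coinciding coordinates too.\<close>

lemma vandermonde_update:
  assumes j: "j \<in> {1..n}"
  shows "vandermonde n (y(j := t)) * (\<Prod>i\<in>{1..n} - {j}. y j - y i) = vandermonde n y * (\<Prod>i\<in>{1..n} - {j}. t - y i)"
proof -
  have 1: "(\<Prod>(i, k)\<in>{(i, k). i \<in> {1..n} - {j} \<and> k \<in> {1..n} - {j} \<and> i < k}. (y(j := t)) i - (y(j := t)) k) =
      (\<Prod>(i, k)\<in>{(i, k). i \<in> {1..n} - {j} \<and> k \<in> {1..n} - {j} \<and> i < k}. y i - y k)"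
    by (intro prod.cong) auto
  have 2: "(\<Prod>i\<in>{1..n} - {j}. (y(j := t)) j - (y(j := t)) i) = (\<Prod>i\<in>{1..n} - {j}. t - y i)"
    by (intro prod.cong) auto
  show ?thesis
    unfolding vandermonde_factor[OF j, of "y(j := t)"] vandermonde_factor[OF j, of y] 1 2
    by (simp only: mult_ac)
qed

lemma vandermonde_eq_0_iff: "vandermonde n y = 0 \<longleftrightarrow> \<not> inj_on y {1..n}"
proof
  assume "vandermonde n y = 0"
  then obtain i j where "i \<in> {1..n}" "j \<in> {i<..n}" "y i = y j"
    by (auto simp: vandermonde_def)
  then have "i \<in> {1..n}" "j \<in> {1..n}" "i \<noteq> j" "y i = y j" by auto
  then show "\<not> inj_on y {1..n}" by (metis inj_onD)
next
  assume "\<not> inj_on y {1..n}"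
  then obtain i j where ij: "i \<in> {1..n}" "j \<in> {1..n}" "y i = y j" "i \<noteq> j" by (auto simp: inj_on_def)
  have "gdet {1..n} (\<lambda>i j. y i ^ (n - j)) = 0"
    by (rule gdet_identical_rows[OF _ ij(1,2,4)]) (use ij in auto)
  then show "vandermonde n y = 0" by (simp only: gdet_vandermonde_power)
qed

section \<open>The determinant of the weights and the symmetrisation of \<open>Phi\<close>\<close>

definition phi_det :: "nat \<Rightarrow> (nat \<Rightarrow> real \<Rightarrow> real) \<Rightarrow> (nat \<Rightarrow> real) \<Rightarrow> real" where
  "phi_det n \<phi> y = gdet {1..n} (\<lambda>i j. \<phi> j (y i))"

lemma phi_det_cong: "(\<And>i. i \<in> {1..n} \<Longrightarrow> y i = y' i) \<Longrightarrow> phi_det n \<phi> y = phi_det n \<phi> y'"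
  unfolding phi_det_def by (rule gdet_cong) simp

lemma Phi_cong: "(\<And>i. i \<in> {1..n} \<Longrightarrow> y i = y' i) \<Longrightarrow> Phi n \<phi> y = Phi n \<phi> y'"
  unfolding Phi_def by (intro arg_cong2[where f = "(*)"] prod.cong vandermonde_cong) auto

lemma nu_density_eq: "nu_density n \<phi> Z y = indicator (GT_closed n) y * (1 / Z * phi_det n \<phi> (y n))"
proof -
  have "gdet {1..n} (\<lambda>i j. \<phi> i (y n j)) = gdet {..<n} (\<lambda>i j. \<phi> (Suc i) (y n (Suc j)))"
    by (rule gdet_reindex) (auto simp: bij_betw_def inj_on_def image_Suc_lessThan)
  then show ?thesis
    unfolding nu_density_def gdet_det[of n "\<lambda>i j. \<phi> (Suc i) (y n (Suc j))"] phi_det_def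
    using gdet_transpose[of "{1..n}" "\<lambda>i j. \<phi> i (y n j)"] by simp
qed

text \<open>Permuting the coordinates of the Vandermonde product absorbs the sign of each term of
  the determinant. This is why the integral of the left side is a multiple of
  \<open>B_const\<close>.\<close>

lemma phi_det_mult_vandermonde:
  "phi_det n \<phi> y * vandermonde n y = (\<Sum>\<sigma> | \<sigma> permutes {1..n}. Phi n \<phi> (\<lambda>i\<in>{1..n}. y (\<sigma> i)))"
proof -
  have "phi_det n \<phi> y = gdet {1..n} (\<lambda>i j. \<phi> i (y j))"
    unfolding phi_det_def using gdet_transpose[of "{1..n}" "\<lambda>i j. \<phi> i (y j)"] by simp
  also have "\<dots> * vandermonde n y = (\<Sum>\<sigma> | \<sigma> permutes {1..n}. (\<Prod>i\<in>{1..n}. \<phi> i (y (\<sigma> i))) * vandermonde n (\<lambda>i. y (\<sigma> i)))"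
    unfolding gdet_def sum_distrib_right by (intro sum.cong refl) (simp add: vandermonde_permute)
  also have "\<dots> = (\<Sum>\<sigma> | \<sigma> permutes {1..n}. Phi n \<phi> (\<lambda>i. y (\<sigma> i)))" by (simp add: Phi_def)
  also have "\<dots> = (\<Sum>\<sigma> | \<sigma> permutes {1..n}. Phi n \<phi> (\<lambda>i\<in>{1..n}. y (\<sigma> i)))"
    by (intro sum.cong refl Phi_cong) simp
  finally show ?thesis .
qed

lemma phi_det_vandermonde_symmetric:
  assumes \<sigma>: "\<sigma> permutes {1..n}"
  shows "phi_det n \<phi> (\<lambda>i\<in>{1..n}. y (\<sigma> i)) * vandermonde n (\<lambda>i\<in>{1..n}. y (\<sigma> i)) = phi_det n \<phi> y * vandermonde n y"
proof -
  have "phi_det n \<phi> (\<lambda>i\<in>{1..n}. y (\<sigma> i)) = phi_det n \<phi> (\<lambda>i. y (\<sigma> i))" by (rule phi_det_cong) simp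
  also have "\<dots> = of_int (sign \<sigma>) * phi_det n \<phi> y"
    unfolding phi_det_def using gdet_permute_rows[OF _ \<sigma>, of "\<lambda>i j. \<phi> j (y i)"] by simp
  moreover have "vandermonde n (\<lambda>i\<in>{1..n}. y (\<sigma> i)) = of_int (sign \<sigma>) * vandermonde n y"
    unfolding vandermonde_permute[OF \<sigma>, symmetric] by (rule vandermonde_cong) simp
  moreover have "of_int (sign \<sigma>) * of_int (sign \<sigma>) = (1 :: real)"
    by (metis of_int_1 of_int_mult sign_idempotent)
  ultimately show ?thesis by (simp add: mult_ac)
qed

lemma phi_det_eq_0:
  assumes "vandermonde n y = 0"
  shows "phi_det n \<phi> y = 0"
proof -
  obtain i j where ij: "i \<in> {1..n}" "j \<in> {1..n}" "y i = y j" "i \<noteq> j"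
    using assms by (auto simp: vandermonde_eq_0_iff inj_on_def)
  show ?thesis
    unfolding phi_det_def by (rule gdet_identical_rows[OF _ ij(1,2,4)]) (use ij in auto)
qed

text \<open>With all but one coordinate fixed, \<open>Phi\<close> is a single weight times a
  polynomial whose roots are the other coordinates. Measurability and moments of the weights are
  extracted from this.\<close>

lemma Phi_update:
  assumes k: "k \<in> {1..n}" and y: "vandermonde n y \<noteq> 0"
  shows "Phi n \<phi> (y(k := t)) = \<phi> k t * ((\<Prod>i\<in>{1..n} - {k}. \<phi> i (y i)) * vandermonde n y * (\<Prod>i\<in>{1..n} - {k}. (t - y i) / (y k - y i)))"
proof -
  have 1: "(\<Prod>i\<in>{1..n}. \<phi> i ((y(k := t)) i)) = \<phi> k t * (\<Prod>i\<in>{1..n} - {k}. \<phi> i (y i))"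
    using k by (subst prod.remove[of _ k]) (auto intro!: prod.cong)
  have nz: "(\<Prod>i\<in>{1..n} - {k}. y k - y i) \<noteq> 0"
  proof -
    have inj: "inj_on y {1..n}" using y by (simp only: vandermonde_eq_0_iff not_not)
    have "y k - y i \<noteq> 0" if "i \<in> {1..n} - {k}" for i using inj_onD[OF inj, of k i] that k by auto
    then show ?thesis by (simp add: prod_zero_iff)
  qed
  have 2: "vandermonde n (y(k := t)) = vandermonde n y * (\<Prod>i\<in>{1..n} - {k}. (t - y i) / (y k - y i))"
    unfolding prod_dividef times_divide_eq_right nonzero_eq_divide_eq[OF nz]
    by (rule vandermonde_update[OF k])
  show ?thesis unfolding Phi_def 1 2 by (simp only: mult_ac)
qed

section \<open>The weight functions\<close>

lemma AE_not_in_finite_lborel: "finite X \<Longrightarrow> AE x in lborel. x \<notin> (X :: real set)"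
  using AE_not_in[of X lborel] by (simp add: finite_imp_null_set_lborel)

lemma AE_PiM_lborel_component:
  assumes i: "i \<in> A" and A: "finite A" and P: "AE x in lborel. P x"
  shows "AE y in PiM A (\<lambda>_. lborel :: real measure). P (y i)"
proof -
  obtain N where N: "{x \<in> space lborel. \<not> P x} \<subseteq> N" "emeasure lborel N = 0" "N \<in> sets lborel"
    using P by (rule AE_E)
  let ?E = "\<lambda>j. if j = i then N else UNIV"
  have "emeasure (PiM A (\<lambda>_. lborel)) (PiE A ?E) = (\<Prod>j\<in>A. emeasure lborel (?E j))"
    by (rule lborel_prod.emeasure_PiM[OF A]) (use N in auto)
  also have "\<dots> = 0" using A i N by (intro prod_zero bexI[of _ i]) auto
  finally have "PiE A ?E \<in> null_sets (PiM A (\<lambda>_. lborel))"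
    using A N by (intro null_setsI sets_PiM_I_finite) auto
  then show ?thesis
    by (rule AE_I') (use N in \<open>auto simp: space_PiM PiE_iff extensional_def\<close>)
qed

lemma AE_lebesgue_vec_permute:
  assumes \<sigma>: "bij_betw \<sigma> {1..n} {1..n}" and P: "AE y in lebesgue_vec n. P y"
  shows "AE y in lebesgue_vec n. P (\<lambda>i\<in>{1..n}. y (\<sigma> i))"
proof -
  have m: "(\<lambda>y. \<lambda>i\<in>{1..n}. y (\<sigma> i)) \<in> measurable (lebesgue_vec n) (lebesgue_vec n)"
    unfolding lebesgue_vec_def
    by (intro measurable_restrict measurable_component_singleton) (use \<sigma> in \<open>auto simp: bij_betw_def\<close>)
  have AE: "AE y in distr (lebesgue_vec n) (lebesgue_vec n) (\<lambda>y. \<lambda>i\<in>{1..n}. y (\<sigma> i)). P y"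
    using P unfolding lebesgue_vec_def distr_PiM_lborel_reindex[OF \<sigma> finite_atLeastAtMost] .
  from AE_distrD[OF m AE] show ?thesis .
qed

locale gt_weights =
  fixes n :: nat and \<phi> :: "nat \<Rightarrow> real \<Rightarrow> real" and Z :: real
  assumes n_pos: "1 \<le> n" and Z_pos: "0 < Z"
    and prob: "defines_probability n \<phi> Z"
    and Phi_integrable: "integrable (lebesgue_vec n) (Phi n \<phi>)"
begin

lemma density_measurable: "nu_density n \<phi> Z \<in> borel_measurable (lebesgue_pattern n)"
  and density_nonneg: "AE y in lebesgue_pattern n. 0 \<le> nu_density n \<phi> Z y"
  using prob by (simp_all add: defines_probability_def)

lemma density_prob: "(\<integral>\<^sup>+y. ennreal (nu_density n \<phi> Z y) \<partial>lebesgue_pattern n) = 1"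
proof -
  interpret prob_space "nu n \<phi> Z" using prob by (simp add: defines_probability_def)
  have "emeasure (nu n \<phi> Z) (space (nu n \<phi> Z)) = (\<integral>\<^sup>+y. ennreal (nu_density n \<phi> Z y) \<partial>lebesgue_pattern n)"
    unfolding nu_def using density_measurable
    by (subst emeasure_density) (auto intro!: nn_integral_cong)
  then show ?thesis using emeasure_space_1 by simp
qed

lemma Phi_measurable: "Phi n \<phi> \<in> borel_measurable (lebesgue_vec n)"
  using Phi_integrable by (rule borel_measurable_integrable)

text \<open>Otherwise the symmetrised product vanishes identically and with it the density, whose
  total mass is 1.\<close>

lemma ex_Phi_nonzero: "\<exists>a. Phi n \<phi> a \<noteq> 0"
proof (rule ccontr)
  assume "\<nexists>a. Phi n \<phi> a \<noteq> 0"
  then have "phi_det n \<phi> y * vandermonde n y = 0" for y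
    unfolding phi_det_mult_vandermonde by (intro sum.neutral) auto
  then have "phi_det n \<phi> y = 0" for y using phi_det_eq_0 by (metis mult_eq_0_iff)
  then have "nu_density n \<phi> Z y = 0" for y by (simp add: nu_density_eq)
  then show False using density_prob by simp
qed

lemma upd_measurable:
  assumes "y \<in> extensional {1..n}" "k \<in> {1..n}"
  shows "(\<lambda>x. y(k := x)) \<in> measurable lborel (lebesgue_vec n)"
  unfolding lebesgue_vec_def
proof -
  have "(\<lambda>x. y(k := x)) = (\<lambda>x. \<lambda>i\<in>{1..n}. if i = k then x else y i)"
    using assms by (auto simp: fun_eq_iff extensional_def)
  also have "\<dots> \<in> measurable lborel (PiM {1..n} (\<lambda>_. lborel))"
    by (intro measurable_restrict) simp
  finally show "(\<lambda>x. y(k := x)) \<in> measurable lborel (PiM {1..n} (\<lambda>_. lborel))" .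
qed

text \<open>A slice of \<open>\<Phi>\<^sub>n\<close> through a point where it does not vanish is, up to a non-zero polynomial, \<open>\<phi>\<^sub>k\<close>.\<close>

lemma \<phi>_measurable:
  assumes k: "k \<in> {1..n}"
  shows "\<phi> k \<in> borel_measurable borel"
proof -
  obtain a0 where a0: "Phi n \<phi> a0 \<noteq> 0" using ex_Phi_nonzero by blast
  define a where "a = restrict a0 {1..n}"
  have a: "Phi n \<phi> a \<noteq> 0" "a \<in> extensional {1..n}"
    using a0 Phi_cong[of n a a0 \<phi>] by (auto simp: a_def)
  have V: "vandermonde n a \<noteq> 0" and P: "(\<Prod>i\<in>{1..n} - {k}. \<phi> i (a i)) \<noteq> 0"
    using a(1) by (auto simp: Phi_def)
  define g where "g t = (\<Prod>i\<in>{1..n} - {k}. \<phi> i (a i)) * vandermonde n a * (\<Prod>i\<in>{1..n} - {k}. (t - a i) / (a k - a i))" for t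
  have gm: "g \<in> borel_measurable borel" unfolding g_def by measurable
  have gz: "g t \<noteq> 0" if "t \<notin> a ` ({1..n} - {k})" for t
  proof -
    have inj: "inj_on a {1..n}" using V by (simp only: vandermonde_eq_0_iff not_not)
    have "(t - a i) / (a k - a i) \<noteq> 0" if i: "i \<in> {1..n} - {k}" for i
    proof -
      have "a k \<noteq> a i" using inj_onD[OF inj, of k i] i k by auto
      moreover have "t \<noteq> a i" using \<open>t \<notin> a ` ({1..n} - {k})\<close> i by blast
      ultimately show ?thesis by simp
    qed
    then have "(\<Prod>i\<in>{1..n} - {k}. (t - a i) / (a k - a i)) \<noteq> 0" by (simp add: prod_zero_iff)
    with V P show ?thesis unfolding g_def by (simp only: mult_eq_0_iff) simp
  qed
  have slice: "Phi n \<phi> (a(k := t)) = \<phi> k t * g t" for t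
    unfolding g_def by (rule Phi_update[OF k V])
  \<comment> \<open>\<open>g\<close> vanishes only at finitely many points, so the quotient is
    \<open>\<phi> k\<close> off a finite set.\<close>
  have "(\<lambda>t. Phi n \<phi> (a(k := t)) / g t) \<in> borel_measurable borel"
    using measurable_compose[OF upd_measurable[OF a(2) k] Phi_measurable] gm by simp
  then show ?thesis
    by (rule measurable_discrete_difference[where X = "a ` ({1..n} - {k})"])
       (auto simp: slice gz intro: countable_finite)
qed

lemma rows_split: "{1..n} = insert n {1..<n}"
  using n_pos by auto

lemma lebesgue_pattern_split:
  assumes "F \<in> borel_measurable (lebesgue_pattern n)"
  shows "(\<integral>\<^sup>+y. F y \<partial>lebesgue_pattern n) = (\<integral>\<^sup>+y. (\<integral>\<^sup>+x. F (x(n := y)) \<partial>PiM {1..<n} lebesgue_vec) \<partial>lebesgue_vec n)"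
  using lebesgue_rows.product_nn_integral_insert_rev[of "{1..<n}" n F] assms
  unfolding lebesgue_pattern_def rows_split by simp

lemma not_AE_phi_det_zero: "\<not> (AE y in lebesgue_vec n. phi_det n \<phi> y = 0)"
proof
  assume *: "AE y in lebesgue_vec n. phi_det n \<phi> y = 0"
  have "1 = (\<integral>\<^sup>+y. (\<integral>\<^sup>+x. ennreal (nu_density n \<phi> Z (x(n := y))) \<partial>PiM {1..<n} lebesgue_vec) \<partial>lebesgue_vec n)"
    using density_measurable by (subst density_prob[symmetric], intro lebesgue_pattern_split) simp
  also have "\<dots> = (\<integral>\<^sup>+y. 0 \<partial>lebesgue_vec n)"
    by (rule nn_integral_cong_AE) (use * in \<open>eventually_elim, simp add: nu_density_eq\<close>)
  finally show False by simp
qed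

lemma not_AE_Phi_zero: "\<not> (AE y in lebesgue_vec n. Phi n \<phi> y = 0)"
proof
  assume *: "AE y in lebesgue_vec n. Phi n \<phi> y = 0"
  have "AE y in lebesgue_vec n. \<forall>\<sigma>\<in>{\<sigma>. \<sigma> permutes {1..n}}. Phi n \<phi> (\<lambda>i\<in>{1..n}. y (\<sigma> i)) = 0"
  proof (intro AE_finite_allI)
    show "finite {\<sigma>. \<sigma> permutes {1..n}}" by (simp add: finite_permutations)
    fix \<sigma> assume "\<sigma> \<in> {\<sigma>. \<sigma> permutes {1..n}}"
    then have \<sigma>: "bij_betw \<sigma> {1..n} {1..n}" by (auto intro: permutes_imp_bij)
    show "AE y in lebesgue_vec n. Phi n \<phi> (\<lambda>i\<in>{1..n}. y (\<sigma> i)) = 0"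
      by (rule AE_lebesgue_vec_permute[OF \<sigma> *])
  qed
  then have "AE y in lebesgue_vec n. phi_det n \<phi> y = 0"
  proof eventually_elim
    fix y assume "\<forall>\<sigma>\<in>{\<sigma>. \<sigma> permutes {1..n}}. Phi n \<phi> (\<lambda>i\<in>{1..n}. y (\<sigma> i)) = 0"
    then have "phi_det n \<phi> y * vandermonde n y = 0" by (simp add: phi_det_mult_vandermonde)
    then show "phi_det n \<phi> y = 0" using phi_det_eq_0 by auto
  qed
  then show False using not_AE_phi_det_zero by simp
qed

text \<open>
  Almost every slice of \<open>\<Phi>\<^sub>n\<close> in the \<open>k\<close>-th variable is integrable and is \<open>\<phi>\<^sub>k\<close> times a polynomial of
  degree \<open>n - 1\<close>; two slices whose polynomials have no common root control \<open>\<phi>\<^sub>k(x) (1 + |x|)\<^sup>n\<^sup>-\<^sup>1\<close>.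
\<close>

lemma \<phi>_moment:
  assumes k: "k \<in> {1..n}"
  shows "integrable lborel (\<lambda>x. \<phi> k x * (1 + \<bar>x\<bar>) ^ (n - 1))"
proof -
  let ?J = "{1..n} - {k}"
  let ?M = "PiM ?J (\<lambda>_. lborel :: real measure)"
  have ins: "{1..n} = insert k ?J" using k by auto
  have lv: "lebesgue_vec n = PiM (insert k ?J) (\<lambda>_. lborel)"
    unfolding lebesgue_vec_def by (rule arg_cong[OF ins])
  define good where "good p \<longleftrightarrow> integrable lborel (\<lambda>x. Phi n \<phi> (p(k := x))) \<and> (\<exists>x. Phi n \<phi> (p(k := x)) \<noteq> 0)" for p
  have upd: "(\<lambda>x. Phi n \<phi> (p(k := x))) \<in> borel_measurable lborel" if "p \<in> space ?M" for p
  proof -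
    have "p \<in> extensional {1..n}" using that by (auto simp: space_PiM PiE_iff extensional_def)
    from measurable_compose[OF upd_measurable[OF this k] Phi_measurable] show ?thesis .
  qed
  have nnm: "(\<lambda>y. ennreal (norm (Phi n \<phi> y))) \<in> borel_measurable (PiM (insert k ?J) (\<lambda>_. lborel))"
    using Phi_measurable unfolding lv by measurable
  have iter: "(\<integral>\<^sup>+y. ennreal (norm (Phi n \<phi> y)) \<partial>lebesgue_vec n) = (\<integral>\<^sup>+p. (\<integral>\<^sup>+x. ennreal (norm (Phi n \<phi> (p(k := x)))) \<partial>lborel) \<partial>?M)"
    unfolding lv by (rule lborel_prod.product_nn_integral_insert) (use nnm in auto)
  have inner_meas: "(\<lambda>p. \<integral>\<^sup>+x. ennreal (norm (Phi n \<phi> (p(k := x)))) \<partial>lborel) \<in> borel_measurable ?M"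
  proof (rule lborel.borel_measurable_nn_integral)
    have "(\<lambda>z. (fst z)(k := snd z)) \<in> measurable (?M \<Otimes>\<^sub>M lborel) (PiM (insert k ?J) (\<lambda>_. lborel))"
      by (rule measurable_fun_upd[where J = ?J]) auto
    from measurable_compose[OF this nnm]
    show "(\<lambda>(p, x). ennreal (norm (Phi n \<phi> (p(k := x))))) \<in> borel_measurable (?M \<Otimes>\<^sub>M lborel)"
      unfolding case_prod_beta .
  qed
  have fin: "(\<integral>\<^sup>+y. ennreal (norm (Phi n \<phi> y)) \<partial>lebesgue_vec n) < \<infinity>"
    using Phi_integrable by (simp add: integrable_iff_bounded)
  have "AE p in ?M. (\<integral>\<^sup>+x. ennreal (norm (Phi n \<phi> (p(k := x)))) \<partial>lborel) \<noteq> \<infinity>"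
    by (rule nn_integral_PInf_AE[OF inner_meas]) (use fin iter in auto)
  then have AEint: "AE p in ?M. integrable lborel (\<lambda>x. Phi n \<phi> (p(k := x)))"
    using AE_space by eventually_elim (use upd in \<open>auto simp: integrable_iff_bounded less_top\<close>)
  have notAE: "\<not> (AE p in ?M. \<forall>x. Phi n \<phi> (p(k := x)) = 0)"
  proof
    assume "AE p in ?M. \<forall>x. Phi n \<phi> (p(k := x)) = 0"
    then have "AE p in ?M. (\<integral>\<^sup>+x. ennreal (norm (Phi n \<phi> (p(k := x)))) \<partial>lborel) = 0"
      by eventually_elim simp
    then have "(\<integral>\<^sup>+p. (\<integral>\<^sup>+x. ennreal (norm (Phi n \<phi> (p(k := x)))) \<partial>lborel) \<partial>?M) = (\<integral>\<^sup>+p. 0 \<partial>?M)"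
      by (rule nn_integral_cong_AE)
    then have "(\<integral>\<^sup>+y. ennreal (norm (Phi n \<phi> y)) \<partial>lebesgue_vec n) = 0" using iter by simp
    then have "AE y in lebesgue_vec n. ennreal (norm (Phi n \<phi> y)) = 0"
      using nnm unfolding lv by (subst (asm) nn_integral_0_iff_AE) auto
    then have "AE y in lebesgue_vec n. Phi n \<phi> y = 0" by eventually_elim simp
    then show False using not_AE_Phi_zero by simp
  qed
  \<comment> \<open>Almost all slices are integrable and not almost all are identically zero, so any
    almost sure property is shared by some good slice.\<close>
  have ex_good: "\<exists>p\<in>space ?M. good p \<and> Q p" if Q: "AE p in ?M. Q p" for Q
  proof (rule ccontr)
    assume neg: "\<not> (\<exists>p\<in>space ?M. good p \<and> Q p)"
    have "AE p in ?M. \<forall>x. Phi n \<phi> (p(k := x)) = 0"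
      using AEint Q AE_space by eventually_elim (use neg in \<open>auto simp: good_def\<close>)
    then show False using notAE by simp
  qed
  obtain p where p: "p \<in> space ?M" "good p" using ex_good[of "\<lambda>_. True"] by auto
  \<comment> \<open>The second slice avoids the coordinates of the first, so that the two
    polynomials have no common root.\<close>
  have "AE q in ?M. \<forall>i\<in>?J. q i \<notin> p ` ?J"
  proof (rule AE_finite_allI)
    fix i assume i: "i \<in> ?J"
    have "AE x in lborel. x \<notin> p ` ?J" by (rule AE_not_in_finite_lborel) simp
    then show "AE q in ?M. q i \<notin> p ` ?J" by (intro AE_PiM_lborel_component[OF i]) auto
  qed simp
  from ex_good[OF this] obtain q where q: "q \<in> space ?M" "good q" "\<forall>i\<in>?J. q i \<notin> p ` ?J" by auto
  define poly where "poly r x = (\<Prod>i\<in>?J. x - r i)" for r :: "nat \<Rightarrow> real" and x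
  have int_poly: "integrable lborel (\<lambda>x. \<phi> k x * poly r x)" if r: "good r" for r
  proof -
    obtain x0 where x0: "Phi n \<phi> (r(k := x0)) \<noteq> 0" using r by (auto simp: good_def)
    define z where "z = r(k := x0)"
    have z: "Phi n \<phi> z \<noteq> 0" unfolding z_def by (rule x0)
    then have V: "vandermonde n z \<noteq> 0" and P: "(\<Prod>i\<in>{1..n}. \<phi> i (z i)) \<noteq> 0" by (auto simp: Phi_def)
    have inj: "inj_on z {1..n}" using V by (simp only: vandermonde_eq_0_iff not_not)
    define c where "c = (\<Prod>i\<in>?J. \<phi> i (z i)) * vandermonde n z * (\<Prod>i\<in>?J. inverse (z k - z i))"
    have "inverse (z k - z i) \<noteq> 0" if "i \<in> ?J" for i
      using inj_onD[OF inj, of k i] that k by auto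
    then have "(\<Prod>i\<in>?J. inverse (z k - z i)) \<noteq> 0" by (simp add: prod_zero_iff)
    moreover have "(\<Prod>i\<in>?J. \<phi> i (z i)) \<noteq> 0" using P by (simp add: prod_zero_iff)
    ultimately have c: "c \<noteq> 0" using V unfolding c_def by (simp only: mult_eq_0_iff) simp
    have "Phi n \<phi> (r(k := x)) = c * (\<phi> k x * poly r x)" for x
    proof -
      have "Phi n \<phi> (r(k := x)) = Phi n \<phi> (z(k := x))" by (simp add: z_def)
      also have "\<dots> = \<phi> k x * ((\<Prod>i\<in>?J. \<phi> i (z i)) * vandermonde n z * (\<Prod>i\<in>?J. (x - z i) / (z k - z i)))"
        by (rule Phi_update[OF k V])
      also have "(\<Prod>i\<in>?J. (x - z i) / (z k - z i)) = poly r x * (\<Prod>i\<in>?J. inverse (z k - z i))"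
        unfolding poly_def prod.distrib[symmetric] by (intro prod.cong) (auto simp: divide_inverse z_def)
      finally show ?thesis unfolding c_def by (simp only: mult_ac)
    qed
    then have "integrable lborel (\<lambda>x. c * (\<phi> k x * poly r x))" using r by (simp only: good_def)
    then have "integrable lborel (\<lambda>x. inverse c * (c * (\<phi> k x * poly r x)))" by (rule integrable_mult_right)
    moreover have "inverse c * (c * z) = z" for z using c by (simp add: mult.assoc[symmetric])
    ultimately show ?thesis by (simp only:)
  qed
  obtain d where d: "d > 0" "d \<le> 1" "\<And>i j. i \<in> ?J \<Longrightarrow> j \<in> ?J \<Longrightarrow> 2 * d \<le> \<bar>p i - q j\<bar>"
  proof -
    \<comment> \<open>\<open>d\<close> is half the minimum, so no \<open>x\<close> is closer than
      \<open>d\<close> to roots of both polynomials. The element 2 keeps the set non-empty for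
      \<open>n = 1\<close> and ensures \<open>d \<le> 1\<close>.\<close>
    let ?D = "insert 2 ((\<lambda>(i, j). \<bar>p i - q j\<bar>) ` (?J \<times> ?J))"
    have fD: "finite ?D" by simp
    have "0 < x" if x: "x \<in> ?D" for x
    proof (cases "x = 2")
      case False
      have "x \<in> (\<lambda>(i, j). \<bar>p i - q j\<bar>) ` (?J \<times> ?J)"
        using False x by (elim insertE) (erule(1) notE, assumption)
      then obtain i j where ij: "i \<in> ?J" "j \<in> ?J" "x = \<bar>p i - q j\<bar>"
        by (elim imageE SigmaE) simp
      then have "q j \<noteq> p i" using q(3) by blast
      then show ?thesis by (simp add: ij(3))
    qed simp
    then have pos: "0 < Min ?D" by (rule Min_gr_iff[THEN iffD2, OF fD insert_not_empty, rule_format])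
    have two: "Min ?D \<le> 2" by (rule Min_le[OF fD insertI1])
    have le: "Min ?D \<le> \<bar>p i - q j\<bar>" if "i \<in> ?J" "j \<in> ?J" for i j
      using that by (intro Min_le[OF fD] insertI2 image_eqI[of _ _ "(i, j)"]) simp_all
    show thesis
    proof (rule that[of "Min ?D / 2"])
      show "0 < Min ?D / 2" "Min ?D / 2 \<le> 1" using pos two by linarith+
      show "2 * (Min ?D / 2) \<le> \<bar>p i - q j\<bar>" if "i \<in> ?J" "j \<in> ?J" for i j
        using le[OF that] by linarith
    qed
  qed
  obtain R where R: "R \<ge> 1" "\<And>i. i \<in> ?J \<Longrightarrow> \<bar>p i\<bar> \<le> R" "\<And>i. i \<in> ?J \<Longrightarrow> \<bar>q i\<bar> \<le> R"
  proof -
    let ?D = "insert 1 ((\<lambda>i. \<bar>p i\<bar>) ` ?J \<union> (\<lambda>i. \<bar>q i\<bar>) ` ?J)"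
    have fD: "finite ?D" by simp
    show thesis
    proof (rule that[of "Max ?D"])
      show "1 \<le> Max ?D" by (rule Max_ge[OF fD insertI1])
      show "\<bar>p i\<bar> \<le> Max ?D" "\<bar>q i\<bar> \<le> Max ?D" if "i \<in> ?J" for i
        using that by (intro Max_ge[OF fD] insertI2 UnI1 UnI2 imageI; assumption)+
    qed
  qed
  \<comment> \<open>If \<open>x\<close> has distance at least \<open>d\<close> from
    \<open>r i\<close>, then \<open>1 + \<bar>x\<bar> \<le> 1 + R + \<bar>x - r i\<bar> \<le> ((1 +
    R) / d + 1) * \<bar>x - r i\<bar>\<close>, and \<open>d \<le> 1\<close> bounds the factor by
    \<open>(2 + R) / d\<close>.\<close>
  define C where "C = (2 + R) / d"
  have far: "(1 + \<bar>x\<bar>) ^ (n - 1) \<le> C ^ (n - 1) * \<bar>poly r x\<bar>"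
    if r: "\<And>i. i \<in> ?J \<Longrightarrow> d \<le> \<bar>x - r i\<bar>" "\<And>i. i \<in> ?J \<Longrightarrow> \<bar>r i\<bar> \<le> R" for r x
  proof -
    have "1 + \<bar>x\<bar> \<le> C * \<bar>x - r i\<bar>" if i: "i \<in> ?J" for i
    proof -
      have "d * (1 + \<bar>x\<bar>) \<le> d * (1 + R + \<bar>x - r i\<bar>)"
        using r(2)[OF i] d by (intro mult_left_mono) auto
      also have "\<dots> = d * (1 + R) + d * \<bar>x - r i\<bar>" by (simp add: algebra_simps)
      also have "\<dots> \<le> \<bar>x - r i\<bar> * (1 + R) + 1 * \<bar>x - r i\<bar>"
        using r(1)[OF i] d R by (intro add_mono mult_right_mono) auto
      also have "\<dots> = (2 + R) * \<bar>x - r i\<bar>" by (simp add: algebra_simps)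
      finally show ?thesis using d by (simp add: C_def field_simps)
    qed
    then have "(\<Prod>i\<in>?J. 1 + \<bar>x\<bar>) \<le> (\<Prod>i\<in>?J. C * \<bar>x - r i\<bar>)" by (intro prod_mono) auto
    then show ?thesis using k by (simp add: prod.distrib poly_def abs_prod)
  qed
  have dich: "(\<forall>i\<in>?J. d \<le> \<bar>x - p i\<bar>) \<or> (\<forall>i\<in>?J. d \<le> \<bar>x - q i\<bar>)" for x
  proof (rule ccontr)
    assume "\<not> ?thesis"
    then obtain i j where ij: "i \<in> ?J" "j \<in> ?J" "\<not> d \<le> \<bar>x - p i\<bar>" "\<not> d \<le> \<bar>x - q j\<bar>" by blast
    then show False using d(3)[OF ij(1,2)] by linarith
  qed
  have C0: "C \<ge> 0" using d R by (simp add: C_def)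
  have "integrable lborel (\<lambda>x. C ^ (n - 1) * (\<bar>\<phi> k x * poly p x\<bar> + \<bar>\<phi> k x * poly q x\<bar>))"
    by (intro integrable_mult_right Bochner_Integration.integrable_add integrable_abs int_poly p q)
  then show ?thesis
  proof (rule Bochner_Integration.integrable_bound)
    show "(\<lambda>x. \<phi> k x * (1 + \<bar>x\<bar>) ^ (n - 1)) \<in> borel_measurable lborel"
      using \<phi>_measurable[OF k] by measurable
    have "\<bar>\<phi> k x * (1 + \<bar>x\<bar>) ^ (n - 1)\<bar> \<le> C ^ (n - 1) * (\<bar>\<phi> k x * poly p x\<bar> + \<bar>\<phi> k x * poly q x\<bar>)" for x
    proof -
      have "(1 + \<bar>x\<bar>) ^ (n - 1) \<le> C ^ (n - 1) * \<bar>poly p x\<bar> \<or> (1 + \<bar>x\<bar>) ^ (n - 1) \<le> C ^ (n - 1) * \<bar>poly q x\<bar>"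
        using dich[of x] far[of x p] far[of x q] R by auto
      moreover have "0 \<le> C ^ (n - 1) * \<bar>poly p x\<bar>" "0 \<le> C ^ (n - 1) * \<bar>poly q x\<bar>" using C0 by auto
      ultimately have "(1 + \<bar>x\<bar>) ^ (n - 1) \<le> C ^ (n - 1) * \<bar>poly p x\<bar> + C ^ (n - 1) * \<bar>poly q x\<bar>" by linarith
      then have "\<bar>\<phi> k x\<bar> * (1 + \<bar>x\<bar>) ^ (n - 1) \<le> \<bar>\<phi> k x\<bar> * (C ^ (n - 1) * \<bar>poly p x\<bar> + C ^ (n - 1) * \<bar>poly q x\<bar>)"
        by (rule mult_left_mono) simp
      then show ?thesis by (simp add: abs_mult algebra_simps)
    qed
    then show "AE x in lborel. norm (\<phi> k x * (1 + \<bar>x\<bar>) ^ (n - 1)) \<le> norm (C ^ (n - 1) * (\<bar>\<phi> k x * poly p x\<bar> + \<bar>\<phi> k x * poly q x\<bar>))"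
      by (auto intro!: AE_I2 order_trans[OF _ abs_ge_self])
  qed
qed

end

section \<open>Positivity of the density on the top row\<close>

lemma ex_sorting_permutation:
  fixes y :: "nat \<Rightarrow> real"
  assumes inj: "inj_on y {1..n}"
  shows "\<exists>\<sigma>. \<sigma> permutes {1..n} \<and> (\<forall>i j. 1 \<le> i \<longrightarrow> i < j \<longrightarrow> j \<le> n \<longrightarrow> y (\<sigma> j) < y (\<sigma> i))"
proof -
  define rk where "rk a = Suc (card {b\<in>{1..n}. y a < y b})" for a
  have rk: "bij_betw rk {1..n} {1..n}"
    using rank_bij(1)[OF _ inj] unfolding rk_def by simp
  have rkl: "rk a < rk b \<longleftrightarrow> y b < y a" if "a \<in> {1..n}" "b \<in> {1..n}" for a b
    unfolding rk_def by (rule rank_bij(2)[OF _ inj that]) simp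
  define \<sigma> where "\<sigma> i = (if i \<in> {1..n} then inv_into {1..n} rk i else i)" for i
  have "bij_betw (inv_into {1..n} rk) {1..n} {1..n}" by (rule bij_betw_inv_into[OF rk])
  then have "bij_betw \<sigma> {1..n} {1..n}" by (rule bij_betw_cong[THEN iffD1, rotated]) (simp add: \<sigma>_def)
  then have \<sigma>: "\<sigma> permutes {1..n}" by (rule bij_imp_permutes) (simp only: \<sigma>_def if_False)
  have rs: "\<sigma> i \<in> {1..n} \<and> rk (\<sigma> i) = i" if "i \<in> {1..n}" for i
    using that bij_betwE[OF bij_betw_inv_into[OF rk]] bij_betw_inv_into_right[OF rk that] by (simp add: \<sigma>_def)
  have "y (\<sigma> j) < y (\<sigma> i)" if ij: "1 \<le> i" "i < j" "j \<le> n" for i j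
  proof -
    have "i \<in> {1..n}" "j \<in> {1..n}" using ij by auto
    then show ?thesis using rkl[of "\<sigma> i" "\<sigma> j"] rs[of i] rs[of j] ij by simp
  qed
  with \<sigma> show ?thesis by blast
qed

context gt_weights
begin

text \<open>
  Over a strictly decreasing \<open>y\<close> the patterns near \<open>y\<^sub>i - (n - r) \<delta>\<close> interlace when \<open>\<delta>\<close> is smaller
  than all gaps of \<open>y\<close>; hence the sign of the density determines the sign of \<open>det [\<phi>\<^sub>j(y\<^sub>i)]\<close>.
\<close>

lemma GT_closed_box:
  assumes y: "y \<in> {1..n} \<rightarrow>\<^sub>E UNIV" and dec: "\<And>i j. 1 \<le> i \<Longrightarrow> i < j \<Longrightarrow> j \<le> n \<Longrightarrow> 3 * \<delta> < y i - y j" and \<delta>: "0 < \<delta>"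
    and x: "x \<in> (\<Pi>\<^sub>E r\<in>{1..<n}. \<Pi>\<^sub>E i\<in>{1..r}. {y i - real (n - r) * \<delta> - \<delta> / 3<..<y i - real (n - r) * \<delta> + \<delta> / 3})"
  shows "x(n := y) \<in> GT_closed n"
proof -
  let ?z = "x(n := y)"
  have near: "y i - real (n - r) * \<delta> - \<delta> / 3 < ?z r i \<and> ?z r i < y i - real (n - r) * \<delta> + \<delta> / 3"
    if "1 \<le> i" "i \<le> r" "r \<le> n" for r i
  proof (cases "r = n")
    case False
    then have "x r \<in> (\<Pi>\<^sub>E i\<in>{1..r}. {y i - real (n - r) * \<delta> - \<delta> / 3<..<y i - real (n - r) * \<delta> + \<delta> / 3})"
      using PiE_mem[OF x, of r] that by auto
    from PiE_mem[OF this, of i] show ?thesis using False that by auto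
  qed (use \<delta> in auto)
  have ext: "?z r \<in> {1..r} \<rightarrow>\<^sub>E UNIV" if "r \<in> {1..n}" for r
  proof (cases "r = n")
    case False
    then show ?thesis using PiE_mem[OF x, of r] that by (auto simp: PiE_iff)
  qed (use y in simp)
  have row: "?z r j \<le> ?z r i" if "1 \<le> i" "i < j" "j \<le> r" "r \<le> n" for r i j
    using near[of i r] near[of j r] dec[of i j] that \<delta> by auto
  have "?z \<in> (\<Pi>\<^sub>E r\<in>{1..n}. weyl_chamber_closure r)"
  proof (rule PiE_I)
    fix r assume r: "r \<in> {1..n}"
    show "?z r \<in> weyl_chamber_closure r"
      unfolding weyl_chamber_closure_eq using ext[OF r] row r by auto
  next
    fix r assume "r \<notin> {1..n}"
    then have "r \<notin> {1..<n}" "r \<noteq> n" using n_pos by auto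
    then show "?z r = undefined" using PiE_arb[OF x] by simp
  qed
  moreover have "?z (r + 1) i \<ge> ?z r i \<and> ?z r i \<ge> ?z (r + 1) (i + 1)" if "1 \<le> i" "i \<le> r" "r \<le> n - 1" for i r
  proof -
    have e: "real (n - r) * \<delta> = real (n - (r + 1)) * \<delta> + \<delta>"
    proof -
      have "n - r = Suc (n - (r + 1))" using that n_pos by auto
      then show ?thesis by (simp add: algebra_simps)
    qed
    have "i + 1 \<le> n" "r + 1 \<le> n" using that n_pos by auto
    \<comment> \<open>Consecutive rows are shifted by \<open>\<delta>\<close>, more than two radii
      \<open>\<delta> / 3\<close> together, and the gaps of \<open>y\<close> exceed the shift plus
      two radii.\<close>
    then show ?thesis
      using near[of i r] near[of i "r + 1"] near[of "i + 1" "r + 1"] dec[of i "i + 1"] that \<delta> e by auto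
  qed
  ultimately show ?thesis by (auto simp: GT_closed_def)
qed

text \<open>By Fubini almost every fibre carries negative density only on a null set, whereas a
  decreasing \<open>y\<close> with negative determinant would give a whole box of positive
  volume.\<close>

lemma phi_det_nonneg:
  "AE y in lebesgue_vec n. (\<forall>i j. 1 \<le> i \<and> i < j \<and> j \<le> n \<longrightarrow> y j < y i) \<longrightarrow> 0 \<le> phi_det n \<phi> y"
proof -
  let ?M = "PiM {1..<n} lebesgue_vec"
  define F where "F z = (indicator {z \<in> space (lebesgue_pattern n). nu_density n \<phi> Z z < 0} z :: ennreal)" for z
  have m: "{z \<in> space (lebesgue_pattern n). nu_density n \<phi> Z z < 0} \<in> sets (lebesgue_pattern n)"
    using density_measurable by measurable
  have F[measurable]: "F \<in> borel_measurable (lebesgue_pattern n)" unfolding F_def using m by simp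
  have lp: "lebesgue_pattern n = PiM (insert n {1..<n}) lebesgue_vec"
    unfolding lebesgue_pattern_def by (rule arg_cong[OF rows_split])
  have "(\<integral>\<^sup>+z. F z \<partial>lebesgue_pattern n) = 0"
    by (subst nn_integral_0_iff_AE[OF F]) (use density_nonneg in \<open>eventually_elim, auto simp: F_def\<close>)
  then have 0: "(\<integral>\<^sup>+y. (\<integral>\<^sup>+x. F (x(n := y)) \<partial>?M) \<partial>lebesgue_vec n) = 0"
    by (simp only: lebesgue_pattern_split[OF F])
  have upd: "(\<lambda>z. (snd z)(n := fst z)) \<in> measurable (lebesgue_vec n \<Otimes>\<^sub>M ?M) (lebesgue_pattern n)"
    unfolding lp by (rule measurable_fun_upd[where J = "{1..<n}"]) auto
  interpret M: sigma_finite_measure ?M by (rule lebesgue_rows.sigma_finite) simp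
  have "(\<lambda>y. \<integral>\<^sup>+x. F (x(n := y)) \<partial>?M) \<in> borel_measurable (lebesgue_vec n)"
  proof (rule M.borel_measurable_nn_integral)
    from measurable_compose[OF upd F]
    show "(\<lambda>(y, x). F (x(n := y))) \<in> borel_measurable (lebesgue_vec n \<Otimes>\<^sub>M ?M)"
      unfolding case_prod_beta .
  qed
  then have "AE y in lebesgue_vec n. (\<integral>\<^sup>+x. F (x(n := y)) \<partial>?M) = 0"
    using 0 by (subst (asm) nn_integral_0_iff_AE)
  with AE_space show ?thesis
  proof eventually_elim
    fix y assume ysp: "y \<in> space (lebesgue_vec n)" and 0: "(\<integral>\<^sup>+x. F (x(n := y)) \<partial>?M) = 0"
    have y: "y \<in> {1..n} \<rightarrow>\<^sub>E UNIV" using ysp by (simp add: lebesgue_vec_def space_PiM)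
    show "(\<forall>i j. 1 \<le> i \<and> i < j \<and> j \<le> n \<longrightarrow> y j < y i) \<longrightarrow> 0 \<le> phi_det n \<phi> y"
    proof (rule impI, rule ccontr)
      assume dec: "\<forall>i j. 1 \<le> i \<and> i < j \<and> j \<le> n \<longrightarrow> y j < y i" and neg: "\<not> 0 \<le> phi_det n \<phi> y"
      obtain \<delta> where \<delta>: "0 < \<delta>" "\<And>i j. 1 \<le> i \<Longrightarrow> i < j \<Longrightarrow> j \<le> n \<Longrightarrow> 3 * \<delta> < y i - y j"
      proof -
        let ?T = "{(i, j). 1 \<le> i \<and> i < j \<and> j \<le> n}"
        let ?D = "insert 1 ((\<lambda>(i, j). y i - y j) ` ?T)"
        have fT: "finite ?T" by (rule finite_subset[of _ "{1..n} \<times> {1..n}"]) auto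
        then have fD: "finite ?D" by simp
        have "0 < d" if "d \<in> ?D" for d
        proof (cases "d = 1")
          case False
          have "d \<in> (\<lambda>(i, j). y i - y j) ` ?T"
            using False that by (elim insertE) (erule(1) notE, assumption)
          then obtain i j where "1 \<le> i" "i < j" "j \<le> n" "d = y i - y j"
            by (elim imageE) auto
          then show ?thesis using dec by simp
        qed simp
        then have pos: "0 < Min ?D" by (rule Min_gr_iff[THEN iffD2, OF fD insert_not_empty, rule_format])
        show thesis
        proof (rule that[of "Min ?D / 4"])
          show "0 < Min ?D / 4" using pos by simp
          fix i j assume "1 \<le> i" "i < j" "j \<le> n"
          then have "Min ?D \<le> y i - y j"
            by (intro Min_le[OF fD] insertI2 image_eqI[of _ _ "(i, j)"]) simp_all
          then show "3 * (Min ?D / 4) < y i - y j" using pos by linarith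
        qed
      qed
      let ?iv = "\<lambda>r i. {y i - real (n - r) * \<delta> - \<delta> / 3<..<y i - real (n - r) * \<delta> + \<delta> / 3}"
      let ?box = "PiE {1..<n} (\<lambda>r. PiE {1..r} (?iv r))"
      have rbox: "PiE {1..r} (?iv r) \<in> sets (lebesgue_vec r)" for r
        unfolding lebesgue_vec_def by (intro sets_PiM_I_finite) auto
      have "emeasure ?M ?box = (\<Prod>r\<in>{1..<n}. emeasure (lebesgue_vec r) (PiE {1..r} (?iv r)))"
        by (rule lebesgue_rows.emeasure_PiM) (simp, rule rbox)
      also have "\<dots> = (\<Prod>r\<in>{1..<n}. \<Prod>i\<in>{1..r}. emeasure lborel (?iv r i))"
        unfolding lebesgue_vec_def by (intro prod.cong refl lborel_prod.emeasure_PiM) auto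
      also have "\<dots> = (\<Prod>r\<in>{1..<n}. \<Prod>i\<in>{1..r}. ennreal (2 * \<delta> / 3))"
        by (intro prod.cong refl) (use \<delta> in \<open>simp add: field_simps\<close>)
      also have "\<dots> \<noteq> 0" using \<delta>(1) by (simp add: prod_zero_iff ennreal_eq_0_iff)
      finally have vol: "emeasure ?M ?box \<noteq> 0" .
      have box: "?box \<in> sets ?M" by (intro sets_PiM_I_finite rbox) auto
      have "emeasure ?M ?box = (\<integral>\<^sup>+x. indicator ?box x \<partial>?M)" using box by simp
      also have "\<dots> \<le> (\<integral>\<^sup>+x. F (x(n := y)) \<partial>?M)"
      proof (rule nn_integral_mono)
        fix x
        show "indicator ?box x \<le> F (x(n := y))"
        proof (cases "x \<in> ?box")
          case True
          have gt: "x(n := y) \<in> GT_closed n" by (rule GT_closed_box[OF y \<delta>(2,1) True]) auto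
          have "x(n := y) \<in> space (lebesgue_pattern n)"
          proof -
            have "x \<in> space ?M" using True sets.sets_into_space[OF box] by auto
            then show ?thesis using ysp unfolding lp by (auto simp: space_PiM PiE_iff extensional_def)
          qed
          moreover have "nu_density n \<phi> Z (x(n := y)) < 0"
            using gt neg Z_pos by (simp add: nu_density_eq divide_neg_pos)
          ultimately have "F (x(n := y)) = 1" by (simp add: F_def)
          then show ?thesis by (simp only: indicator_simps(1)[OF True] order_refl)
        qed simp
      qed
      finally show False using 0 vol by simp
    qed
  qed
qed

text \<open>Both factors change by the same sign when coordinates are permuted, so it suffices to
  look at the decreasing rearrangement, where both are non-negative.\<close>

lemma AE_phi_det_vandermonde_nonneg: "AE y in lebesgue_vec n. 0 \<le> phi_det n \<phi> y * vandermonde n y"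
proof -
  let ?P = "{\<sigma>. \<sigma> permutes {1..n}}"
  let ?dec = "\<lambda>y :: nat \<Rightarrow> real. \<forall>i j. 1 \<le> i \<and> i < j \<and> j \<le> n \<longrightarrow> y j < y i"
  have "AE y in lebesgue_vec n. \<forall>\<sigma>\<in>?P. ?dec (\<lambda>i\<in>{1..n}. y (\<sigma> i)) \<longrightarrow> 0 \<le> phi_det n \<phi> (\<lambda>i\<in>{1..n}. y (\<sigma> i))"
  proof (intro AE_finite_allI)
    show "finite ?P" by (simp add: finite_permutations)
    fix \<sigma> assume "\<sigma> \<in> ?P"
    then have "bij_betw \<sigma> {1..n} {1..n}" by (auto intro: permutes_imp_bij)
    from AE_lebesgue_vec_permute[OF this phi_det_nonneg]
    show "AE y in lebesgue_vec n. ?dec (\<lambda>i\<in>{1..n}. y (\<sigma> i)) \<longrightarrow> 0 \<le> phi_det n \<phi> (\<lambda>i\<in>{1..n}. y (\<sigma> i))" .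
  qed
  moreover have "AE y in lebesgue_vec n. inj_on y {1..n}"
    unfolding lebesgue_vec_def by (rule AE_inj_on_PiM_lborel) simp
  ultimately show ?thesis
  proof eventually_elim
    fix y assume *: "\<forall>\<sigma>\<in>?P. ?dec (\<lambda>i\<in>{1..n}. y (\<sigma> i)) \<longrightarrow> 0 \<le> phi_det n \<phi> (\<lambda>i\<in>{1..n}. y (\<sigma> i))"
      and inj: "inj_on y {1..n}"
    obtain \<sigma> where \<sigma>: "\<sigma> permutes {1..n}"
        and less: "\<And>i j. 1 \<le> i \<Longrightarrow> i < j \<Longrightarrow> j \<le> n \<Longrightarrow> y (\<sigma> j) < y (\<sigma> i)"
      using ex_sorting_permutation[OF inj] by blast
    have dec: "?dec (\<lambda>i\<in>{1..n}. y (\<sigma> i))" using less by simp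
    have "0 \<le> phi_det n \<phi> (\<lambda>i\<in>{1..n}. y (\<sigma> i))" using * \<sigma> dec by blast
    moreover have "0 \<le> vandermonde n (\<lambda>i\<in>{1..n}. y (\<sigma> i))"
      unfolding vandermonde_def
    proof (intro prod_nonneg ballI)
      fix i j assume "i \<in> {1..n}" "j \<in> {i<..n}"
      then have "1 \<le> i \<and> i < j \<and> j \<le> n" by auto
      then show "0 \<le> (\<lambda>i\<in>{1..n}. y (\<sigma> i)) i - (\<lambda>i\<in>{1..n}. y (\<sigma> i)) j" using dec by (metis diff_ge_0_iff_ge less_imp_le)
    qed
    ultimately show "0 \<le> phi_det n \<phi> y * vandermonde n y"
      using phi_det_vandermonde_symmetric[OF \<sigma>, of \<phi> y] by (metis mult_nonneg_nonneg)
  qed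
qed

lemma integral_Phi_permute:
  assumes "\<sigma> permutes {1..n}"
  shows "integrable (lebesgue_vec n) (\<lambda>y. Phi n \<phi> (\<lambda>i\<in>{1..n}. y (\<sigma> i)))"
    and "(\<integral>y. Phi n \<phi> (\<lambda>i\<in>{1..n}. y (\<sigma> i)) \<partial>lebesgue_vec n) = B_const n \<phi>"
proof -
  have \<sigma>: "bij_betw \<sigma> {1..n} {1..n}" using assms by (rule permutes_imp_bij)
  have m: "(\<lambda>y. \<lambda>i\<in>{1..n}. y (\<sigma> i)) \<in> measurable (lebesgue_vec n) (lebesgue_vec n)"
    unfolding lebesgue_vec_def
    by (intro measurable_restrict measurable_component_singleton) (use \<sigma> in \<open>auto simp: bij_betw_def\<close>)
  have d: "distr (lebesgue_vec n) (lebesgue_vec n) (\<lambda>y. \<lambda>i\<in>{1..n}. y (\<sigma> i)) = lebesgue_vec n"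
    unfolding lebesgue_vec_def by (rule distr_PiM_lborel_reindex[OF \<sigma> finite_atLeastAtMost])
  show "integrable (lebesgue_vec n) (\<lambda>y. Phi n \<phi> (\<lambda>i\<in>{1..n}. y (\<sigma> i)))"
    using Phi_integrable by (simp only: integrable_distr_eq[OF m Phi_measurable, unfolded d])
  show "(\<integral>y. Phi n \<phi> (\<lambda>i\<in>{1..n}. y (\<sigma> i)) \<partial>lebesgue_vec n) = B_const n \<phi>"
    unfolding B_const_def by (rule integral_distr[OF m Phi_measurable, unfolded d, symmetric])
qed

lemma B_const_nonzero: "B_const n \<phi> \<noteq> 0"
proof
  assume B: "B_const n \<phi> = 0"
  let ?F = "\<lambda>y. phi_det n \<phi> y * vandermonde n y"
  have int: "integrable (lebesgue_vec n) ?F"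
    unfolding phi_det_mult_vandermonde by (intro Bochner_Integration.integrable_sum integral_Phi_permute) simp
  have "(\<integral>y. ?F y \<partial>lebesgue_vec n) =
      (\<Sum>\<sigma> | \<sigma> permutes {1..n}. \<integral>y. Phi n \<phi> (\<lambda>i\<in>{1..n}. y (\<sigma> i)) \<partial>lebesgue_vec n)"
    unfolding phi_det_mult_vandermonde
    by (rule Bochner_Integration.integral_sum) (rule integral_Phi_permute, simp only: mem_Collect_eq)
  also have "\<dots> = 0"
    by (intro sum.neutral ballI) (simp only: mem_Collect_eq integral_Phi_permute(2) B)
  finally have "AE y in lebesgue_vec n. ?F y = 0"
    using integral_nonneg_eq_0_iff_AE[OF int AE_phi_det_vandermonde_nonneg] by simp
  then have "AE y in lebesgue_vec n. phi_det n \<phi> y = 0"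
    by eventually_elim (use phi_det_eq_0 in auto)
  then show False using not_AE_phi_det_zero by simp
qed

section \<open>The moment matrix and the biorthogonal functions\<close>

definition moment :: "nat \<Rightarrow> nat \<Rightarrow> real" where
  "moment k j = (\<integral>x. \<phi> k x * dpow (n - j) x \<partial>lborel)"

lemma integrable_\<phi>_pgrow:
  assumes "k \<in> {1..n}" and "pgrow (n - 1) g"
  shows "integrable lborel (\<lambda>x. \<phi> k x * g x)"
  by (rule integrable_mult_pgrow[OF sets_lborel \<phi>_measurable \<phi>_moment]) fact+

text \<open>Row \<open>k\<close> involves only \<open>y k\<close>, so every term of the determinant
  is a product over separate variables and integrates factor by factor.\<close>

lemma integral_prod_det:
  assumes f: "\<And>k j. k \<in> {1..n} \<Longrightarrow> j \<in> {1..n} \<Longrightarrow> integrable lborel (f k j)"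
  shows "integrable (lebesgue_vec n) (\<lambda>y. gdet {1..n} (\<lambda>k j. f k j (y k)))" (is ?int)
    and "(\<integral>y. gdet {1..n} (\<lambda>k j. f k j (y k)) \<partial>lebesgue_vec n) = gdet {1..n} (\<lambda>k j. \<integral>x. f k j x \<partial>lborel)" (is ?eq)
proof -
  have i: "integrable (lebesgue_vec n) (\<lambda>y. of_int (sign \<sigma>) * (\<Prod>k\<in>{1..n}. f k (\<sigma> k) (y k)))"
    and e: "(\<integral>y. of_int (sign \<sigma>) * (\<Prod>k\<in>{1..n}. f k (\<sigma> k) (y k)) \<partial>lebesgue_vec n) =
      of_int (sign \<sigma>) * (\<Prod>k\<in>{1..n}. \<integral>x. f k (\<sigma> k) x \<partial>lborel)"
    if "\<sigma> permutes {1..n}" for \<sigma>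
  proof -
    have f': "integrable lborel (f k (\<sigma> k))" if "k \<in> {1..n}" for k
      using that \<open>\<sigma> permutes {1..n}\<close> by (intro f) (simp_all only: permutes_in_image)
    show "integrable (lebesgue_vec n) (\<lambda>y. of_int (sign \<sigma>) * (\<Prod>k\<in>{1..n}. f k (\<sigma> k) (y k)))"
      unfolding lebesgue_vec_def by (intro integrable_mult_right lborel_prod.product_integrable_prod f') simp
    show "(\<integral>y. of_int (sign \<sigma>) * (\<Prod>k\<in>{1..n}. f k (\<sigma> k) (y k)) \<partial>lebesgue_vec n) =
      of_int (sign \<sigma>) * (\<Prod>k\<in>{1..n}. \<integral>x. f k (\<sigma> k) x \<partial>lborel)"
      unfolding lebesgue_vec_def by (simp only: integral_mult_right_zero lborel_prod.product_integral_prod[OF finite_atLeastAtMost f'])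
  qed
  show ?int unfolding gdet_def by (intro Bochner_Integration.integrable_sum i) simp
  have "(\<integral>y. gdet {1..n} (\<lambda>k j. f k j (y k)) \<partial>lebesgue_vec n) =
      (\<Sum>\<sigma> | \<sigma> permutes {1..n}. \<integral>y. of_int (sign \<sigma>) * (\<Prod>k\<in>{1..n}. f k (\<sigma> k) (y k)) \<partial>lebesgue_vec n)"
    unfolding gdet_def by (rule Bochner_Integration.integral_sum) (rule i, simp only: mem_Collect_eq)
  also have "\<dots> = gdet {1..n} (\<lambda>k j. \<integral>x. f k j x \<partial>lborel)"
    unfolding gdet_def by (intro sum.cong refl) (simp only: mem_Collect_eq e)
  finally show ?eq .
qed

lemma gdet_moment: "gdet {1..n} moment = vandermonde_const n * B_const n \<phi>"
proof -
  have "vandermonde_const n * Phi n \<phi> y = gdet {1..n} (\<lambda>k j. \<phi> k (y k) * dpow (n - j) (y k))" for y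
    unfolding gdet_scale_rows gdet_dpow Phi_def by (simp only: mult_ac)
  then have "vandermonde_const n * B_const n \<phi> = (\<integral>y. gdet {1..n} (\<lambda>k j. \<phi> k (y k) * dpow (n - j) (y k)) \<partial>lebesgue_vec n)"
    unfolding B_const_def by (subst integral_mult_right_zero[symmetric]) simp
  also have "\<dots> = gdet {1..n} moment"
    unfolding moment_def[abs_def]
    by (rule integral_prod_det(2)) (auto intro!: integrable_\<phi>_pgrow pgrow_dpow0)
  finally show ?thesis by simp
qed

lemma gdet_moment_nonzero: "gdet {1..n} moment \<noteq> 0"
  unfolding gdet_moment using vandermonde_const_pos[of n] B_const_nonzero by simp

text \<open>Cramer's rule for the inverse moment matrix. Column \<open>j\<close> of
  \<open>moment\<close> belongs to the power \<open>n - j\<close>, so index \<open>l\<close> belongs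
  to column \<open>n - l\<close>.\<close>

definition dual :: "nat \<Rightarrow> real \<Rightarrow> real" where
  "dual l x = (\<Sum>k\<in>{1..n}. \<phi> k x * (cofactor {1..n} moment k (n - l) / gdet {1..n} moment))"

lemma integral_dual:
  assumes "pgrow (n - 1) g"
  shows "integrable lborel (\<lambda>x. dual l x * g x)"
    and "(\<integral>x. dual l x * g x \<partial>lborel) =
      (\<Sum>k\<in>{1..n}. (\<integral>x. \<phi> k x * g x \<partial>lborel) * cofactor {1..n} moment k (n - l)) / gdet {1..n} moment"
proof -
  have eq: "dual l x * g x = (\<Sum>k\<in>{1..n}. \<phi> k x * g x * (cofactor {1..n} moment k (n - l) / gdet {1..n} moment))" for x
    unfolding dual_def sum_distrib_right by (intro sum.cong refl) (simp only: mult_ac)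
  have i: "integrable lborel (\<lambda>x. \<phi> k x * g x * (cofactor {1..n} moment k (n - l) / gdet {1..n} moment))" if "k \<in> {1..n}" for k
    using that assms by (intro integrable_mult_left integrable_\<phi>_pgrow)
  show "integrable lborel (\<lambda>x. dual l x * g x)" unfolding eq by (intro Bochner_Integration.integrable_sum i)
  show "(\<integral>x. dual l x * g x \<partial>lborel) =
      (\<Sum>k\<in>{1..n}. (\<integral>x. \<phi> k x * g x \<partial>lborel) * cofactor {1..n} moment k (n - l)) / gdet {1..n} moment"
    unfolding eq by (subst Bochner_Integration.integral_sum[OF i]) (simp_all add: sum_divide_distrib)
qed

sublocale biorthogonal lborel n dual
proof (unfold_locales)
  show "sets lborel = sets borel" by simp
  show "1 \<le> n" by (rule n_pos)
  show "dual l \<in> borel_measurable borel" if "l < n" for l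
    unfolding dual_def[abs_def] by (intro borel_measurable_sum borel_measurable_times \<phi>_measurable) auto
  show "integrable lborel (\<lambda>y. dual l y * (1 + \<bar>y\<bar>) ^ (n - 1))" if "l < n" for l
    by (rule integral_dual) (auto simp: pgrow_def intro!: exI[of _ 1])
  show "(\<integral>y. dual l y * dpow k y \<partial>lborel) = of_bool (l = k)" if l: "l < n" and k: "k < n" for l k
  proof -
    have "(\<integral>y. dual l y * dpow k y \<partial>lborel) =
        (\<Sum>j\<in>{1..n}. moment j (n - k) * cofactor {1..n} moment j (n - l)) / gdet {1..n} moment"
      using k by (subst integral_dual(2)) (auto intro!: pgrow_dpow0 simp: moment_def)
    also have "(\<Sum>j\<in>{1..n}. moment j (n - k) * cofactor {1..n} moment j (n - l)) = of_bool (n - l = n - k) * gdet {1..n} moment"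
      by (rule sum_cofactor_dual) (use l k in auto)
    finally show ?thesis using l k gdet_moment_nonzero by (auto simp: diff_diff_eq)
  qed
qed

end

section \<open>The kernel as an integral\<close>

context gt_weights
begin

definition coeff_matrix :: "nat \<Rightarrow> nat \<Rightarrow> real" where
  "coeff_matrix k j = cofactor {1..n} moment k j / gdet {1..n} moment"

text \<open>By \<open>sum_cofactor_dual\<close>, \<open>coeff_matrix\<close> is the transposed
  inverse of \<open>moment\<close>.\<close>

lemma gdet_coeff_matrix: "gdet {1..n} coeff_matrix * gdet {1..n} moment = 1"
proof -
  let ?J = "{1..n}"
  have "gdet ?J coeff_matrix * gdet ?J moment = gdet ?J (\<lambda>l j. coeff_matrix j l) * gdet ?J moment"
    using gdet_transpose[of ?J coeff_matrix] by simp
  also have "\<dots> = gdet ?J (\<lambda>l l'. \<Sum>j\<in>?J. coeff_matrix j l * moment j l')"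
    by (rule gdet_mult[symmetric]) simp
  also have "\<dots> = gdet ?J (\<lambda>l l'. of_bool (l = l'))"
  proof (rule gdet_cong)
    fix l l' assume l: "l \<in> ?J" "l' \<in> ?J"
    have "(\<Sum>j\<in>?J. coeff_matrix j l * moment j l') = (\<Sum>j\<in>?J. moment j l' * cofactor ?J moment j l) / gdet ?J moment"
      unfolding coeff_matrix_def sum_divide_distrib by (intro sum.cong) auto
    also have "\<dots> = of_bool (l = l')"
      using gdet_moment_nonzero by (simp only: sum_cofactor_dual[OF finite_atLeastAtMost l]) simp
    finally show "(\<Sum>j\<in>?J. coeff_matrix j l * moment j l') = of_bool (l = l')" .
  qed
  also have "\<dots> = 1" by (rule gdet_id) simp
  finally show ?thesis .
qed

lemma gdet_dual: "gdet {1..n} (\<lambda>i j. dual (n - j) (y i)) = phi_det n \<phi> y * gdet {1..n} coeff_matrix"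
proof -
  have "gdet {1..n} (\<lambda>i j. dual (n - j) (y i)) = gdet {1..n} (\<lambda>i j. \<Sum>k\<in>{1..n}. \<phi> k (y i) * coeff_matrix k j)"
    by (rule gdet_cong) (simp add: dual_def coeff_matrix_def)
  also have "\<dots> = phi_det n \<phi> y * gdet {1..n} coeff_matrix"
    unfolding phi_det_def by (rule gdet_mult) simp
  finally show ?thesis .
qed

text \<open>The sign from the factorisation, the change of basis from the weights to
  \<open>dual\<close>, and the normalisation. Once \<open>gt_density\<close> is available,
  \<open>\<kappa>_eq_1\<close> shows that the product is 1.\<close>

definition scale :: real where
  "scale = top_sign n * gdet {1..n} coeff_matrix * Z"

text \<open>In \<open>corr_particle_index\<close> the factor of \<open>Rmat\<close> is the indicator
  of \<open>GT_closed\<close>, and the factor of row \<open>n\<close> is the determinant of the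
  weights up to the change of basis.\<close>

lemma corr_eq_nu_density:
  assumes inj: "inj_on z (particle_index n)"
    and sorted: "\<And>r i j. 1 \<le> i \<Longrightarrow> i < j \<Longrightarrow> j \<le> r \<Longrightarrow> r \<le> n \<Longrightarrow> z (r, j) < z (r, i)"
  shows "corr (particle_index n) fst z = scale * nu_density n \<phi> Z (\<lambda>r\<in>{1..n}. \<lambda>i\<in>{1..r}. z (r, i))"
proof -
  let ?y = "\<lambda>r\<in>{1..n}. \<lambda>i\<in>{1..r}. z (r, i)"
  let ?inter = "\<forall>i r. 1 \<le> i \<and> i \<le> r \<and> r \<le> n - 1 \<longrightarrow> z (r + 1, i) \<ge> z (r, i) \<and> z (r, i) \<ge> z (r + 1, i + 1)"
  have "?y r \<in> weyl_chamber_closure r" if "r \<in> {1..n}" for r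
    using that sorted[of _ _ r] by (auto simp: weyl_chamber_closure_eq intro: less_imp_le)
  then have Pi: "?y \<in> (\<Pi>\<^sub>E r\<in>{1..n}. weyl_chamber_closure r)" by (intro PiE_I) auto
  have val: "?y r i = z (r, i)" if "1 \<le> i" "i \<le> r" "r \<le> n" for r i using that by simp
  have "?y \<in> GT_closed n \<longleftrightarrow>
      (\<forall>i r. 1 \<le> i \<and> i \<le> r \<and> r \<le> n - 1 \<longrightarrow> ?y (r + 1) i \<ge> ?y r i \<and> ?y r i \<ge> ?y (r + 1) (i + 1))"
    using Pi by (simp only: GT_closed_def mem_Collect_eq simp_thms)
  also have "\<dots> \<longleftrightarrow> ?inter"
  proof (intro iff_allI imp_cong refl)
    fix i r assume *: "1 \<le> i \<and> i \<le> r \<and> r \<le> n - 1"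
    have "?y (r + 1) i = z (r + 1, i)" "?y r i = z (r, i)" "?y (r + 1) (i + 1) = z (r + 1, i + 1)"
      using * n_pos by (intro val; linarith)+
    then show "(?y (r + 1) i \<ge> ?y r i \<and> ?y r i \<ge> ?y (r + 1) (i + 1)) = (z (r + 1, i) \<ge> z (r, i) \<and> z (r, i) \<ge> z (r + 1, i + 1))"
      by (simp only:)
  qed
  finally have ind: "indicator (GT_closed n) ?y = (of_bool ?inter :: real)"
    by (simp only: indicator_def)
  have top: "phi_det n \<phi> (?y n) = phi_det n \<phi> (\<lambda>i. z (n, i))"
    by (rule phi_det_cong) (use n_pos in auto)
  have Rm: "gdet (particle_index n) (Rmat n z) = of_bool ?inter"
    by (rule gdet_Rmat_sorted[OF inj]) (rule sorted)
  have alg: "a * (p * c) * b = a * c * Z * (b * (1 / Z * p))" for a b c p :: real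
    using Z_pos by simp
  show ?thesis
    unfolding corr_particle_index Rm gdet_dual nu_density_eq ind top scale_def by (rule alg)
qed

sublocale gt_density n dual "nu_density n \<phi> Z" scale
proof (unfold_locales)
  show "nu_density n \<phi> Z \<in> borel_measurable (lebesgue_pattern n)" by (rule density_measurable)
  show "AE y in lebesgue_pattern n. 0 \<le> nu_density n \<phi> Z y" by (rule density_nonneg)
  show "(\<integral>\<^sup>+y. ennreal (nu_density n \<phi> Z y) \<partial>lebesgue_pattern n) = 1" by (rule density_prob)
  show "nu_density n \<phi> Z y = 0" if "y \<notin> GT_closed n" for y using that by (simp add: nu_density_eq)
  show "scale \<noteq> 0"
    using gdet_coeff_matrix top_sign_nonzero[of n] Z_pos by (auto simp: scale_def)
qed (rule corr_eq_nu_density)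

end

section \<open>Permuted chambers and derivatives of Lagrange polynomials\<close>

lemma permuted_chambers_eq: "permuted_chambers n = {y \<in> space (lebesgue_vec n). inj_on y {1..n}}"
proof (intro equalityI subsetI)
  fix y assume "y \<in> permuted_chambers n"
  then obtain \<sigma> w where \<sigma>: "\<sigma> permutes {1..n}" and w: "w \<in> weyl_chamber n" and y: "y = w \<circ> \<sigma>"
    by (auto simp: permuted_chambers_def)
  have less: "w j < w i" if "1 \<le> i" "i < j" "j \<le> n" for i j
    using w that by (simp add: weyl_chamber_def)
  have "inj_on w (\<sigma> ` {1..n})"
    unfolding permutes_image[OF \<sigma>]
  proof (rule inj_onI, rule ccontr)
    fix i j assume ij: "i \<in> {1..n}" "j \<in> {1..n}" "w i = w j" "i \<noteq> j"
    then consider "i < j" | "j < i" by linarith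
    then show False using ij less[of i j] less[of j i] by cases auto
  qed
  then have "inj_on y {1..n}"
    unfolding y by (intro comp_inj_on inj_on_subset[OF permutes_inj[OF \<sigma>]]) auto
  moreover have "y \<in> extensional {1..n}"
    using w permutes_not_in[OF \<sigma>] by (auto simp: y weyl_chamber_def extensional_def PiE_iff)
  ultimately show "y \<in> {y \<in> space (lebesgue_vec n). inj_on y {1..n}}"
    by (auto simp: lebesgue_vec_def space_PiM PiE_iff)
next
  fix y assume "y \<in> {y \<in> space (lebesgue_vec n). inj_on y {1..n}}"
  then have ext: "y \<in> extensional {1..n}" and inj: "inj_on y {1..n}"
    by (auto simp: lebesgue_vec_def space_PiM PiE_iff)
  obtain \<sigma> where \<sigma>: "\<sigma> permutes {1..n}"
      and less: "\<And>i j. 1 \<le> i \<Longrightarrow> i < j \<Longrightarrow> j \<le> n \<Longrightarrow> y (\<sigma> j) < y (\<sigma> i)"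
    using ex_sorting_permutation[OF inj] by blast
  let ?\<tau> = "inv_into UNIV \<sigma>" and ?w = "\<lambda>i\<in>{1..n}. y (\<sigma> i)"
  have \<tau>: "?\<tau> permutes {1..n}" by (rule permutes_inv[OF \<sigma>])
  have "?w \<in> weyl_chamber n" using less by (auto simp: weyl_chamber_def)
  moreover have "y = ?w \<circ> ?\<tau>"
  proof
    fix i
    show "y i = (?w \<circ> ?\<tau>) i"
    proof (cases "i \<in> {1..n}")
      case True
      then have "?\<tau> i \<in> {1..n}" by (simp only: permutes_in_image[OF \<tau>])
      then show ?thesis by (simp add: permutes_inverses[OF \<sigma>])
    next
      case False
      then have "?\<tau> i = i" by (rule permutes_not_in[OF \<tau>])
      then show ?thesis using False ext by (auto simp: extensional_def)
    qed
  qed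
  ultimately show "y \<in> permuted_chambers n"
    using \<tau> unfolding permuted_chambers_def by blast
qed

lemma permuted_chambers_sets: "permuted_chambers n \<in> sets (lebesgue_vec n)"
proof -
  have [measurable]: "(\<lambda>y. y i) \<in> borel_measurable (lebesgue_vec n)" if "i \<in> {1..n}" for i
    using that by (rule measurable_lebesgue_vec_component)
  have "vandermonde n \<in> borel_measurable (lebesgue_vec n)"
    unfolding vandermonde_def[abs_def]
    by (intro borel_measurable_prod borel_measurable_diff measurable_lebesgue_vec_component) auto
  then have "{y \<in> space (lebesgue_vec n). vandermonde n y \<noteq> 0} \<in> sets (lebesgue_vec n)" by measurable
  then show ?thesis by (simp only: permuted_chambers_eq vandermonde_eq_0_iff not_not)
qed

lemma AE_permuted_chambers: "AE y in lebesgue_vec n. y \<in> permuted_chambers n"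
proof -
  have "AE y in lebesgue_vec n. inj_on y {1..n}"
    unfolding lebesgue_vec_def by (rule AE_inj_on_PiM_lborel) simp
  with AE_space show ?thesis unfolding permuted_chambers_eq by eventually_elim simp
qed

lemma deriv_dpow_sum:
  "(deriv ^^ d) (\<lambda>t. \<Sum>l\<in>A. c l * dpow (k l) t) = (\<lambda>t. \<Sum>l\<in>A. c l * ediff d (k l) t)"
proof (induction d)
  case 0
  show ?case by (simp add: ediff_def)
next
  case (Suc d)
  have "((\<lambda>t. \<Sum>l\<in>A. c l * ediff d (k l) t) has_real_derivative (\<Sum>l\<in>A. c l * ediff (Suc d) (k l) t)) (at t)" for t
    by (intro DERIV_sum DERIV_cmult ediff_has_derivative)
  then have "deriv (\<lambda>t. \<Sum>l\<in>A. c l * ediff d (k l) t) = (\<lambda>t. \<Sum>l\<in>A. c l * ediff (Suc d) (k l) t)"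
    by (intro ext DERIV_imp_deriv)
  then show ?case by (simp only: funpow.simps comp_apply Suc.IH)
qed

text \<open>\<open>\<Phi>\<^sub>n(y)\<close> times the \<open>j\<close>-th Lagrange polynomial at \<open>t\<close> replaces \<open>y\<^sub>j\<close> by \<open>t\<close> in the Vandermonde
  determinant, so that the derivative in \<open>t\<close> only affects row \<open>j\<close>.\<close>

lemma Phi_lagrange_deriv:
  assumes j: "j \<in> {1..n}" and inj: "inj_on y {1..n}"
  shows "vandermonde_const n * (Phi n \<phi> y * lagrange_deriv n d j y v) =
    (\<Prod>k\<in>{1..n}. \<phi> k (y k)) * gdet {1..n} (\<lambda>i k. if i = j then ediff d (n - k) v else dpow (n - k) (y i))"
proof -
  let ?J = "{1..n}" and ?M = "\<lambda>i k. dpow (n - k) (y i)"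
  have V: "vandermonde n y \<noteq> 0" using inj by (simp only: vandermonde_eq_0_iff not_not)
  have nz: "(\<Prod>i\<in>?J - {j}. y j - y i) \<noteq> 0"
  proof -
    have "y j - y i \<noteq> 0" if "i \<in> ?J - {j}" for i using inj_onD[OF inj, of j i] that j by auto
    then show ?thesis by (simp add: prod_zero_iff)
  qed
  let ?c = "\<lambda>l. cofactor ?J ?M j l / (vandermonde_const n * vandermonde n y)"
  have vc: "vandermonde_const n \<noteq> 0" using vandermonde_const_pos[of n] by simp
  have "(\<Prod>i\<in>?J - {j}. (t - y i) / (y j - y i)) = (\<Sum>l\<in>?J. ?c l * dpow (n - l) t)" for t
  proof -
    have "(\<Prod>i\<in>?J - {j}. (t - y i) / (y j - y i)) = vandermonde n (y(j := t)) / vandermonde n y"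
      using vandermonde_update[OF j, of y t] nz V by (simp add: prod_dividef frac_eq_eq mult.commute)
    also have "\<dots> = gdet ?J (\<lambda>i k. dpow (n - k) ((y(j := t)) i)) / (vandermonde_const n * vandermonde n y)"
      by (simp only: gdet_dpow mult_divide_mult_cancel_left[OF vc])
    also have "gdet ?J (\<lambda>i k. dpow (n - k) ((y(j := t)) i)) = gdet ?J (\<lambda>i k. if i = j then dpow (n - k) t else ?M i k)"
      by (rule gdet_cong) simp
    also have "\<dots> = (\<Sum>l\<in>?J. dpow (n - l) t * cofactor ?J ?M j l)"
      by (rule sum_row_cofactor[symmetric]) (use j in auto)
    finally show ?thesis unfolding sum_divide_distrib by (simp add: mult.commute)
  qed
  then have "lagrange_deriv n d j y v = (\<Sum>l\<in>?J. ?c l * ediff d (n - l) v)"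
    unfolding lagrange_deriv_def by (simp only: deriv_dpow_sum)
  also have "\<dots> = (\<Sum>l\<in>?J. ediff d (n - l) v * cofactor ?J ?M j l) / (vandermonde_const n * vandermonde n y)"
    unfolding sum_divide_distrib by (simp add: mult.commute)
  also have "(\<Sum>l\<in>?J. ediff d (n - l) v * cofactor ?J ?M j l) = gdet ?J (\<lambda>i k. if i = j then ediff d (n - k) v else ?M i k)"
    by (rule sum_row_cofactor) (use j in auto)
  finally show ?thesis using vc V by (simp add: Phi_def)
qed

context gt_weights
begin

text \<open>By \<open>Phi_lagrange_deriv\<close> the \<open>j\<close>-th summand is a determinant
  whose row \<open>j\<close> holds derivatives at \<open>v\<close>, weighted by \<open>f\<close>.
  Integrated row by row it becomes the moment determinant with row \<open>j\<close> replaced, and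
  expansion along that row gives the cofactors from which \<open>dual\<close> is built.\<close>

lemma kernel_integral:
  assumes f: "pgrow (n - 1) f"
  shows "1 / B_const n \<phi> * (LINT y:permuted_chambers n|lebesgue_vec n.
      Phi n \<phi> y * (\<Sum>j\<in>{1..n}. f (y j) * lagrange_deriv n (n - s) j y v)) = (\<integral>y. \<beta> s v y * f y \<partial>lborel)"
proof -
  let ?J = "{1..n}"
  let ?e = "\<lambda>k. ediff (n - s) (n - k) v"
  let ?a = "\<lambda>j. \<integral>x. \<phi> j x * f x \<partial>lborel"
  let ?M = "\<lambda>y j i k. if i = j then ?e k else dpow (n - k) (y i)"
  have vc: "vandermonde_const n \<noteq> 0" using vandermonde_const_pos[of n] by simp
  \<comment> \<open>The factor \<open>f (y j)\<close> is put into row \<open>j\<close> of the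
    determinant, so that each row still depends on one variable only.\<close>
  define g where "g j i k x = (if i = j then \<phi> i x * f x * ?e k else \<phi> i x * dpow (n - k) x)" for j i k x
  have gi: "integrable lborel (g j i k)"
    and ge: "(\<integral>x. g j i k x \<partial>lborel) = (if i = j then ?a j * ?e k else moment i k)"
    if i: "i \<in> ?J" and k: "k \<in> ?J" for j i k
  proof -
    have 1: "integrable lborel (\<lambda>x. \<phi> i x * f x * ?e k)"
      using i by (intro integrable_mult_left integrable_\<phi>_pgrow f)
    have 2: "integrable lborel (\<lambda>x. \<phi> i x * dpow (n - k) x)"
      using i k by (intro integrable_\<phi>_pgrow pgrow_dpow0) auto
    show "integrable lborel (g j i k)"
      using 1 2 by (cases "i = j") (simp_all only: g_def[abs_def] simp_thms if_True if_False)
    show "(\<integral>x. g j i k x \<partial>lborel) = (if i = j then ?a j * ?e k else moment i k)"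
      by (cases "i = j") (simp_all only: g_def simp_thms if_True if_False integral_mult_left_zero moment_def)
  qed
  have pointwise: "vandermonde_const n * (Phi n \<phi> y * (\<Sum>j\<in>?J. f (y j) * lagrange_deriv n (n - s) j y v)) =
      (\<Sum>j\<in>?J. gdet ?J (\<lambda>i k. g j i k (y i)))" if "y \<in> permuted_chambers n" for y
  proof -
    have inj: "inj_on y ?J" using that by (simp add: permuted_chambers_eq)
    have "vandermonde_const n * (Phi n \<phi> y * (\<Sum>j\<in>?J. f (y j) * lagrange_deriv n (n - s) j y v)) =
        (\<Sum>j\<in>?J. f (y j) * (vandermonde_const n * (Phi n \<phi> y * lagrange_deriv n (n - s) j y v)))"
      unfolding sum_distrib_left by (intro sum.cong refl) (simp only: mult_ac)
    also have "\<dots> = (\<Sum>j\<in>?J. gdet ?J (\<lambda>i k. g j i k (y i)))"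
    proof (intro sum.cong refl)
      fix j assume j: "j \<in> ?J"
      let ?c = "\<lambda>i. \<phi> i (y i) * (if i = j then f (y i) else 1)"
      have "gdet ?J (\<lambda>i k. g j i k (y i)) = gdet ?J (\<lambda>i k. ?c i * ?M y j i k)"
        by (rule gdet_cong) (simp add: g_def)
      also have "\<dots> = (\<Prod>i\<in>?J. ?c i) * gdet ?J (?M y j)" by (rule gdet_scale_rows)
      also have "(\<Prod>i\<in>?J. ?c i) = (\<Prod>i\<in>?J. \<phi> i (y i)) * f (y j)"
        using j by (simp add: prod.distrib)
      finally show "f (y j) * (vandermonde_const n * (Phi n \<phi> y * lagrange_deriv n (n - s) j y v)) =
          gdet ?J (\<lambda>i k. g j i k (y i))"
        unfolding Phi_lagrange_deriv[OF j inj] by (simp only: mult_ac)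
    qed
    finally show ?thesis .
  qed
  let ?G = "\<lambda>y. 1 / vandermonde_const n * (\<Sum>j\<in>?J. gdet ?J (\<lambda>i k. g j i k (y i)))"
  note iG = integral_prod_det[of "g j" for j, OF gi]
  have Gint: "integrable (lebesgue_vec n) ?G"
    by (intro integrable_mult_right Bochner_Integration.integrable_sum iG(1))
  have "(LINT y:permuted_chambers n|lebesgue_vec n. Phi n \<phi> y * (\<Sum>j\<in>?J. f (y j) * lagrange_deriv n (n - s) j y v)) =
      (LINT y:permuted_chambers n|lebesgue_vec n. ?G y)"
    unfolding set_lebesgue_integral_def
  proof (rule Bochner_Integration.integral_cong[OF refl])
    fix y
    show "indicator (permuted_chambers n) y *\<^sub>R (Phi n \<phi> y * (\<Sum>j\<in>?J. f (y j) * lagrange_deriv n (n - s) j y v)) =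
        indicator (permuted_chambers n) y *\<^sub>R ?G y"
    proof (cases "y \<in> permuted_chambers n")
      case True
      show ?thesis unfolding pointwise[OF True, symmetric] using vc by simp
    qed simp
  qed
  also have "\<dots> = (\<integral>y. ?G y \<partial>lebesgue_vec n)"
    unfolding set_lebesgue_integral_def
  proof (rule integral_cong_AE)
    show "?G \<in> borel_measurable (lebesgue_vec n)" using Gint by (rule borel_measurable_integrable)
    then show "(\<lambda>y. indicator (permuted_chambers n) y *\<^sub>R ?G y) \<in> borel_measurable (lebesgue_vec n)"
      by (intro borel_measurable_scaleR borel_measurable_indicator permuted_chambers_sets)
    show "AE y in lebesgue_vec n. indicator (permuted_chambers n) y *\<^sub>R ?G y = ?G y"
      using AE_permuted_chambers by eventually_elim simp
  qed
  also have "\<dots> = 1 / vandermonde_const n * (\<Sum>j\<in>?J. gdet ?J (\<lambda>i k. \<integral>x. g j i k x \<partial>lborel))"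
    unfolding integral_mult_right_zero by (simp only: Bochner_Integration.integral_sum[OF iG(1)] iG(2))
  also have "(\<Sum>j\<in>?J. gdet ?J (\<lambda>i k. \<integral>x. g j i k x \<partial>lborel)) = (\<Sum>j\<in>?J. \<Sum>k\<in>?J. ?a j * ?e k * cofactor ?J moment j k)"
  proof (intro sum.cong refl)
    fix j assume j: "j \<in> ?J"
    have "gdet ?J (\<lambda>i k. \<integral>x. g j i k x \<partial>lborel) = gdet ?J (\<lambda>i k. if i = j then ?a j * ?e k else moment i k)"
      by (rule gdet_cong) (simp only: ge)
    also have "\<dots> = (\<Sum>k\<in>?J. ?a j * ?e k * cofactor ?J moment j k)"
      by (rule sum_row_cofactor[symmetric]) (use j in auto)
    finally show "gdet ?J (\<lambda>i k. \<integral>x. g j i k x \<partial>lborel) = \<dots>" .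
  qed
  finally have 1: "(LINT y:permuted_chambers n|lebesgue_vec n. Phi n \<phi> y * (\<Sum>j\<in>?J. f (y j) * lagrange_deriv n (n - s) j y v)) =
      1 / vandermonde_const n * (\<Sum>j\<in>?J. \<Sum>k\<in>?J. ?a j * ?e k * cofactor ?J moment j k)" .
  have "(\<integral>y. \<beta> s v y * f y \<partial>lborel) = (\<Sum>l<n. (\<integral>y. dual l y * f y \<partial>lborel) * ediff (n - s) l v)"
    by (rule integral_\<beta>(2)[OF f])
  also have "\<dots> = (\<Sum>k\<in>?J. (\<integral>y. dual (n - k) y * f y \<partial>lborel) * ?e k)"
    by (rule sum.reindex_bij_witness[of _ "\<lambda>k. n - k" "\<lambda>l. n - l"]) auto
  also have "\<dots> = (\<Sum>k\<in>?J. (\<Sum>j\<in>?J. ?a j * cofactor ?J moment j k) / gdet ?J moment * ?e k)"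
    by (intro sum.cong refl) (simp add: integral_dual(2)[OF f])
  also have "\<dots> = (\<Sum>k\<in>?J. \<Sum>j\<in>?J. ?a j * ?e k * cofactor ?J moment j k) / gdet ?J moment"
    unfolding sum_divide_distrib sum_distrib_right by (intro sum.cong refl) simp
  also have "(\<Sum>k\<in>?J. \<Sum>j\<in>?J. ?a j * ?e k * cofactor ?J moment j k) = (\<Sum>j\<in>?J. \<Sum>k\<in>?J. ?a j * ?e k * cofactor ?J moment j k)"
    by (rule sum.swap)
  finally have 2: "(\<integral>y. \<beta> s v y * f y \<partial>lborel) =
      (\<Sum>j\<in>?J. \<Sum>k\<in>?J. ?a j * ?e k * cofactor ?J moment j k) / gdet ?J moment" .
  show ?thesis unfolding 1 2 gdet_moment by simp
qed

text \<open>\<open>oind v y u\<close> is 1 for \<open>v \<le> u < y\<close> and -1 for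
  \<open>y \<le> u < v\<close>; the two cases become the two integrals.\<close>

lemma K_formula:
  assumes r: "r \<in> {1..n - 1}" and s: "s \<in> {1..n}"
  shows "K (r, u) (s, v) =
    1 / B_const n \<phi> * (LINT y:permuted_chambers n|lebesgue_vec n. kernel_integrand_upper n \<phi> r u s v y)
  - 1 / B_const n \<phi> * (LINT y:permuted_chambers n|lebesgue_vec n. kernel_integrand_lower n \<phi> r u s v y)"
proof -
  let ?up = "\<lambda>x. of_bool (v \<le> u \<and> u < x) * dpow (n - r - 1) (x - u)"
  let ?low = "\<lambda>x. of_bool (v > u \<and> u \<ge> x) * dpow (n - r - 1) (x - u)"
  have up: "pgrow (n - 1) ?up" and low: "pgrow (n - 1) ?low"
    by (rule pgrow_mult_bounded[OF pgrow_dpow, where B = 1]; simp add: of_bool_def)+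
  have "K (r, u) (s, v) = (\<integral>y. \<beta> s v y * (oind v y u * dpow (n - r - 1) (y - u)) \<partial>lborel)"
    using Kf_oind[of r s u v] r s n_pos by auto
  also have "\<dots> = (\<integral>y. \<beta> s v y * ?up y - \<beta> s v y * ?low y \<partial>lborel)"
    by (rule Bochner_Integration.integral_cong[OF refl]) (auto simp: oind_def)
  also have "\<dots> = (\<integral>y. \<beta> s v y * ?up y \<partial>lborel) - (\<integral>y. \<beta> s v y * ?low y \<partial>lborel)"
    by (rule Bochner_Integration.integral_diff[OF integral_\<beta>(1)[OF up] integral_\<beta>(1)[OF low]])
  also have "(\<integral>y. \<beta> s v y * ?up y \<partial>lborel) =
      1 / B_const n \<phi> * (LINT y:permuted_chambers n|lebesgue_vec n. kernel_integrand_upper n \<phi> r u s v y)"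
    using kernel_integral[OF up, of s v] by (simp only: kernel_integrand_upper_def dpow_def)
  also have "(\<integral>y. \<beta> s v y * ?low y \<partial>lborel) =
      1 / B_const n \<phi> * (LINT y:permuted_chambers n|lebesgue_vec n. kernel_integrand_lower n \<phi> r u s v y)"
    using kernel_integral[OF low, of s v] by (simp only: kernel_integrand_lower_def dpow_def)
  finally show ?thesis .
qed

end

theorem theorem2p1:
  fixes n :: nat and \<phi> :: "nat \<Rightarrow> real \<Rightarrow> real" and Z :: real
  assumes "n \<ge> 1" and "Z > 0"
    and "defines_probability n \<phi> Z"
    and "integrable (lebesgue_vec n) (Phi n \<phi>)"
    and "\<And>r s u v. r \<in> {1..n - 1} \<Longrightarrow> s \<in> {1..n} \<Longrightarrow>
           set_integrable (lebesgue_vec n) (permuted_chambers n) (kernel_integrand_upper n \<phi> r u s v)"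
    and "\<And>r s u v. r \<in> {1..n - 1} \<Longrightarrow> s \<in> {1..n} \<Longrightarrow>
           set_integrable (lebesgue_vec n) (permuted_chambers n) (kernel_integrand_lower n \<phi> r u s v)"
  shows "B_const n \<phi> \<noteq> 0 \<and>
    (\<exists>K :: nat \<times> real \<Rightarrow> nat \<times> real \<Rightarrow> real.
       determinantal (restrict_space (nu n \<phi> Z) (GT_patterns n)) (particle_index n) particle
         (reference_measure n) K \<and>
       (\<forall>r\<in>{1..n - 1}. \<forall>s\<in>{1..n}. \<forall>u v.
          K (r, u) (s, v) =
            1 / B_const n \<phi> *
              (LINT y:permuted_chambers n|lebesgue_vec n. kernel_integrand_upper n \<phi> r u s v y)
          - 1 / B_const n \<phi> *
              (LINT y:permuted_chambers n|lebesgue_vec n. kernel_integrand_lower n \<phi> r u s v y)))"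
proof -
  interpret gt_weights n \<phi> Z
    using assms(1-4) by unfold_locales auto
  show ?thesis
    using B_const_nonzero determinantal_K[unfolded \<nu>_def nu_def[symmetric]] K_formula by blast
qed

end
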